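(* There is an absolute constant $C \ge 1$ such that for all integers $n \ge 3$ and $\ell \ge 3$ with $\ell \ge C\frac{\log n}{\log\log n}$ we have $r(C_\ell, K_n) = (\ell-1)(n-1)+1$.
   Context: All logarithms are to base $2$. For graphs $G,H$, the Ramsey number $r(G,H)$ is the smallest natural number $N$ such that every red/blue colouring of the edges of the complete graph $K_N$ contains a red copy of $G$ or a blue copy of $H$ (as not necessarily induced subgraphs). $C_\ell$ is the cycle of length $\ell$ and $K_n$ is the complete graph on $n$ vertices. *)

theory Defs
  imports Complex_Main "HOL-Library.Ramsey"
begin

text \<open>
  A finite simple graph is a pair of a vertex set and a set of edges, each edge being a
  two-element subset of the vertex set. The notation \<open>[V]\<^bsup>2\<^esup>\<close> is \<^const>\<open>nsets\<close> from the
  Ramsey theory of the library.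
\<close>

type_synonym 'a graph = "'a set \<times> 'a set set"

definition verts :: "'a graph \<Rightarrow> 'a set" where
  "verts G = fst G"

definition edges :: "'a graph \<Rightarrow> 'a set set" where
  "edges G = snd G"

definition complete_graph :: "nat \<Rightarrow> nat graph" where
  "complete_graph n = ({..<n}, [{..<n}]\<^bsup>2\<^esup>)"

text \<open>This is a cycle only for \<open>l \<ge> 3\<close>; smaller values of \<open>l\<close> have no meaning here.\<close>

definition cycle_graph :: "nat \<Rightarrow> nat graph" where
  "cycle_graph l = ({..<l}, {{i, (i + 1) mod l} | i. i < l})"

text \<open>\<open>H\<close> contains a copy of \<open>G\<close>, as a not necessarily induced subgraph.\<close>

definition contains_copy :: "'b graph \<Rightarrow> 'a graph \<Rightarrow> bool" where
  "contains_copy H G \<longleftrightarrow>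
     (\<exists>f. inj_on f (verts G) \<and> f ` verts G \<subseteq> verts H \<and> (\<forall>e\<in>edges G. f ` e \<in> edges H))"

text \<open>
  A red/blue colouring of the edges of \<open>K\<^sub>N\<close> is given by its set \<open>R\<close> of red edges; all other
  edges are blue.
\<close>

definition ramsey_property :: "'a graph \<Rightarrow> 'b graph \<Rightarrow> nat \<Rightarrow> bool" where
  "ramsey_property G H N \<longleftrightarrow>
     (\<forall>R \<subseteq> edges (complete_graph N).
        contains_copy (verts (complete_graph N), R) G \<or>
        contains_copy (verts (complete_graph N), edges (complete_graph N) - R) H)"

text \<open>
  By Ramsey's theorem the least number exists whenever \<open>G\<close> and \<open>H\<close> are finite simple graphs.
\<close>

definition ramsey_number :: "'a graph \<Rightarrow> 'b graph \<Rightarrow> nat" where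
  "ramsey_number G H = (LEAST N. ramsey_property G H N)"

end

theory Submission
  imports Defs
begin

text \<open>
  Fix \<open>l\<close> and let \<open>G\<close> be a counterexample with \<open>n\<close> minimal, so \<open>n\<close> is at most a small power of
  \<open>l ^ l\<close>.  Then every independent set \<open>I\<close> has more than \<open>(l - 1) * card I\<close> vertices in its closed
  neighbourhood.  A ball \<open>B\<close> of some radius at most \<open>l / 8\<close> grows by a factor of at most a small
  power \<open>K\<close> of \<open>l\<close> in two further steps, so \<open>B\<close> has independence number at most about
  \<open>K * card B / l\<close>.

  In a layer of the breadth-first search a long path closes up to a cycle of length \<open>l\<close>, and a
  graph without long paths whose independence number is small contains a small highly connected
  piece with few independent vertices (a cluster).  Hence all but a tiny part of \<open>B\<close> is covered
  by disjoint clusters lying in layers.  Clusters are panconnected, so each has fewer than \<open>l\<close>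
  vertices, also after absorbing the clusters attached to it by many disjoint edges.  As all
  degrees are at least \<open>l - 1\<close>, a matching whose size is proportional to that of the cluster
  leaves it.  Contracting the clusters therefore gives a graph of large average degree; a path in
  it, closed through the breadth-first search tree, yields a cycle whose length can be tuned to
  exactly \<open>l\<close> inside the clusters.
\<close>

section \<open>Independence number, paths and connectivity\<close>

text \<open>A cluster has fewer than \<open>l\<close> vertices, so by the degree condition each of
  its vertices has a neighbour outside; the obstacle is that these neighbours may coincide. If a
  maximum matching out of the cluster were small, the neighbourhoods of almost all its vertices
  would lie in a set barely larger than \<open>l\<close>, and such a set contains a cycle of length
  exactly \<open>l\<close>.

  Clusters occur at two scales because matching edges are lost in two ways. Edges into uncovered
  vertices stay distinct after contraction, whereas nearly \<open>kp\<close> edges into one cluster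
  may merge into a single edge. So the vertices in no cluster need only be rare, while the number of
  clusters must be smaller by a much larger power of \<open>K\<close>; big clusters have to fill
  half of the ball.

  The tree path contributes \<open>2 * h - 1\<close> vertices with \<open>h\<close> beyond control.
  Exactness comes from the big clusters: each can be crossed with any number of vertices from
  \<open>2 * m + 2\<close> to \<open>s1\<close>, so about \<open>K ^ 3\<close> of them reach every
  relevant length.\<close>

locale ugraph =
  fixes E :: "'a \<Rightarrow> 'a \<Rightarrow> bool"
  assumes E_sym: "E x y \<Longrightarrow> E y x"
    and E_irrefl: "\<not> E x x"
begin

definition indep :: "'a set \<Rightarrow> bool" where
  "indep I \<longleftrightarrow> (\<forall>x\<in>I. \<forall>y\<in>I. \<not> E x y)"

definition alpha :: "'a set \<Rightarrow> nat" where
  "alpha A = Max (card ` {I. I \<subseteq> A \<and> indep I})"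

definition nadj :: "'a set \<Rightarrow> 'a set \<Rightarrow> bool" where
  "nadj A B \<longleftrightarrow> (\<forall>x\<in>A. \<forall>y\<in>B. \<not> E x y)"

definition pth :: "'a set \<Rightarrow> 'a list \<Rightarrow> bool" where
  "pth A xs \<longleftrightarrow> xs \<noteq> [] \<and> distinct xs \<and> set xs \<subseteq> A \<and> successively E xs"

definition edge_rel :: "'a set \<Rightarrow> ('a \<times> 'a) set" where
  "edge_rel A = {(x, y). x \<in> A \<and> y \<in> A \<and> E x y}"

definition conn :: "'a set \<Rightarrow> bool" where
  "conn A \<longleftrightarrow> (\<forall>x\<in>A. \<forall>y\<in>A. (x, y) \<in> (edge_rel A)\<^sup>*)"

definition component :: "'a set \<Rightarrow> 'a \<Rightarrow> 'a set" where
  "component A x = {y. (x, y) \<in> (edge_rel A)\<^sup>*}"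

text \<open>No lower bound on \<open>card A\<close> is built in, and \<open>conn {}\<close> holds,
  so cliques of any size are \<open>k\<close>-connected for every \<open>k\<close>. Statements on
  degrees therefore ask for \<open>k < card X\<close> separately.\<close>

definition kconn :: "nat \<Rightarrow> 'a set \<Rightarrow> bool" where
  "kconn k A \<longleftrightarrow> (\<forall>C. C \<subseteq> A \<longrightarrow> card C < k \<longrightarrow> conn (A - C))"

text \<open>This is a cycle in the usual sense only for \<open>l \<ge> 3\<close>; for
  \<open>l = 2\<close> a single edge satisfies it.\<close>

definition has_cycle :: "'a set \<Rightarrow> nat \<Rightarrow> bool" where
  "has_cycle A l \<longleftrightarrow> (\<exists>xs. pth A xs \<and> length xs = l \<and> E (last xs) (hd xs))"

lemma indep_subset: "indep I \<Longrightarrow> J \<subseteq> I \<Longrightarrow> indep J"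
  unfolding indep_def by blast

lemma finite_indep: "finite A \<Longrightarrow> finite {I. I \<subseteq> A \<and> indep I}"
  by (rule finite_subset[of _ "Pow A"]) auto

lemma alpha_ge:
  assumes "finite A" "I \<subseteq> A" "indep I"
  shows "card I \<le> alpha A"
  unfolding alpha_def using assms finite_indep[OF assms(1)] by (intro Max_ge) auto

lemma alpha_ex:
  assumes "finite A"
  obtains I where "I \<subseteq> A" "indep I" "card I = alpha A"
proof -
  have "{} \<in> {I. I \<subseteq> A \<and> indep I}" by (simp add: indep_def)
  then have "alpha A \<in> card ` {I. I \<subseteq> A \<and> indep I}"
    unfolding alpha_def using finite_indep[OF assms] by (intro Max_in) auto
  then show ?thesis using that by auto
qed

lemma alpha_mono:
  assumes "finite B" "A \<subseteq> B"
  shows "alpha A \<le> alpha B"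
proof -
  obtain I where "I \<subseteq> A" "indep I" "card I = alpha A"
    using alpha_ex finite_subset[OF assms(2,1)] by metis
  then show ?thesis using alpha_ge[OF assms(1)] assms(2) by (metis subset_trans)
qed

lemma alpha_pos:
  assumes "finite A" "A \<noteq> {}"
  shows "alpha A \<ge> 1"
proof -
  obtain x where "x \<in> A" using assms by auto
  then have "card {x} \<le> alpha A"
    using assms(1) E_irrefl by (intro alpha_ge) (auto simp: indep_def)
  then show ?thesis by simp
qed

lemma alpha_Un_le:
  assumes "finite A" "finite B"
  shows "alpha (A \<union> B) \<le> alpha A + alpha B"
proof -
  obtain I where I: "I \<subseteq> A \<union> B" "indep I" "card I = alpha (A \<union> B)"
    using alpha_ex[of "A \<union> B"] assms by auto
  have "card (I \<inter> A) \<le> alpha A" "card (I \<inter> B) \<le> alpha B"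
    using alpha_ge assms indep_subset[OF I(2)] by (metis Int_lower1 Int_lower2)+
  moreover have "I = (I \<inter> A) \<union> (I \<inter> B)" using I(1) by auto
  then have "card I \<le> card (I \<inter> A) + card (I \<inter> B)" by (metis card_Un_le)
  ultimately show ?thesis using I(3) by linarith
qed

lemma alpha_le_card:
  assumes "finite A"
  shows "alpha A \<le> card A"
  by (metis alpha_ex assms card_mono)

lemma nadj_sym: "nadj A B \<Longrightarrow> nadj B A"
  unfolding nadj_def using E_sym by blast

lemma alpha_nadj:
  assumes "finite A" "finite B" "A \<inter> B = {}" "nadj A B"
  shows "alpha A + alpha B \<le> alpha (A \<union> B)"
proof -
  obtain I where I: "I \<subseteq> A" "indep I" "card I = alpha A" using alpha_ex assms(1) by metis
  obtain J where J: "J \<subseteq> B" "indep J" "card J = alpha B" using alpha_ex assms(2) by metis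
  have "indep (I \<union> J)"
    using I J assms(4) nadj_sym[OF assms(4)] unfolding indep_def nadj_def by blast
  then have "card (I \<union> J) \<le> alpha (A \<union> B)" using alpha_ge[of "A \<union> B" "I \<union> J"] I J assms by auto
  moreover have "card (I \<union> J) = card I + card J"
    using I J assms by (intro card_Un_disjoint) (auto intro: finite_subset)
  ultimately show ?thesis using I J by simp
qed

lemma edge_of_large:
  assumes "finite A" "T \<subseteq> A" "card T > alpha A"
  obtains x y where "x \<in> T" "y \<in> T" "E x y"
  using alpha_ge[OF assms(1,2)] assms(3) unfolding indep_def by fastforce

lemma pth_mono: "pth A xs \<Longrightarrow> A \<subseteq> B \<Longrightarrow> pth B xs"
  unfolding pth_def by auto

lemma pth_self: "pth A xs \<Longrightarrow> pth (set xs) xs"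
  unfolding pth_def by auto

lemma pth_single: "x \<in> A \<Longrightarrow> pth A [x]"
  unfolding pth_def by auto

lemma pth_append:
  "pth A xs \<Longrightarrow> pth A ys \<Longrightarrow> set xs \<inter> set ys = {} \<Longrightarrow> E (last xs) (hd ys) \<Longrightarrow> pth A (xs @ ys)"
  unfolding pth_def by (auto simp: successively_append_iff)

lemma pth_Cons: "pth A ys \<Longrightarrow> x \<in> A \<Longrightarrow> x \<notin> set ys \<Longrightarrow> E x (hd ys) \<Longrightarrow> pth A (x # ys)"
  using pth_append[of A "[x]" ys] pth_single[of x A] by auto

lemma pth_appendD1: "pth A (xs @ ys) \<Longrightarrow> xs \<noteq> [] \<Longrightarrow> pth A xs"
  unfolding pth_def by (auto simp: successively_append_iff)

lemma pth_appendD2: "pth A (xs @ ys) \<Longrightarrow> ys \<noteq> [] \<Longrightarrow> pth A ys"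
  unfolding pth_def by (auto simp: successively_append_iff)

lemma pth_append_edge: "pth A (xs @ ys) \<Longrightarrow> xs \<noteq> [] \<Longrightarrow> ys \<noteq> [] \<Longrightarrow> E (last xs) (hd ys)"
  unfolding pth_def by (auto simp: successively_append_iff)

lemma pth_rev:
  assumes "pth A xs"
  shows "pth A (rev xs)"
proof -
  have "successively E xs" using assms by (simp add: pth_def)
  then have "successively (\<lambda>x y. E y x) xs"
    by (rule successively_mono) (auto intro: E_sym)
  then show ?thesis using assms by (simp add: pth_def)
qed

lemma pth_length: "pth A xs \<Longrightarrow> finite A \<Longrightarrow> length xs \<le> card A"
  unfolding pth_def by (metis card_mono distinct_card)

lemma edge_rel_sym: "(x, y) \<in> edge_rel A \<Longrightarrow> (y, x) \<in> edge_rel A"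
  unfolding edge_rel_def using E_sym by auto

lemma edge_rel_rtrancl_sym: "(x, y) \<in> (edge_rel A)\<^sup>* \<Longrightarrow> (y, x) \<in> (edge_rel A)\<^sup>*"
proof (induction rule: rtrancl_induct)
  case (step y z)
  then show ?case using edge_rel_sym converse_rtrancl_into_rtrancl by metis
qed auto

lemma component_refl: "x \<in> component A x"
  unfolding component_def by auto

lemma component_subset: "x \<in> A \<Longrightarrow> component A x \<subseteq> A"
proof
  fix y assume "x \<in> A" "y \<in> component A x"
  then have "(x, y) \<in> (edge_rel A)\<^sup>*" unfolding component_def by simp
  then show "y \<in> A" using \<open>x \<in> A\<close>
    by (induction rule: rtrancl_induct) (auto simp: edge_rel_def)
qed

lemma component_nadj: "x \<in> A \<Longrightarrow> nadj (component A x) (A - component A x)"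
  unfolding nadj_def
proof (intro ballI notI)
  fix u v assume x: "x \<in> A" and u: "u \<in> component A x" and v: "v \<in> A - component A x" and "E u v"
  have "u \<in> A" using component_subset[OF x] u by auto
  then have "(u, v) \<in> edge_rel A" using v \<open>E u v\<close> by (auto simp: edge_rel_def)
  then have "v \<in> component A x" using u unfolding component_def by auto
  then show False using v by auto
qed

lemma component_conn: assumes "x \<in> A" shows "conn (component A x)"
proof -
  have "(x, y) \<in> (edge_rel (component A x))\<^sup>*" if "(x, y) \<in> (edge_rel A)\<^sup>*" for y
    using that
  proof (induction rule: rtrancl_induct)
    case (step y z)
    have "y \<in> component A x" "z \<in> component A x"
      using step unfolding component_def by auto
    then have "(y, z) \<in> edge_rel (component A x)" using step by (auto simp: edge_rel_def)
    then show ?case using step by auto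
  qed auto
  then have *: "\<forall>y\<in>component A x. (x, y) \<in> (edge_rel (component A x))\<^sup>*"
    unfolding component_def by auto
  show ?thesis unfolding conn_def
    using * edge_rel_rtrancl_sym rtrancl_trans by metis
qed

lemma conn_split:
  assumes "\<not> conn A"
  obtains A1 A2 where "A = A1 \<union> A2" "A1 \<inter> A2 = {}" "A1 \<noteq> {}" "A2 \<noteq> {}" "nadj A1 A2"
proof -
  obtain x y where xy: "x \<in> A" "y \<in> A" "(x, y) \<notin> (edge_rel A)\<^sup>*"
    using assms unfolding conn_def by auto
  have "y \<in> A - component A x" using xy unfolding component_def by auto
  then show ?thesis
    using that[of "component A x" "A - component A x"] component_subset[OF xy(1)]
      component_nadj[OF xy(1)] component_refl[of x A] by auto
qed

lemma rtrancl_pth: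
  assumes "(x, y) \<in> (edge_rel A)\<^sup>*" "x \<in> A"
  shows "\<exists>p. pth A p \<and> hd p = x \<and> last p = y"
  using assms
proof (induction rule: rtrancl_induct)
  case base
  then show ?case using pth_single[of x A] by (metis last.simps list.sel(1))
next
  case (step y z)
  then obtain p where p: "pth A p" "hd p = x" "last p = y" by auto
  have z: "z \<in> A" "E y z" using step by (auto simp: edge_rel_def)
  show ?case
  proof (cases "z \<in> set p")
    case True
    then obtain us vs where us: "p = us @ z # vs" by (meson split_list)
    have "pth A (us @ [z])" using p(1) us pth_appendD1[of A "us @ [z]" vs] by auto
    moreover have "hd (us @ [z]) = x" using p(2) us by (cases us) auto
    ultimately show ?thesis by (metis last_snoc)
  next
    case False
    have "pth A (p @ [z])" using p z False by (intro pth_append pth_single) auto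
    moreover have "hd (p @ [z]) = x" using p by (auto simp: pth_def)
    ultimately show ?thesis by (metis last_snoc)
  qed
qed

lemma conn_pth:
  assumes "conn A" "x \<in> A" "y \<in> A"
  obtains p where "pth A p" "hd p = x" "last p = y"
  using rtrancl_pth assms unfolding conn_def by metis

lemma edge_rel_mono: "A \<subseteq> B \<Longrightarrow> (edge_rel A)\<^sup>* \<subseteq> (edge_rel B)\<^sup>*"
  by (rule rtrancl_mono) (auto simp: edge_rel_def)

lemma kconn_diff:
  assumes "kconn k A" "finite A" "D \<subseteq> A" "card D \<le> d"
  shows "kconn (k - d) (A - D)"
  unfolding kconn_def
proof (intro allI impI)
  fix C assume "C \<subseteq> A - D" "card C < k - d"
  moreover have "card (C \<union> D) \<le> card C + card D" by (rule card_Un_le)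
  ultimately have "card (C \<union> D) < k" "C \<union> D \<subseteq> A" using assms by auto
  then have "conn (A - (C \<union> D))" using assms(1) unfolding kconn_def by blast
  moreover have "A - (C \<union> D) = A - D - C" by auto
  ultimately show "conn (A - D - C)" by simp
qed

lemma kconn_conn: "kconn k A \<Longrightarrow> k \<ge> 1 \<Longrightarrow> conn A"
  unfolding kconn_def by (metis Diff_empty card.empty empty_subsetI less_eq_Suc_le One_nat_def)

end

section \<open>Hamilton paths and paths of prescribed length\<close>

context ugraph
begin

lemma reach_closed:
  assumes "(w, y) \<in> (edge_rel B)\<^sup>*" "w \<in> H" "nadj H (B - H)"
  shows "y \<in> H"
  using assms(1)
proof (induction rule: rtrancl_induct)
  case (step u v)
  then show ?case using assms(3) unfolding nadj_def edge_rel_def by blast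
qed (use assms in auto)

lemma pth_detour:
  assumes p: "pth A (p1 @ p2)" "p1 \<noteq> []" "p2 \<noteq> []" and q: "pth A q" "set q \<inter> (set p1 \<union> set p2) = {}"
    and "E (last p1) (hd q)" "E (last q) (hd p2)"
  shows "pth A (p1 @ q @ p2)"
proof -
  have "set p1 \<inter> set p2 = {}" using p(1) by (auto simp: pth_def)
  have "pth A (q @ p2)" using assms pth_appendD2[OF p(1) p(3)] by (intro pth_append[of A q p2]) auto
  moreover have "hd (q @ p2) = hd q" using q by (auto simp: pth_def)
  ultimately show ?thesis
    using assms pth_appendD1[OF p(1) p(2)] \<open>set p1 \<inter> set p2 = {}\<close> by (intro pth_append[of A p1 "q @ p2"]) auto
qed

text \<open>
  The argument of Chvatal and Erdos: the successors, on a longest path, of the attachment vertices of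
  a component off the path are independent.
\<close>

lemma hamilton_path:
  assumes fin: "finite A" and kc: "kconn k A" and ak: "alpha A + 2 \<le> k"
    and ab: "a \<in> A" "b \<in> A" "a \<noteq> b"
  obtains p where "pth A p" "hd p = a" "last p = b" "set p = A"
proof -
  define Q where "Q p \<longleftrightarrow> pth A p \<and> hd p = a \<and> last p = b" for p
  have "conn A" using kconn_conn[OF kc] ak by auto
  then obtain p0 where "Q p0" using conn_pth ab unfolding Q_def by metis
  moreover have "\<forall>p. Q p \<longrightarrow> length p < Suc (card A)"
    using pth_length[OF _ fin] unfolding Q_def by fastforce
  ultimately obtain p where p: "Q p" and pmax: "\<And>q. Q q \<Longrightarrow> length q \<le> length p"
    using ex_has_greatest_nat[of Q p0 length "Suc (card A)"] by auto
  have pp: "pth A p" and hp: "hd p = a" and lp: "last p = b" using p unfolding Q_def by auto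
  have dist: "distinct p" and pA: "set p \<subseteq> A" and pne: "p \<noteq> []" using pp unfolding pth_def by auto
  have len2: "length p \<ge> 2"
  proof (rule ccontr)
    assume "\<not> ?thesis"
    then have "length p = 1" using pne by (metis One_nat_def Suc_leI le_neq_implies_less length_greater_0_conv numeral_2_eq_2)
    then obtain x where "p = [x]" by (metis One_nat_def length_0_conv length_Suc_conv)
    then show False using hp lp ab by auto
  qed
  have "set p = A"
  proof (rule ccontr)
    assume "set p \<noteq> A"
    then obtain w where w: "w \<in> A - set p" using pA by auto
    define H where "H = component (A - set p) w"
    have wH: "w \<in> H" and HA: "H \<subseteq> A - set p" and Hc: "conn H" and Hn: "nadj H (A - set p - H)"
      unfolding H_def using component_refl component_subset[OF w] component_conn[OF w] component_nadj[OF w] by auto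
    define T where "T = {i. i < length p \<and> (\<exists>h\<in>H. E (p ! i) h)}"
    have through: "\<exists>q. pth A q \<and> set q \<subseteq> H \<and> E (p ! i) (hd q) \<and> E (last q) (p ! j)"
      if ij: "i \<in> T" "j \<in> T" for i j
    proof -
      obtain h h' where h: "h \<in> H" "E (p ! i) h" "h' \<in> H" "E (p ! j) h'" using ij unfolding T_def by blast
      obtain q where "pth H q" "hd q = h" "last q = h'" using conn_pth[OF Hc h(1,3)] by auto
      then show ?thesis using h HA E_sym by (intro exI[of _ q]) (auto simp: pth_def)
    qed
    have qpos: "length q > 0" if "pth A q" for q using that unfolding pth_def by auto
    \<comment> \<open>Otherwise a detour through \<open>H\<close> between two consecutive vertices
      would lengthen \<open>p\<close>.\<close>
    have step: "Suc i \<notin> T" if i: "i \<in> T" for i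
    proof
      assume si: "Suc i \<in> T"
      obtain q where q: "pth A q" "set q \<subseteq> H" "E (p ! i) (hd q)" "E (last q) (p ! Suc i)"
        using through[OF i si] by auto
      have sl: "Suc i < length p" using si unfolding T_def by auto
      define p1 p2 where "p1 = take (Suc i) p" and "p2 = drop (Suc i) p"
      have ps: "p = p1 @ p2" "p1 \<noteq> []" "p2 \<noteq> []" unfolding p1_def p2_def using sl pne by auto
      have e: "last p1 = p ! i" "hd p2 = p ! Suc i" unfolding p1_def p2_def using sl
        by (auto simp: take_Suc_conv_app_nth hd_drop_conv_nth)
      have "pth A (p1 @ q @ p2)"
        using pp ps q e HA by (intro pth_detour) auto
      moreover have "hd (p1 @ q @ p2) = a" "last (p1 @ q @ p2) = b" using ps hp lp by auto
      ultimately have "length (p1 @ q @ p2) \<le> length p" using pmax unfolding Q_def by blast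
      then show False using qpos[OF q(1)] ps by simp
    qed
    have finT: "finite T" unfolding T_def by auto
    have injp: "inj_on ((!) p) {..<length p}" using dist by (auto simp: inj_on_def nth_eq_iff_index_eq)
    \<comment> \<open>Removing fewer than \<open>k\<close> attachment vertices would leave the graph
      connected, although it cuts \<open>w\<close> off from a path vertex that is not an attachment.
      By \<open>step\<close>, one of the first two vertices of \<open>p\<close> is of that
      kind.\<close>
    have cardT: "card T \<ge> k"
    proof (rule ccontr)
      assume "\<not> ?thesis"
      define C where "C = (!) p ` T"
      have "card C < k" using \<open>\<not> k \<le> card T\<close> card_image_le[OF finT] unfolding C_def by (meson le_less_trans not_le)
      moreover have CA: "C \<subseteq> A" using pA unfolding C_def T_def by auto
      ultimately have cn: "conn (A - C)" using kc unfolding kconn_def by blast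
      obtain i where i: "i < length p" "i \<notin> T" using step[of 0] len2 
        by (metis One_nat_def Suc_1 Suc_le_lessD less_trans zero_less_Suc)
      have "p ! i \<notin> C" using i injp unfolding C_def T_def inj_on_def by auto
      then have pi: "p ! i \<in> A - C" using pA i by auto
      have wC: "w \<in> A - C" using w unfolding C_def T_def by auto
      have "nadj H (A - C - H)" unfolding nadj_def
      proof (intro ballI notI)
        fix u v assume u: "u \<in> H" and v: "v \<in> A - C - H" and "E u v"
        show False
        proof (cases "v \<in> set p")
          case True
          then obtain j where "j < length p" "v = p ! j" by (metis in_set_conv_nth)
          then have "j \<in> T" using u \<open>E u v\<close> E_sym unfolding T_def by auto
          then show False using v \<open>v = p ! j\<close> unfolding C_def by auto
        next
          case False
          then show False using Hn u v \<open>E u v\<close> unfolding nadj_def by auto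
        qed
      qed
      moreover have "(w, p ! i) \<in> (edge_rel (A - C))\<^sup>*" using cn wC pi unfolding conn_def by auto
      ultimately have "p ! i \<in> H" using wH reach_closed by metis
      then show False using HA i by auto
    qed
    \<comment> \<open>The last vertex of \<open>p\<close> has no successor, which costs one index;
      adding \<open>w\<close> to the set of successors restores the count.\<close>
    define T' where "T' = T - {length p - 1}"
    have "card T - 1 \<le> card T'" unfolding T'_def by (simp add: card_Diff_singleton_if)
    then have cT': "card T' \<ge> k - 1" using cardT by linarith
    have T'l: "Suc i < length p" if "i \<in> T'" for i using that unfolding T'_def T_def by auto
    define S where "S = (\<lambda>i. p ! Suc i) ` T'"
    have "card S = card T'" unfolding S_def
      using T'l dist by (intro card_image) (auto simp: inj_on_def nth_eq_iff_index_eq)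
    moreover have "w \<notin> S" using w T'l unfolding S_def by auto
    moreover have "finite S" unfolding S_def T'_def using finT by auto
    ultimately have big: "alpha A < card (insert w S)" using cT' ak by auto
    have sub: "insert w S \<subseteq> A" using w T'l pA unfolding S_def by auto
    obtain x y where xy: "x \<in> insert w S" "y \<in> insert w S" "E x y"
      using edge_of_large[OF fin sub big] by blast
    have wS: False if "y \<in> S" "E w y" for y
    proof -
      obtain i where i: "i \<in> T'" "y = p ! Suc i" using \<open>y \<in> S\<close> unfolding S_def by auto
      then have "Suc i \<in> T" using T'l[OF i(1)] wH that E_sym unfolding T_def by auto
      then show False using step i unfolding T'_def by auto
    qed
    have xS: "x \<in> S" "y \<in> S" using xy wS E_sym E_irrefl by auto
    \<comment> \<open>Adjacent successors yield a longer path with the same ends: up to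
      \<open>i\<close>, through \<open>H\<close> to \<open>j\<close>, backwards to
      \<open>Suc i\<close>, across the edge to \<open>Suc j\<close>, and on to
      \<open>b\<close>.\<close>
    have main: False if ij: "i \<in> T'" "j \<in> T'" "i < j" and e: "E (p ! Suc i) (p ! Suc j)" for i j
    proof -
      obtain q where q: "pth A q" "set q \<subseteq> H" "E (p ! i) (hd q)" "E (last q) (p ! j)"
        using through[of i j] ij unfolding T'_def by auto
      have sj: "Suc j < length p" using T'l ij by auto
      define p1 p2 p3 where "p1 = take (Suc i) p" and "p2 = take (j - i) (drop (Suc i) p)" and "p3 = drop (Suc j) p"
      have "drop (Suc i) p = p2 @ p3" unfolding p2_def p3_def using ij
        by (metis Suc_diff_le Suc_diff_Suc append_take_drop_id drop_drop add_Suc_right le_add_diff_inverse2 less_imp_le_nat)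
      then have ps: "p = p1 @ p2 @ p3" unfolding p1_def by (metis append_take_drop_id)
      have ne: "p1 \<noteq> []" "p2 \<noteq> []" "p3 \<noteq> []" unfolding p1_def p2_def p3_def using sj ij pne by auto
      have ends: "last p1 = p ! i" "hd p2 = p ! Suc i" "hd p3 = p ! Suc j"
        unfolding p1_def p2_def p3_def using sj ij
        by (auto simp: take_Suc_conv_app_nth hd_drop_conv_nth)
      have "length p2 = j - i" unfolding p2_def using sj ij by simp
      then have "last p2 = p2 ! (j - i - 1)" using ne by (simp add: last_conv_nth)
      also have "\<dots> = p ! (Suc i + (j - i - 1))" unfolding p2_def using sj ij by simp
      also have "Suc i + (j - i - 1) = j" using ij by simp
      finally have l2: "last p2 = p ! j" .
      have P: "pth A p1" "pth A p2" "pth A p3"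
        using pp ps ne pth_appendD1[of A p1 "p2 @ p3"] pth_appendD2[of A p1 "p2 @ p3"]
          pth_appendD1[of A p2 p3] pth_appendD2[of A p2 p3] by auto
      have D: "set p1 \<inter> set p2 = {}" "set p1 \<inter> set p3 = {}" "set p2 \<inter> set p3 = {}"
        "set q \<inter> set p = {}"
        using dist ps HA q by auto
      have sp: "set p = set p1 \<union> set p2 \<union> set p3" by (subst ps) auto
      have "pth A (rev p2 @ p3)"
        using P D ne ends e by (intro pth_append pth_rev) (auto simp: last_rev)
      then have "pth A (q @ rev p2 @ p3)"
        using q(1,4) D sp ne l2 by (intro pth_append[of A q "rev p2 @ p3"]) (auto simp: hd_rev)
      moreover have "hd (q @ rev p2 @ p3) = hd q" using q by (auto simp: pth_def)
      ultimately have "pth A (p1 @ q @ rev p2 @ p3)"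
        using P q D sp ends by (intro pth_append[of A p1 "q @ rev p2 @ p3"]) auto
      moreover have "hd (p1 @ q @ rev p2 @ p3) = a" "last (p1 @ q @ rev p2 @ p3) = b"
        using hp lp ps ne by auto
      ultimately have "length (p1 @ q @ rev p2 @ p3) \<le> length p" using pmax unfolding Q_def by blast
      then show False using qpos[OF q(1)] ps by simp
    qed
    obtain i j where ij: "i \<in> T'" "x = p ! Suc i" "j \<in> T'" "y = p ! Suc j" using xS unfolding S_def by auto
    have "i \<noteq> j" using xy ij E_irrefl by auto
    then show False using main[of i j] main[of j i] ij xy E_sym by (metis linorder_neqE_nat)
  qed
  then show ?thesis using that pp hp lp by auto
qed


section \<open>Paths in dense sets, shortening by chords, and panconnectedness\<close>

text \<open>Deleting a vertex of small degree together with its neighbours costs fewer than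
  \<open>f\<close> vertices but lowers \<open>alpha\<close> by at least one. The ratio hypothesis
  survives, now strictly, so the deletions cannot exhaust the set.\<close>

lemma min_degree_subset:
  assumes "finite Z" "Z \<noteq> {}" "f * alpha Z \<le> card Z"
  obtains Y where "Y \<subseteq> Z" "Y \<noteq> {}" "\<And>z. z \<in> Y \<Longrightarrow> f \<le> Suc (card {y \<in> Y. E z y})"
proof -
  have "\<exists>Y\<subseteq>Z. Y \<noteq> {} \<and> (\<forall>z\<in>Y. f \<le> Suc (card {y \<in> Y. E z y}))"
    using assms
  proof (induction Z rule: finite_psubset_induct)
    case (psubset Z)
    show ?case
    proof (cases "\<forall>z\<in>Z. f \<le> Suc (card {y \<in> Z. E z y})")
      case True
      then show ?thesis using psubset.prems by blast
    next
      case False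
      then obtain z where z: "z \<in> Z" "Suc (card {y \<in> Z. E z y}) < f" by (auto simp: not_le)
      define D where "D = insert z {y \<in> Z. E z y}"
      have fD: "finite D" "D \<subseteq> Z" unfolding D_def using psubset.hyps(1) z by auto
      have cD: "card D < f" unfolding D_def using z(2) psubset.hyps(1) E_irrefl by (simp add: card_insert_if)
      have "alpha {z} + alpha (Z - D) \<le> alpha ({z} \<union> (Z - D))"
        using psubset.hyps(1) z(1) by (intro alpha_nadj) (auto simp: D_def nadj_def)
      also have "\<dots> \<le> alpha Z" using psubset.hyps(1) z(1) by (intro alpha_mono) auto
      finally have al: "Suc (alpha (Z - D)) \<le> alpha Z" using alpha_pos[of "{z}"] by simp
      have "f * Suc (alpha (Z - D)) \<le> f * alpha Z" using al by (rule mult_le_mono2)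
      then have "f + f * alpha (Z - D) \<le> card Z" using psubset.prems(2) by simp
      moreover have "card (Z - D) = card Z - card D" using fD by (intro card_Diff_subset) auto
      ultimately have c: "f * alpha (Z - D) < card (Z - D)" using cD by linarith
      then have "Z - D \<noteq> {}" by (metis card.empty not_less_zero)
      moreover have "Z - D \<subset> Z" using z(1) unfolding D_def by auto
      ultimately obtain Y where "Y \<subseteq> Z - D" "Y \<noteq> {}" "\<forall>z\<in>Y. f \<le> Suc (card {y \<in> Y. E z y})"
        using psubset.IH[of "Z - D"] c by (meson less_imp_le_nat)
      then show ?thesis by blast
    qed
  qed
  then show ?thesis using that by blast
qed

text \<open>Greedy extension: the end of a path on \<open>n < f\<close> vertices has more neighbours
  than the path has other vertices.\<close>

lemma min_degree_path:
  assumes "finite Z" "Z \<noteq> {}" "\<And>z. z \<in> Z \<Longrightarrow> f \<le> Suc (card {y \<in> Z. E z y})" "1 \<le> n" "n \<le> f"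
  shows "\<exists>p. pth Z p \<and> length p = n"
  using assms(4,5)
proof (induction n rule: nat_induct_at_least)
  case base
  obtain z where "z \<in> Z" using assms(2) by auto
  then show ?case using pth_single[of z Z] by (metis length_Cons list.size(3) One_nat_def)
next
  case (Suc n)
  then obtain p where p: "pth Z p" "length p = n" by auto
  define z where "z = last p"
  have pne: "p \<noteq> []" and zZ: "z \<in> Z" using p by (auto simp: pth_def z_def)
  have "card (set p - {z}) = n - 1" using p pne
    by (simp add: card_Diff_singleton distinct_card pth_def z_def)
  then have "card (set p - {z}) < card {y \<in> Z. E z y}" using assms(3)[OF zZ] Suc by linarith
  then have "\<not> {y \<in> Z. E z y} \<subseteq> set p - {z}"
    by (metis List.finite_set card_mono finite_Diff not_le)
  then obtain y where y: "y \<in> Z" "E z y" "y \<notin> set p" using E_irrefl by auto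
  have "pth Z (p @ [y])" using p y unfolding z_def by (intro pth_append pth_single) auto
  then show ?case using p by (intro exI[of _ "p @ [y]"]) auto
qed

lemma dense_path:
  assumes "finite Z" "Z \<noteq> {}" "f * alpha Z \<le> card Z" "1 \<le> f"
  obtains p where "pth Z p" "length p = f"
proof -
  obtain Y where Y: "Y \<subseteq> Z" "Y \<noteq> {}" "\<And>z. z \<in> Y \<Longrightarrow> f \<le> Suc (card {y \<in> Y. E z y})"
    using min_degree_subset[OF assms(1-3)] by metis
  then obtain p where "pth Y p" "length p = f"
    using min_degree_path[of Y f f] assms finite_subset by blast
  then show ?thesis using that pth_mono Y by blast
qed

text \<open>Two of the \<open>m + 1\<close> vertices at the positions 0, 2, ..., 2m are adjacent.
  Restricting to even positions makes the chord skip at least one vertex, and it skips fewer than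
  \<open>2 * m\<close>.\<close>

lemma chord_step:
  assumes "pth A p" "finite A" "alpha A \<le> m" "2 * m < length p"
  obtains q where "pth (set p) q" "hd q = hd p" "last q = last p" "length q < length p" "length p \<le> length q + 2 * m"
proof -
  note result = that
  define T where "T = (\<lambda>i. p ! (2 * i)) ` {..m}"
  have dist: "distinct p" "set p \<subseteq> A" using assms(1) by (auto simp: pth_def)
  have "card T = card {..m}" unfolding T_def using dist assms(4)
    by (intro card_image) (auto simp: inj_on_def nth_eq_iff_index_eq)
  then have "card T > alpha A" using assms(3) by simp
  moreover have "T \<subseteq> A" using dist assms(4) unfolding T_def by auto
  ultimately obtain x y where xy: "x \<in> T" "y \<in> T" "E x y" using edge_of_large[OF assms(2)] by metis
  have main: thesis if ij: "i < j" "j \<le> m" and e: "E (p ! (2 * i)) (p ! (2 * j))" for i j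
  proof -
    define p1 p2 where "p1 = take (2 * i + 1) p" and "p2 = drop (2 * j) p"
    have l: "2 * j < length p" using ij assms(4) by linarith
    have s: "set p1 \<inter> set p2 = {}"
      unfolding p1_def p2_def using dist ij by (intro set_take_disj_set_drop_if_distinct) auto
    have ne: "p1 \<noteq> []" "p2 \<noteq> []" unfolding p1_def p2_def using l by auto
    have P: "pth (set p) p1" "pth (set p) p2"
      using pth_self[OF assms(1)] pth_appendD1[of "set p" p1 "drop (2 * i + 1) p"]
        pth_appendD2[of "set p" "take (2 * j) p" p2] ne unfolding p1_def p2_def by auto
    have ends: "last p1 = p ! (2 * i)" "hd p2 = p ! (2 * j)"
      unfolding p1_def p2_def using l ij by (auto simp: take_Suc_conv_app_nth hd_drop_conv_nth)
    have "pth (set p) (p1 @ p2)" using P s e ends by (intro pth_append) auto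
    moreover have "hd (p1 @ p2) = hd p" "last (p1 @ p2) = last p"
      using ne l unfolding p1_def p2_def by (auto simp: hd_append)
    moreover have "length (p1 @ p2) + (2 * j - (2 * i + 1)) = length p"
      unfolding p1_def p2_def using l ij by (simp add: min_def)
    moreover have "1 \<le> 2 * j - (2 * i + 1)" "2 * j - (2 * i + 1) \<le> 2 * m" using ij by linarith+
    ultimately show thesis by (intro result[of "p1 @ p2"]) linarith+
  qed
  obtain i j where "x = p ! (2 * i)" "y = p ! (2 * j)" "i \<le> m" "j \<le> m" using xy unfolding T_def by auto
  moreover then have "i \<noteq> j" using xy E_irrefl by auto
  ultimately show ?thesis using main[of i j] main[of j i] xy E_sym by (metis linorder_neqE_nat)
qed

text \<open>Each chord step loses at most \<open>2 * m\<close> vertices, so the first length not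
  above \<open>t\<close> is still at least \<open>t - 2 * m\<close>.\<close>

lemma shorten:
  assumes "pth A p" "finite A" "alpha A \<le> m" "2 * m \<le> t" "t \<le> length p"
  shows "\<exists>q. pth (set p) q \<and> hd q = hd p \<and> last q = last p \<and> length q \<le> t \<and> t \<le> length q + 2 * m"
  using assms(1,5)
proof (induction "length p" arbitrary: p rule: less_induct)
  case less
  show ?case
  proof (cases "length p = t")
    case True
    then show ?thesis using pth_self[OF less.prems(1)] by (intro exI[of _ p]) auto
  next
    case False
    then have "2 * m < length p" using less.prems assms(4) by linarith
    then obtain q where q: "pth (set p) q" "hd q = hd p" "last q = last p" "length q < length p"
      "length p \<le> length q + 2 * m"
      using chord_step[OF less.prems(1) assms(2,3)] by metis
    have qA: "pth A q" "set q \<subseteq> set p" using q(1) less.prems(1) by (auto simp: pth_def)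
    show ?thesis
    proof (cases "length q \<le> t")
      case True
      then show ?thesis using q less.prems by (intro exI[of _ q]) auto
    next
      case False
      then obtain r where "pth (set q) r" "hd r = hd q" "last r = last q" "length r \<le> t" "t \<le> length r + 2 * m"
        using less.hyps[OF q(4) qA(1)] by auto
      then show ?thesis using q qA pth_mono by (intro exI[of _ r]) auto
    qed
  qed
qed

text \<open>Otherwise deleting the neighbours of \<open>a\<close> would separate \<open>a\<close>
  from another vertex, and one is left because \<open>X\<close> has more than \<open>k\<close>
  vertices.\<close>

lemma kconn_degree:
  assumes "finite X" "kconn k X" "k < card X" "a \<in> X"
  shows "k \<le> card {y \<in> X. E a y}"
proof (rule ccontr)
  assume "\<not> ?thesis"
  then have c: "conn (X - {y \<in> X. E a y})" using assms(2) unfolding kconn_def by auto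
  have "card (insert a {y \<in> X. E a y}) \<le> Suc (card {y \<in> X. E a y})" by (rule card_insert_le_m1) auto
  then have "card (insert a {y \<in> X. E a y}) < card X" using \<open>\<not> k \<le> _\<close> assms(3) by linarith
  moreover have "insert a {y \<in> X. E a y} \<subseteq> X" using assms(4) by auto
  ultimately have "insert a {y \<in> X. E a y} \<subset> X" by (metis less_irrefl psubsetI)
  then obtain z where z: "z \<in> X" "z \<noteq> a" "\<not> E a z" by blast
  then have "(a, z) \<in> (edge_rel (X - {y \<in> X. E a y}))\<^sup>*" using c assms(4) E_irrefl unfolding conn_def by auto
  then have "z \<in> {a}" by (rule reach_closed) (auto simp: nadj_def)
  then show False using z by auto
qed

text \<open>
  A path inside the neighbourhood of \<open>a\<close>, entered at an arbitrary vertex, compensates for the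
  imprecision of shortening a Hamilton path by chords.
\<close>

lemma panconnected:
  assumes fin: "finite X" and kc: "kconn k X" and al: "alpha X \<le> m" and k: "10 * m * m \<le> k" and kX: "k < card X"
    and ab: "a \<in> X" "b \<in> X" "a \<noteq> b" and s: "2 * m + 2 \<le> s" "s \<le> card X"
  obtains p where "pth X p" "hd p = a" "last p = b" "length p = s"
proof -
  have m1: "1 \<le> m" using alpha_pos[OF fin] ab al by fastforce
  have k2: "10 * m \<le> 10 * m * m" using m1 by simp
  define N where "N = {y \<in> X. E a y} - {b}"
  have "k \<le> card {y \<in> X. E a y}" using kconn_degree[OF fin kc kX ab(1)] .
  moreover have "card {y \<in> X. E a y} - 1 \<le> card N" unfolding N_def using fin by (simp add: card_Diff_singleton_if)
  ultimately have cN: "k - 1 \<le> card N" by linarith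
  have "N \<subseteq> X" unfolding N_def by auto
  then have "(2 * m + 1) * alpha N \<le> (2 * m + 1) * m"
    using alpha_mono[OF fin, of N] al by (intro mult_le_mono2) linarith
  also have "\<dots> \<le> 3 * m * m" using m1 by (simp add: algebra_simps)
  also have "\<dots> \<le> k - 1" using k m1 k2 by linarith
  finally have "(2 * m + 1) * alpha N \<le> card N" using cN by linarith
  moreover have "0 < card N" using cN k m1 k2 by linarith
  then have "N \<noteq> {}" by auto
  moreover have "finite N" unfolding N_def using fin by auto
  ultimately obtain qs where qs: "pth N qs" "length qs = 2 * m + 1"
    using dense_path[of N "2 * m + 1"] by (metis le_add2)
  define g where "g = last qs"
  \<comment> \<open>\<open>us\<close> is the reserve: its \<open>2 * m\<close> vertices are all
    adjacent to \<open>a\<close>, so a path may go from \<open>a\<close> into any suffix of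
    \<open>us\<close> and on to \<open>g\<close>. It is removed together with \<open>a\<close>
    before the Hamilton path from \<open>g\<close> to \<open>b\<close> is taken.\<close>
  define us where "us = butlast qs"
  have qsne: "qs \<noteq> []" using qs by auto
  have qs_eq: "qs = us @ [g]" unfolding us_def g_def using qsne by simp
  have usl: "length us = 2 * m" unfolding us_def using qs by simp
  have N: "\<And>y. y \<in> set qs \<Longrightarrow> y \<in> X \<and> E a y \<and> y \<noteq> b" using qs unfolding N_def pth_def by auto
  have dq: "distinct qs" using qs by (auto simp: pth_def)
  define D where "D = insert a (set us)"
  have aus: "a \<notin> set qs" using N E_irrefl by blast
  have cD: "card D = 2 * m + 1" unfolding D_def using aus usl dq qs_eq
    by (auto simp: distinct_card)
  have DX: "D \<subseteq> X" unfolding D_def using ab N qs_eq by auto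
  define Y where "Y = X - D"
  have finY: "finite Y" unfolding Y_def using fin by auto
  have kY: "kconn (k - (2 * m + 1)) Y" unfolding Y_def using kconn_diff[OF kc fin DX] cD by simp
  have cY: "card Y = card X - (2 * m + 1)" unfolding Y_def using DX cD fin by (simp add: card_Diff_subset finite_subset)
  have alY: "alpha Y \<le> m" using alpha_mono[OF fin, of Y] al unfolding Y_def by auto
  have gY: "g \<in> Y" "b \<in> Y" "g \<noteq> b" unfolding Y_def D_def using N qs_eq aus dq ab by auto
  have "alpha Y + 2 \<le> k - (2 * m + 1)" using alY k m1 k2 by linarith
  then obtain P where P: "pth Y P" "hd P = g" "last P = b" "set P = Y"
    using hamilton_path[OF finY kY _ gY] by metis
  have lP: "length P = card Y" using P distinct_card unfolding pth_def by metis
  have "\<exists>Q. pth Y Q \<and> hd Q = g \<and> last Q = b \<and> length Q \<le> s - 1 \<and> s - 1 \<le> length Q + 2 * m"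
  proof (cases "s - 1 \<le> length P")
    case True
    have "2 * m \<le> s - 1" using s by linarith
    from shorten[OF P(1) finY alY this True] show ?thesis using P by metis
  next
    case False
    \<comment> \<open>The Hamilton path of \<open>Y\<close> has \<open>card X - (2 * m + 1)\<close>
      vertices, so \<open>s \<le> card X\<close> already bounds the deficit by
      \<open>2 * m\<close>.\<close>
    then show ?thesis using P lP cY s by (intro exI[of _ P]) auto
  qed
  then obtain Q where Q: "pth Y Q" "hd Q = g" "last Q = b" "length Q \<le> s - 1" "s - 1 \<le> length Q + 2 * m" by auto
  \<comment> \<open>The deficit is at most \<open>2 * m\<close> and is filled exactly by the last
    \<open>r\<close> vertices of \<open>us\<close>.\<close>
  define r where "r = s - 1 - length Q"
  define vs where "vs = drop (2 * m - r) us"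
  have lv: "length vs = r" unfolding vs_def r_def using usl Q by auto
  have suf: "vs @ [g] = drop (2 * m - r) qs" unfolding vs_def qs_eq using usl by simp
  have "drop (2 * m - r) qs \<noteq> []" using suf by (metis snoc_eq_iff_butlast)
  then have "pth N (vs @ [g])"
    using pth_appendD2[of N "take (2 * m - r) qs" "drop (2 * m - r) qs"] qs(1) suf by simp
  then have pv: "pth X (vs @ [g])" by (rule pth_mono) (auto simp: N_def)
  have vsub: "set vs \<subseteq> set us" unfolding vs_def by (rule set_drop_subset)
  have QX: "pth X Q" using Q(1) pth_mono unfolding Y_def by blast
  have dis: "set vs \<inter> set Q = {}" using vsub Q(1) unfolding Y_def D_def pth_def by auto
  have vQ: "pth X (vs @ Q)"
  proof (cases "vs = []")
    case False
    then have "E (last vs) g" using pth_append_edge[OF pv] by simp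
    then show ?thesis using pth_append[OF pth_appendD1[OF pv False] QX dis] Q by simp
  qed (use QX in auto)
  have "hd (vs @ Q) \<in> set qs" using Q vsub qs_eq by (cases vs) auto
  then have "E (last [a]) (hd (vs @ Q))" using N by auto
  moreover have "a \<notin> set (vs @ Q)" using vsub aus qs_eq Q(1) unfolding Y_def D_def pth_def by auto
  ultimately have "pth X ([a] @ vs @ Q)" using pth_Cons[OF vQ ab(1)] by auto
  moreover have "last ([a] @ vs @ Q) = b" using Q by (auto simp: pth_def)
  moreover have "length ([a] @ vs @ Q) = s" using lv Q s unfolding r_def by auto
  ultimately show ?thesis using that by force
qed

end

section \<open>Dense sets without long paths\<close>

lemma double_count:
  assumes "finite A" "finite B"
  shows "(\<Sum>a\<in>A. card {b \<in> B. R a b}) = (\<Sum>b\<in>B. card {a \<in> A. R a b})"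
proof -
  have "(\<Sum>a\<in>A. card {b \<in> B. R a b}) = (\<Sum>a\<in>A. \<Sum>b\<in>B. if R a b then 1 else 0)"
    using assms by (intro sum.cong) (auto simp: sum.If_cases Int_def)
  also have "\<dots> = (\<Sum>b\<in>B. \<Sum>a\<in>A. if R a b then 1 else 0)" by (rule sum.swap)
  also have "\<dots> = (\<Sum>b\<in>B. card {a \<in> A. R a b})"
    using assms by (intro sum.cong) (auto simp: sum.If_cases Int_def)
  finally show ?thesis .
qed

context ugraph
begin

text \<open>\<open>card\<close> is additive over components and \<open>alpha\<close> is
  superadditive over mutually non-adjacent sets, so an inequality linear in both may be checked on
  components. The induction runs over unions of components.\<close>

lemma component_bound:
  assumes fin: "finite A"
    and comp: "\<And>x. x \<in> A \<Longrightarrow> card (component A x) * c \<le> e * alpha (component A x)"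
  shows "card A * c \<le> e * alpha A"
proof -
  have "card B * c \<le> e * alpha B" if "B \<subseteq> A" "nadj B (A - B)" for B
    using finite_subset[OF that(1) fin] that
  proof (induction B rule: finite_psubset_induct)
    case (psubset B)
    show ?case
    proof (cases "B = {}")
      case False
      then obtain x where x: "x \<in> B" by auto
      define K where "K = component A x"
      have xA: "x \<in> A" using x psubset.prems by auto
      have KB: "K \<subseteq> B"
      proof
        fix y assume "y \<in> K"
        then have "(x, y) \<in> (edge_rel A)\<^sup>*" unfolding K_def component_def by auto
        then show "y \<in> B" using x psubset.prems(2) by (rule reach_closed)
      qed
      have xK: "x \<in> K" unfolding K_def by (rule component_refl)
      have n: "nadj K (A - K)" unfolding K_def using xA by (rule component_nadj)
      have "nadj (B - K) (A - (B - K))" unfolding nadj_def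
      proof (intro ballI)
        fix u v assume u: "u \<in> B - K" and v: "v \<in> A - (B - K)"
        show "\<not> E u v"
        proof (cases "v \<in> K")
          case True
          then show ?thesis using n u psubset.prems(1) E_sym[of u v] unfolding nadj_def by auto
        next
          case False
          then show ?thesis using psubset.prems(2) u v unfolding nadj_def by auto
        qed
      qed
      moreover have "B - K \<subset> B" "B - K \<subseteq> A" using xK x psubset.prems by auto
      ultimately have 1: "card (B - K) * c \<le> e * alpha (B - K)" using psubset.IH by blast
      have 2: "card K * c \<le> e * alpha K" unfolding K_def using comp xA by auto
      have f: "finite K" "finite (B - K)" using psubset.hyps KB finite_subset by auto
      have "alpha K + alpha (B - K) \<le> alpha (K \<union> (B - K))"
        using f n psubset.prems by (intro alpha_nadj) (auto simp: nadj_def)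
      also have "K \<union> (B - K) = B" using KB by auto
      finally have 3: "e * alpha K + e * alpha (B - K) \<le> e * alpha B"
        by (metis add_mult_distrib2 mult_le_mono2)
      have "card B = card K + card (B - K)"
        using KB f psubset.hyps by (metis card_Diff_subset card_mono le_add_diff_inverse)
      then have "card B * c = card K * c + card (B - K) * c" by (simp add: add_mult_distrib)
      then show ?thesis using 1 2 3 by linarith
    qed auto
  qed
  from this[of A] show ?thesis by (simp add: nadj_def)
qed

text \<open>Induction by deleting the root: every component of the rest contains a neighbour of
  \<open>r\<close>, from which paths have at most \<open>d - 1\<close> vertices. The gain from
  \<open>M - d\<close> to \<open>M - (d - 1)\<close> pays for the lost root once \<open>A\<close>
  has at least \<open>M\<close> vertices; smaller sets fall under the last hypothesis.\<close>

lemma rooted_path_bound: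
  assumes "finite A" "conn A" "r \<in> A" "\<And>p. pth A p \<Longrightarrow> hd p = r \<Longrightarrow> length p \<le> d" "d \<le> M"
    and "\<And>W. W \<subseteq> A \<Longrightarrow> card W < M \<Longrightarrow> card W \<le> D * alpha W"
  shows "card A * (M - d) \<le> D * M * alpha A"
  using assms
proof (induction A arbitrary: r d rule: finite_psubset_induct)
  case (psubset A)
  show ?case
  proof (cases "card A < M")
    case True
    have "card A * (M - d) \<le> card A * M" by simp
    also have "\<dots> \<le> D * alpha A * M" using psubset.prems(5)[of A] True by (intro mult_le_mono1) auto
    finally show ?thesis by (simp add: ac_simps)
  next
    case False
    have r: "r \<in> A" by (rule psubset.prems(2))
    have d1: "1 \<le> d" using psubset.prems(3)[of "[r]"] pth_single[OF r] by auto
    define B where "B = A - {r}"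
    have finB: "finite B" unfolding B_def using psubset.hyps by auto
    have "card B * (M - (d - 1)) \<le> D * M * alpha B"
    proof (rule component_bound[OF finB])
      fix x assume x: "x \<in> B"
      define K where "K = component B x"
      have KB: "K \<subseteq> B" and xK: "x \<in> K" and Kc: "conn K" and Kn: "nadj K (B - K)"
        unfolding K_def using component_subset[OF x] component_refl component_conn[OF x] component_nadj[OF x] by auto
      have "\<exists>r'\<in>K. E r r'"
      proof (rule ccontr)
        assume "\<not> ?thesis"
        then have nr: "\<not> E z r" if "z \<in> K" for z using that E_sym[of z r] by auto
        have "nadj K (A - K)" unfolding nadj_def
        proof (intro ballI)
          fix u v assume "u \<in> K" "v \<in> A - K"
          then show "\<not> E u v" using nr[of u] Kn unfolding nadj_def B_def by (cases "v = r") auto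
        qed
        moreover have "(x, r) \<in> (edge_rel A)\<^sup>*" using psubset.prems(1) r x unfolding conn_def B_def by auto
        ultimately have "r \<in> K" using reach_closed[OF _ xK] by blast
        then show False using KB unfolding B_def by auto
      qed
      then obtain r' where r': "r' \<in> K" "E r r'" by auto
      have "card K * (M - (d - 1)) \<le> D * M * alpha K"
      proof (rule psubset.IH)
        show "K \<subset> A" using KB r unfolding B_def by auto
        show "conn K" by (rule Kc)
        show "r' \<in> K" by (rule r'(1))
        show "d - 1 \<le> M" using psubset.prems(4) by auto
        show "card W \<le> D * alpha W" if "W \<subseteq> K" "card W < M" for W
          using psubset.prems(5)[of W] that KB unfolding B_def by auto
        fix p assume p: "pth K p" "hd p = r'"
        have "pth A ([r] @ p)"
          using pth_Cons[of A p r] pth_mono[OF p(1), of A] p r r' KB unfolding B_def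
          by (auto simp: pth_def)
        then have "length ([r] @ p) \<le> d" by (rule psubset.prems(3)) simp
        then show "length p \<le> d - 1" by auto
      qed
      then show "card (component B x) * (M - (d - 1)) \<le> D * M * alpha (component B x)" unfolding K_def .
    qed
    also have "\<dots> \<le> D * M * alpha A"
      using alpha_mono[OF psubset.hyps, of B] unfolding B_def by (intro mult_le_mono2) auto
    finally have *: "card B * (M - (d - 1)) \<le> D * M * alpha A" .
    obtain b where cA: "card A = Suc b" "card B = b"
      using r psubset.hyps unfolding B_def by (metis card_Suc_Diff1)
    obtain u where u: "M = d + u" using psubset.prems(4) by (metis le_add_diff_inverse)
    have "M - (d - 1) = Suc u" "M - d = u" using u d1 by auto
    moreover have "u \<le> b" using False cA u d1 by linarith
    then have "Suc b * u \<le> b * Suc u" by simp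
    ultimately show ?thesis using * cA by (metis le_trans)
  qed
qed

text \<open>Read contrapositively, with \<open>d\<close> half of \<open>M\<close>: if paths have at
  most \<open>d\<close> vertices and the ratio of \<open>card\<close> to \<open>alpha\<close>
  exceeds \<open>2 * D\<close>, then some subset with fewer than \<open>M\<close> vertices has ratio
  above \<open>D\<close>.\<close>

lemma no_long_path_bound:
  assumes "finite A" "\<And>p. pth A p \<Longrightarrow> length p \<le> d" "d \<le> M"
    and "\<And>W. W \<subseteq> A \<Longrightarrow> card W < M \<Longrightarrow> card W \<le> D * alpha W"
  shows "card A * (M - d) \<le> D * M * alpha A"
proof (rule component_bound[OF assms(1)])
  fix x assume x: "x \<in> A"
  show "card (component A x) * (M - d) \<le> D * M * alpha (component A x)"
  proof (rule rooted_path_bound[of _ x])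
    show "finite (component A x)" using component_subset[OF x] assms(1) finite_subset by auto
    show "conn (component A x)" "x \<in> component A x" using component_conn[OF x] component_refl by auto
    show "length p \<le> d" if "pth (component A x) p" for p
      using assms(2) pth_mono[OF that component_subset[OF x]] .
    show "card W \<le> D * alpha W" if "W \<subseteq> component A x" "card W < M" for W
      using assms(4) that component_subset[OF x] by auto
  qed (rule assms(3))
qed

text \<open>A cut of fewer than \<open>k\<close> vertices splits \<open>W\<close> into two
  non-adjacent parts whose independence numbers add up to at most \<open>alpha W\<close>. The
  summand \<open>k\<close> on the right is available once for each part, which pays for the cut, so
  one part inherits the inequality.\<close>

lemma extract_kconn:
  assumes "finite W" "W \<noteq> {}" "alpha W * (s + k) \<le> card W + k"
  shows "\<exists>X\<subseteq>W. X \<noteq> {} \<and> kconn k X \<and> alpha X * (s + k) \<le> card X + k"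
  using assms
proof (induction W rule: finite_psubset_induct)
  case (psubset W)
  show ?case
  proof (cases "kconn k W")
    case False
    then obtain C where C: "C \<subseteq> W" "card C < k" "\<not> conn (W - C)" unfolding kconn_def by auto
    obtain A B where AB: "W - C = A \<union> B" "A \<inter> B = {}" "A \<noteq> {}" "B \<noteq> {}" "nadj A B"
      using conn_split[OF C(3)] by metis
    have sub: "A \<subset> W" "B \<subset> W" using AB by auto
    have fin: "finite A" "finite B" using sub psubset.hyps finite_subset by blast+
    have "alpha A + alpha B \<le> alpha (A \<union> B)" using fin AB by (intro alpha_nadj) auto
    also have "\<dots> \<le> alpha W" using psubset.hyps AB by (intro alpha_mono) auto
    finally have "(alpha A + alpha B) * (s + k) \<le> alpha W * (s + k)" by (rule mult_le_mono1)
    then have 1: "alpha A * (s + k) + alpha B * (s + k) \<le> card W + k" using psubset.prems by (simp add: add_mult_distrib)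
    have "card A + card B = card (W - C)" using AB fin by (simp add: card_Un_disjoint)
    also have "\<dots> = card W - card C" using C psubset.hyps by (meson card_Diff_subset finite_subset)
    finally have 2: "card W < card A + card B + k" using C(2) by linarith
    consider "alpha A * (s + k) \<le> card A + k" | "alpha B * (s + k) \<le> card B + k" using 1 2 by linarith
    then show ?thesis
    proof cases
      case 1
      then obtain X where "X \<subseteq> A" "X \<noteq> {}" "kconn k X" "alpha X * (s + k) \<le> card X + k"
        using psubset.IH[OF sub(1)] AB(3) by auto
      then show ?thesis using sub(1) by (intro exI[of _ X]) auto
    next
      case 2
      then obtain X where "X \<subseteq> B" "X \<noteq> {}" "kconn k X" "alpha X * (s + k) \<le> card X + k"
        using psubset.IH[OF sub(2)] AB(4) by auto
      then show ?thesis using sub(2) by (intro exI[of _ X]) auto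
    qed
  qed (use psubset.prems in auto)
qed

end

section \<open>Matchings leaving a set\<close>

context ugraph
begin

text \<open>
  If a maximal matching from \<open>X\<close> out of \<open>U\<close> were small, then almost all of \<open>X\<close> would be
  adjacent to almost all of a set \<open>Q\<close> with \<open>l + e\<close> elements.  All but \<open>e\<close> of the vertices of
  \<open>Q\<close> with few neighbours in \<open>X\<close> can be threaded onto a path through \<open>X\<close>, and the rest of \<open>Q\<close>
  is highly connected, so that \<open>Q\<close> contains a cycle of length exactly \<open>l\<close>.
\<close>

lemma outward_matching:
  assumes finV: "finite V" and noC: "\<not> has_cycle V l"
    and deg: "\<And>v. v \<in> V \<Longrightarrow> l \<le> Suc (card {u \<in> V. E v u})"
    and XU: "X \<subseteq> U" and UV: "U \<subseteq> V" and cU: "card U < l" and aU: "100 * alpha U \<le> card X"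
  obtains S w where "S \<subseteq> X" "inj_on w S" "\<And>x. x \<in> S \<Longrightarrow> w x \<in> V - U \<and> E x (w x)"
    "card X \<le> 100 * card S"
proof (rule ccontr)
  assume no: "\<not> thesis"
  define good where "good S w \<longleftrightarrow> S \<subseteq> X \<and> inj_on w S \<and> (\<forall>x\<in>S. w x \<in> V - U \<and> E x (w x))" for S w
  have finU: "finite U" and finX: "finite X" using finV UV XU finite_subset by metis+
  have "\<exists>w. good {} w" unfolding good_def by auto
  moreover have "\<forall>S. (\<exists>w. good S w) \<longrightarrow> card S < Suc (card X)"
    using card_mono[OF finX] unfolding good_def by (auto simp: less_Suc_eq_le)
  ultimately obtain S where "\<exists>w. good S w" and Smax0: "\<forall>S'. (\<exists>w. good S' w) \<longrightarrow> card S' \<le> card S"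
    using ex_has_greatest_nat[of "\<lambda>S. \<exists>w. good S w" "{}" card "Suc (card X)"] by auto
  then obtain w where S: "good S w" by auto
  have Smax: "card S' \<le> card S" if "good S' w'" for S' w' using Smax0 that by blast
  have SX: "S \<subseteq> X" and inj: "inj_on w S" and Sw: "\<And>x. x \<in> S \<Longrightarrow> w x \<in> V - U \<and> E x (w x)"
    using S unfolding good_def by auto
  define m where "m = card S"
  have small: "100 * m < card X" using no that[OF SX inj Sw] unfolding m_def by (meson not_le)
  have finS: "finite S" using SX finX finite_subset by auto
  define Y where "Y = X - S"
  define W where "W = w ` S"
  define Q where "Q = U \<union> W"
  have cY: "card Y = card X - m" unfolding Y_def m_def using SX finS by (rule card_Diff_subset[rotated])
  have cW: "card W = m" unfolding W_def m_def using inj by (rule card_image)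
  have WV: "W \<subseteq> V - U" unfolding W_def using Sw by auto
  have finW: "finite W" unfolding W_def using finS by auto
  have finQ: "finite Q" and QV: "Q \<subseteq> V" unfolding Q_def using finU finW UV WV by auto
  have cQ: "card Q = card U + m" unfolding Q_def using finU finW WV cW by (subst card_Un_disjoint) auto
  have YU: "Y \<subseteq> U" and YQ: "Y \<subseteq> Q" and finY: "finite Y"
    unfolding Y_def Q_def using XU finX by auto
  \<comment> \<open>An edge from an unmatched vertex of \<open>X\<close> to a vertex outside
    \<open>Q\<close> could be added to the maximum matching.\<close>
  have nb: "{u \<in> V. E x u} \<subseteq> Q" if "x \<in> Y" for x
  proof
    fix u assume u: "u \<in> {u \<in> V. E x u}"
    show "u \<in> Q"
    proof (rule ccontr)
      assume "u \<notin> Q"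
      have "x \<notin> S" using that unfolding Y_def by auto
      then have "good (insert x S) (w(x := u))"
        using u \<open>u \<notin> Q\<close> S that unfolding good_def Q_def W_def Y_def inj_on_def by auto
      then show False using Smax \<open>x \<notin> S\<close> finS by fastforce
    qed
  qed
  define miss where "miss x = {z \<in> Q. z \<noteq> x \<and> \<not> E x z}" for x
  have cm: "card Q \<ge> l \<and> card (miss x) \<le> card Q - l" if x: "x \<in> Y" for x
  proof -
    have "insert x {u \<in> V. E x u} \<subseteq> Q" using nb[OF x] x YQ by auto
    moreover have "miss x = Q - insert x {u \<in> V. E x u}" unfolding miss_def using QV by auto
    moreover have "card (insert x {u \<in> V. E x u}) = Suc (card {u \<in> V. E x u})"
      using E_irrefl finV by (subst card_insert_disjoint) auto
    moreover have "finite (insert x {u \<in> V. E x u})" using finV by auto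
    moreover have "x \<in> V" using x YQ QV by auto
    moreover have "card (insert x {u \<in> V. E x u}) \<le> card Q" using card_mono[OF finQ] calculation(1) by blast
    moreover have "card (miss x) = card Q - card (insert x {u \<in> V. E x u})"
      unfolding calculation(2) using calculation(1,4) by (intro card_Diff_subset)
    ultimately show ?thesis using deg[of x] by linarith
  qed
  have "Y \<noteq> {}" using cY small by (intro notI) simp
  then obtain y0 where y0: "y0 \<in> Y" by auto
  \<comment> \<open>By the degree condition a vertex of \<open>Y\<close> has at most
    \<open>e\<close> non-neighbours in \<open>Q\<close>, and \<open>e < m\<close> because
    \<open>U\<close> has fewer than \<open>l\<close> vertices. A cycle of length \<open>l\<close> in
    \<open>Q\<close> has to leave out exactly \<open>e\<close> vertices.\<close>
  define e where "e = card Q - l"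
  have cQl: "card Q = l + e" unfolding e_def using cm[OF y0] by simp
  have em: "e < m" using cQ cQl cU by linarith
  have cmiss: "card (miss x) \<le> e" if "x \<in> Y" for x using cm[OF that] unfolding e_def by auto
  have finmiss: "finite (miss x)" for x unfolding miss_def using finQ by auto
  have Ybig: "99 * m < card Y" using cY small by linarith
  have YlU: "card Y < l" using card_mono[OF finU YU] cU by linarith
  \<comment> \<open>The vertices outside \<open>Y\<close> that see less than half of
    \<open>Y\<close>; counting the missing pairs between \<open>B\<close> and \<open>Y\<close> in
    two ways shows that there are at most \<open>2 * e\<close>.\<close>
  define B where "B = {z \<in> Q - Y. 2 * card {x \<in> Y. E z x} < card Y}"
  have finB: "finite B" and BQ: "B \<subseteq> Q" and BY: "B \<inter> Y = {}" unfolding B_def using finQ by auto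
  have cB: "card B \<le> 2 * e"
  proof -
    have "card B * card Y = (\<Sum>z\<in>B. card Y)" by simp
    also have "\<dots> \<le> (\<Sum>z\<in>B. 2 * card {x \<in> Y. \<not> E z x})"
    proof (rule sum_mono)
      fix z assume "z \<in> B"
      have "card {x \<in> Y. E z x} + card {x \<in> Y. \<not> E z x} = card ({x \<in> Y. E z x} \<union> {x \<in> Y. \<not> E z x})"
        using finY by (subst card_Un_disjoint) auto
      also have "{x \<in> Y. E z x} \<union> {x \<in> Y. \<not> E z x} = Y" by auto
      finally show "card Y \<le> 2 * card {x \<in> Y. \<not> E z x}" using \<open>z \<in> B\<close> unfolding B_def by auto
    qed
    also have "\<dots> = 2 * (\<Sum>x\<in>Y. card {z \<in> B. \<not> E z x})"
      by (simp add: sum_distrib_left[symmetric] double_count[OF finB finY])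
    also have "\<dots> \<le> 2 * (\<Sum>x\<in>Y. e)"
    proof (intro mult_le_mono2 sum_mono)
      fix x assume x: "x \<in> Y"
      have "{z \<in> B. \<not> E z x} \<subseteq> miss x" unfolding miss_def using BQ BY x E_sym by auto
      then show "card {z \<in> B. \<not> E z x} \<le> e" using cmiss[OF x] card_mono[OF finmiss] le_trans by blast
    qed
    also have "\<dots> = 2 * e * card Y" by simp
    finally show ?thesis using y0 finY by (metis card_gt_0_iff empty_iff mult_le_cancel2)
  qed
  have chain: "\<exists>p. pth (Y \<union> B) p \<and> hd p \<in> Y \<and> last p \<in> Y \<and> card (set p \<inter> B) = t \<and> card (set p \<inter> Y) \<le> 2 * t + 1"
    if "t \<le> card B - e" for t
    using that
  proof (induction t)
    case 0
    have "card ({y0} \<inter> B) = 0" "card ({y0} \<inter> Y) \<le> 1" using y0 BY by auto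
    then show ?case using y0 by (intro exI[of _ "[y0]"]) (auto simp: pth_def)
  next
    case (Suc t)
    then obtain p where p: "pth (Y \<union> B) p" "hd p \<in> Y" "last p \<in> Y" "card (set p \<inter> B) = t"
      "card (set p \<inter> Y) \<le> 2 * t + 1" by auto
    have pne: "p \<noteq> []" using p by (auto simp: pth_def)
    define R where "R = B - set p"
    have "card R = card B - card (set p \<inter> B)" unfolding R_def
      by (metis card_Diff_subset_Int finite_Int finB Int_commute)
    then have cR: "e < card R" using p(4) Suc.prems by linarith
    have cR2: "card R \<le> 2 * e" using card_mono[OF finB, of R] cB unfolding R_def by auto
    have finR: "finite R" unfolding R_def using finB by auto
    define F where "F = {x \<in> Y - set p. E (last p) x}"
    have finF: "finite F" unfolding F_def using finY by auto
    have "Y \<subseteq> F \<union> (set p \<inter> Y) \<union> miss (last p)" unfolding F_def miss_def using YQ p(3) pne by auto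
    then have "card Y \<le> card (F \<union> (set p \<inter> Y) \<union> miss (last p))" using finF finY finmiss by (intro card_mono) auto
    also have "\<dots> \<le> card F + card (set p \<inter> Y) + card (miss (last p))" by (meson card_Un_le add_le_mono1 le_trans)
    finally have cF: "card Y \<le> card F + (2 * t + 1) + e" using p(5) cmiss[OF p(3)] by linarith
    have "\<exists>z\<in>R. 2 \<le> card {x \<in> F. E z x}"
    proof (rule ccontr)
      assume a: "\<not> ?thesis"
      have "card F = (\<Sum>x\<in>F. 1)" by simp
      also have "\<dots> \<le> (\<Sum>x\<in>F. card {z \<in> R. E z x})"
      proof (rule sum_mono)
        fix x assume x: "x \<in> F"
        then have xY: "x \<in> Y" unfolding F_def by auto
        have "\<not> R \<subseteq> miss x" using cR cmiss[OF xY] card_mono[OF finmiss, of R x] by linarith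
        then obtain z where "z \<in> R" "z \<notin> miss x" by auto
        then have "z \<in> {z \<in> R. E z x}" using xY BY BQ E_sym unfolding miss_def R_def by auto
        then show "1 \<le> card {z \<in> R. E z x}" using finR card_gt_0_iff[of "{z \<in> R. E z x}"] by (auto simp: Suc_le_eq)
      qed
      also have "\<dots> = (\<Sum>z\<in>R. card {x \<in> F. E z x})" by (rule double_count[OF finR finF, symmetric])
      also have "\<dots> \<le> (\<Sum>z\<in>R. 1)" using a by (intro sum_mono) (auto simp: not_le)
      finally have "card F \<le> card R" by simp
      then show False using cF cR2 em Ybig Suc.prems cB by linarith
    qed
    then obtain z where z: "z \<in> R" "2 \<le> card {x \<in> F. E z x}" by auto
    then obtain T where T: "T \<subseteq> {x \<in> F. E z x}" "card T = 2" by (meson obtain_subset_with_card_n)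
    then obtain a b where ab: "T = {a, b}" "a \<noteq> b" by (meson card_2_iff)
    have a: "a \<in> Y" "a \<notin> set p" "E (last p) a" "E z a" and b: "b \<in> Y" "b \<notin> set p" "E z b"
      using T ab unfolding F_def by auto
    have zz: "z \<in> B" "z \<notin> set p" "z \<notin> Y" using z BY unfolding R_def by auto
    have "pth (Y \<union> B) [a, z, b]" using a b zz ab E_sym unfolding pth_def by auto
    then have "pth (Y \<union> B) (p @ [a, z, b])" using p a b zz by (intro pth_append) auto
    moreover have "hd (p @ [a, z, b]) \<in> Y" "last (p @ [a, z, b]) \<in> Y" using p pne b by auto
    moreover have "set (p @ [a, z, b]) \<inter> B = insert z (set p \<inter> B)" using a b zz BY by auto
    then have "card (set (p @ [a, z, b]) \<inter> B) = Suc t" using p(4) zz by simp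
    moreover have "set (p @ [a, z, b]) \<inter> Y = insert a (insert b (set p \<inter> Y))" using a b zz by auto
    then have "card (set (p @ [a, z, b]) \<inter> Y) \<le> 2 * Suc t + 1"
      using p(5) a b ab by simp
    ultimately show ?case by blast
  qed
  \<comment> \<open>Truncated subtraction: if \<open>B\<close> has at most \<open>e\<close>
    vertices, then \<open>p\<close> avoids \<open>B\<close> altogether.\<close>
  define t where "t = card B - e"
  obtain p where p: "pth (Y \<union> B) p" "hd p \<in> Y" "last p \<in> Y" "card (set p \<inter> B) = t"
      "card (set p \<inter> Y) \<le> 2 * t + 1" using chain[of t] unfolding t_def by auto
  have te: "t \<le> e" unfolding t_def using cB by linarith
  define O' where "O' = Q - Y - B"
  have cO: "card O' + card B + card Y = l + e"
  proof -
    have "card Q = card (O' \<union> B \<union> Y)" unfolding O'_def using BQ YQ by (intro arg_cong[of _ _ card]) auto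
    also have "\<dots> = card (O' \<union> B) + card Y"
      unfolding O'_def using finQ finB finY BY by (intro card_Un_disjoint) auto
    also have "card (O' \<union> B) = card O' + card B"
      unfolding O'_def using finQ finB by (intro card_Un_disjoint) auto
    finally show ?thesis using cQl by simp
  qed
  \<comment> \<open>If \<open>B\<close> has fewer than \<open>e\<close> vertices, the remaining ones
    to be left out are taken from \<open>O'\<close>; this makes \<open>length p + card Z = l\<close>
    exact.\<close>
  obtain Os where Os: "Os \<subseteq> O'" "card Os = card O' - (e - card B)"
    by (meson obtain_subset_with_card_n diff_le_self)
  define Y2 where "Y2 = Y - set p"
  have finOs: "finite Os" using Os(1) finQ unfolding O'_def by (meson finite_Diff finite_subset)
  have finY2: "finite Y2" using finY unfolding Y2_def by auto
  have cY2: "card Y2 + card (set p \<inter> Y) = card Y"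
  proof -
    have "Y = Y2 \<union> (set p \<inter> Y)" unfolding Y2_def by auto
    moreover have "card (Y2 \<union> (set p \<inter> Y)) = card Y2 + card (set p \<inter> Y)"
      unfolding Y2_def using finY by (intro card_Un_disjoint) auto
    ultimately show ?thesis by simp
  qed
  define Z where "Z = Os \<union> Y2"
  have OsY: "Os \<inter> Y = {}" "Os \<subseteq> Q" "Os \<inter> B = {}" using Os unfolding O'_def by auto
  have finZ: "finite Z" unfolding Z_def using finOs finY2 by auto
  have cZ: "card Z = card Os + card Y2" unfolding Z_def using finOs finY2 OsY
    by (intro card_Un_disjoint) (auto simp: Y2_def)
  have lp: "length p = card (set p \<inter> Y) + t"
  proof -
    have "set p = (set p \<inter> Y) \<union> (set p \<inter> B)" using p by (auto simp: pth_def)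
    then have "card (set p) = card (set p \<inter> Y) + card (set p \<inter> B)"
      using BY by (metis (no_types, lifting) card_Un_disjoint finite_Int List.finite_set inf_assoc inf_bot_right inf_commute)
    then show ?thesis using p distinct_card by (metis pth_def)
  qed
  have total: "length p + card Z = l"
    using lp cZ cY2 Os(2) cO YlU unfolding t_def by linarith
  define k where "k = alpha U + m + 2"
  have big: "card {x \<in> Y. E z x} > k + 2 * t + 1" if "z \<in> Os \<union> Y" for z
  proof (cases "z \<in> Y")
    case True
    have "Y \<subseteq> {x \<in> Y. E z x} \<union> insert z (miss z)" unfolding miss_def using YQ by auto
    then have "card Y \<le> card ({x \<in> Y. E z x} \<union> insert z (miss z))" using finY finmiss by (intro card_mono) auto
    also have "\<dots> \<le> card {x \<in> Y. E z x} + card (insert z (miss z))" by (rule card_Un_le)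
    also have "card (insert z (miss z)) \<le> Suc (card (miss z))" by (rule card_insert_le_m1) auto
    finally show ?thesis using cmiss[OF True] Ybig aU em te cY small unfolding k_def by linarith
  next
    case False
    then have "card Y \<le> 2 * card {x \<in> Y. E z x}" using that Os unfolding O'_def B_def by auto
    then show ?thesis using Ybig aU em te cY small unfolding k_def by linarith
  qed
  have nbZ: "\<exists>x\<in>Y2 - C. E z x" if z: "z \<in> Os \<union> Y" and C: "finite C" "card C < k" for z C
  proof (rule ccontr)
    assume "\<not> ?thesis"
    then have "{x \<in> Y. E z x} \<subseteq> (set p \<inter> Y) \<union> C" unfolding Y2_def by auto
    then have "card {x \<in> Y. E z x} \<le> card ((set p \<inter> Y) \<union> C)" using C by (intro card_mono) auto
    also have "\<dots> \<le> card (set p \<inter> Y) + card C" by (rule card_Un_le)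
    finally show False using big[OF z] p(5) C by linarith
  qed
  \<comment> \<open>Two vertices of \<open>Y2\<close> miss so few vertices of \<open>Y\<close> that
    they have a common neighbour in \<open>Y2 - C\<close>. Together with \<open>nbZ\<close> this
    makes \<open>Z\<close> highly connected.\<close>
  have comm: "(x, x') \<in> (edge_rel (Z - C))\<^sup>*" if x: "x \<in> Y2 - C" "x' \<in> Y2 - C" and C: "finite C" "card C < k" for x x' C
  proof -
    have xY: "x \<in> Y" "x' \<in> Y" using x unfolding Y2_def by auto
    define D where "D = ((set p \<inter> Y) \<union> C) \<union> (insert x (miss x) \<union> insert x' (miss x'))"
    have "card D \<le> card ((set p \<inter> Y) \<union> C) + card (insert x (miss x) \<union> insert x' (miss x'))"
      unfolding D_def by (rule card_Un_le)
    also have "\<dots> \<le> (card (set p \<inter> Y) + card C) + (card (insert x (miss x)) + card (insert x' (miss x')))"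
      by (intro add_mono card_Un_le)
    also have "\<dots> \<le> (card (set p \<inter> Y) + card C) + (Suc (card (miss x)) + Suc (card (miss x')))"
      by (intro add_mono card_insert_le_m1) auto
    finally have "card D < card Y" using p(5) C cmiss[OF xY(1)] cmiss[OF xY(2)] te em Ybig aU cY small unfolding k_def by linarith
    then have "\<not> Y \<subseteq> D" using card_mono[of D Y] C finmiss unfolding D_def by auto
    then obtain y where y: "y \<in> Y" "y \<notin> D" by auto
    then have "y \<in> Y2 - C" "E x y" "E x' y" unfolding D_def miss_def Y2_def using YQ by auto
    then have "(x, y) \<in> edge_rel (Z - C)" "(y, x') \<in> edge_rel (Z - C)"
      using x E_sym unfolding edge_rel_def Z_def by auto
    then show ?thesis by auto
  qed
  have kZ: "kconn k Z" unfolding kconn_def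
  proof (intro allI impI)
    fix C assume C0: "C \<subseteq> Z" "card C < k"
    then have C: "finite C" "card C < k" using finZ finite_subset by auto
    have reach: "\<exists>x\<in>Y2 - C. (z, x) \<in> (edge_rel (Z - C))\<^sup>*" if z: "z \<in> Z - C" for z
    proof -
      have "z \<in> Os \<union> Y" using z unfolding Z_def Y2_def by auto
      then obtain x where "x \<in> Y2 - C" "E z x" using nbZ[OF _ C] by blast
      then have "(z, x) \<in> edge_rel (Z - C)" using z unfolding edge_rel_def Z_def by auto
      then show ?thesis using \<open>x \<in> Y2 - C\<close> by auto
    qed
    show "conn (Z - C)" unfolding conn_def
    proof (intro ballI)
      fix z z' assume "z \<in> Z - C" "z' \<in> Z - C"
      then obtain x x' where "x \<in> Y2 - C" "(z, x) \<in> (edge_rel (Z - C))\<^sup>*" "x' \<in> Y2 - C" "(z', x') \<in> (edge_rel (Z - C))\<^sup>*"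
        using reach by metis
      then show "(z, z') \<in> (edge_rel (Z - C))\<^sup>*"
        using comm[OF _ _ C] edge_rel_rtrancl_sym by (meson rtrancl_trans)
    qed
  qed
  have "alpha Z \<le> alpha (U \<union> W)" using finU finW OsY(2) YQ unfolding Z_def Y2_def Q_def
    by (intro alpha_mono) auto
  also have "\<dots> \<le> alpha U + alpha W" by (rule alpha_Un_le[OF finU finW])
  also have "\<dots> \<le> alpha U + m" using alpha_le_card[OF finW] cW by simp
  finally have aZ: "alpha Z + 2 \<le> k" unfolding k_def by simp
  obtain d1 where d1: "d1 \<in> Y2" "E (last p) d1" using nbZ[of "last p" "{}"] p(3) unfolding k_def by auto
  obtain d2 where d2: "d2 \<in> Y2" "E (hd p) d2" "d2 \<noteq> d1" using nbZ[of "hd p" "{d1}"] p(2) unfolding k_def by auto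
  obtain P where P: "pth Z P" "hd P = d1" "last P = d2" "set P = Z"
    using hamilton_path[OF finZ kZ aZ, of d1 d2] d1 d2 unfolding Z_def by auto
  have ZV: "Z \<subseteq> V" using OsY(2) YQ QV unfolding Z_def Y2_def by auto
  have pV: "Y \<union> B \<subseteq> V" using YQ BQ QV by auto
  have "set p \<inter> Z = {}" using p(1) OsY unfolding Z_def Y2_def pth_def by auto
  then have "pth V (p @ P)" using pth_mono[OF p(1) pV] pth_mono[OF P(1) ZV] P d1 by (intro pth_append) auto
  moreover have "length (p @ P) = l" using total P distinct_card by (metis length_append pth_def)
  moreover have "E (last (p @ P)) (hd (p @ P))" using P p d2 E_sym by (auto simp: pth_def)
  ultimately show False using noC unfolding has_cycle_def by blast
qed

end

section \<open>Layers of a breadth-first search\<close>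

lemma (in ugraph) pth_take: "pth A p \<Longrightarrow> 0 < m \<Longrightarrow> pth A (take m p)"
  using pth_appendD1[of A "take m p" "drop m p"] by (auto simp: pth_def)

lemma successively_map_upt:
  assumes "\<And>i. m \<le> i \<Longrightarrow> Suc i < n \<Longrightarrow> P (f i) (f (Suc i))"
  shows "successively P (map f [m..<n])"
  using assms by (auto simp: successively_conv_nth)

text \<open>Only a tree and its levels are recorded, which is all that closing a cycle needs. That
  edges join equal or neighbouring levels is a property of spheres and enters later as a separate
  hypothesis.\<close>

locale layering = ugraph E for E :: "'a \<Rightarrow> 'a \<Rightarrow> bool" +
  fixes V :: "'a set" and S :: "nat \<Rightarrow> 'a set" and par :: "'a \<Rightarrow> 'a" and y :: 'a
  assumes S_sub: "S i \<subseteq> V" and S_disj: "i \<noteq> j \<Longrightarrow> S i \<inter> S j = {}"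
    and S_0: "S 0 = {y}" and par: "v \<in> S (Suc j) \<Longrightarrow> par v \<in> S j \<and> E v (par v)"
begin

lemma par_pow: "v \<in> S J \<Longrightarrow> i \<le> J \<Longrightarrow> (par ^^ i) v \<in> S (J - i)"
proof (induction i)
  case (Suc i)
  then have "(par ^^ i) v \<in> S (Suc (J - Suc i))" by (simp add: Suc_diff_Suc)
  then show ?case using par by auto
qed auto

lemma par_pow_edge: "v \<in> S J \<Longrightarrow> i < J \<Longrightarrow> E ((par ^^ i) v) ((par ^^ Suc i) v)"
  using par_pow[of v J i] par[of "(par ^^ i) v" "J - Suc i"] by (simp add: Suc_diff_Suc)

lemma par_pow_top: "v \<in> S J \<Longrightarrow> (par ^^ J) v = y"
  using par_pow[of v J J] S_0 by auto

lemma par_pow_eq_mono: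
  assumes "(par ^^ i) v = (par ^^ i) w" "i \<le> j"
  shows "(par ^^ j) v = (par ^^ j) w"
  using assms(2,1) by (induction j rule: dec_induct) auto

lemma ancestor_path:
  assumes v: "v \<in> S J" and h: "1 \<le> h" "h \<le> J"
  shows "pth (\<Union>i<J. S i) (map (\<lambda>i. (par ^^ i) v) [1..<Suc h])"
proof -
  have lev: "(par ^^ i) v \<in> S (J - i)" if "i \<le> J" for i using par_pow[OF v that] .
  have "inj_on (\<lambda>i. (par ^^ i) v) {1..<Suc h}"
  proof (rule inj_onI)
    fix i j assume ij: "i \<in> {1..<Suc h}" "j \<in> {1..<Suc h}" and eq: "(par ^^ i) v = (par ^^ j) v"
    have "(par ^^ i) v \<in> S (J - i) \<inter> S (J - j)" using lev[of i] lev[of j] ij h eq by auto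
    then have "J - i = J - j" using S_disj by blast
    then show "i = j" using ij h by auto
  qed
  moreover have "successively E (map (\<lambda>i. (par ^^ i) v) [1..<Suc h])"
    using par_pow_edge[OF v] h by (intro successively_map_upt) auto
  moreover have "(par ^^ i) v \<in> (\<Union>i<J. S i)" if "i \<in> {1..<Suc h}" for i
    using lev[of i] that h by (auto intro!: bexI[of _ "J - i"])
  ultimately show ?thesis using h unfolding pth_def distinct_map by (auto simp del: upt_Suc)
qed

text \<open>\<open>h\<close> is the height of the lowest common ancestor. The path climbs through
  \<open>h\<close> ancestors of \<open>w\<close> and descends through \<open>h - 1\<close> ancestors
  of \<open>z\<close>; a vertex on both branches would be a common ancestor at a height below
  \<open>h\<close>.\<close>

lemma tree_path:
  assumes z: "z \<in> S J" and w: "w \<in> S J" and h: "1 \<le> h" "h \<le> J"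
    and eq: "(par ^^ h) z = (par ^^ h) w" and neq: "(par ^^ (h - 1)) z \<noteq> (par ^^ (h - 1)) w"
  obtains t where "pth (\<Union>i<J. S i) t" "length t = 2 * h - 1" "E w (hd t)" "E (last t) z"
proof -
  define a where "a = (\<lambda>i. (par ^^ i) w)"
  define b where "b = (\<lambda>i. (par ^^ i) z)"
  define t1 where "t1 = map a [1..<Suc h]"
  define t2 where "t2 = rev (map b [1..<h])"
  have p1: "pth (\<Union>i<J. S i) t1" unfolding t1_def a_def using ancestor_path[OF w h] .
  have "t1 = a 1 # map a [2..<Suc h]" unfolding t1_def using h
    by (simp add: upt_conv_Cons numeral_2_eq_2 del: upt_Suc)
  then have h1: "hd t1 = par w" unfolding a_def by auto
  have Ew: "E w (par w)" using par_pow_edge[OF w, of 0] h by auto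
  have Ez: "E (par z) z" using par_pow_edge[OF z, of 0] h E_sym by auto
  have l1: "last t1 = (par ^^ h) z" unfolding t1_def a_def using h eq by (simp add: last_map)
  show ?thesis
  proof (cases "h = 1")
    case True
    then have "last t1 = par z" using l1 by auto
    moreover have "length t1 = 2 * h - 1" unfolding t1_def using True by auto
    ultimately show ?thesis using that[OF p1] h1 Ew Ez by auto
  next
    case False
    then have h2: "2 \<le> h" using h by auto
    have "pth (\<Union>i<J. S i) (map b [1..<Suc (h - 1)])" unfolding b_def using h h2 by (intro ancestor_path[OF z]) auto
    then have p2: "pth (\<Union>i<J. S i) t2" unfolding t2_def using pth_rev h by auto
    have "map b [1..<h] = b 1 # map b [2..<h]" using h2 by (simp add: upt_conv_Cons numeral_2_eq_2)
    then have l2: "last t2 = par z" unfolding t2_def b_def by (simp add: last_rev)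
    have hd2: "hd t2 = (par ^^ (h - 1)) z" unfolding t2_def b_def using h2 by (simp add: hd_rev last_map)
    have "E ((par ^^ (h - 1)) z) ((par ^^ Suc (h - 1)) z)" using h by (intro par_pow_edge[OF z]) auto
    then have e12: "E (last t1) (hd t2)" unfolding l1 hd2 using h E_sym by auto
    have "set t1 \<inter> set t2 = {}"
    proof (rule ccontr)
      assume "\<not> ?thesis"
      then obtain u where u: "u \<in> set t1" "u \<in> set t2" by blast
      obtain i where i: "1 \<le> i" "i \<le> h" "u = a i" using u(1) unfolding t1_def by (auto simp del: upt_Suc)
      obtain j where j: "1 \<le> j" "j < h" "u = b j" using u(2) unfolding t2_def by auto
      note ij = i(1,2) j(1,2) i(3)[unfolded j(3), symmetric]
      have "a i \<in> S (J - i) \<inter> S (J - j)" using par_pow[OF w, of i] par_pow[OF z, of j] ij h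
        unfolding a_def b_def by auto
      then have "J - i = J - j" using S_disj by blast
      then have "i = j" using ij h by auto
      then have "(par ^^ (h - 1)) z = (par ^^ (h - 1)) w"
        using ij par_pow_eq_mono[of i z w "h - 1"] unfolding a_def b_def by auto
      then show False using neq by auto
    qed
    then have "pth (\<Union>i<J. S i) (t1 @ t2)" using p1 p2 e12 by (intro pth_append) auto
    moreover have "length (t1 @ t2) = 2 * h - 1" unfolding t1_def t2_def using h by auto
    moreover have "hd (t1 @ t2) = par w" "last (t1 @ t2) = par z" using h1 l2 p1 p2 by (auto simp: pth_def)
    ultimately show ?thesis using that Ew Ez by metis
  qed
qed

lemma close_cycle:
  assumes z: "z \<in> S J" and w: "w \<in> S J" and h: "1 \<le> h" "h \<le> J"
    and eq: "(par ^^ h) z = (par ^^ h) w" and neq: "(par ^^ (h - 1)) z \<noteq> (par ^^ (h - 1)) w"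
    and p: "pth V p" "hd p = z" "last p = w" "\<And>i. i < J \<Longrightarrow> set p \<inter> S i = {}"
  shows "has_cycle V (length p + 2 * h - 1)"
proof -
  obtain t where t: "pth (\<Union>i<J. S i) t" "length t = 2 * h - 1" "E w (hd t)" "E (last t) z"
    using tree_path[OF z w h eq neq] .
  have "pth V t" by (rule pth_mono[OF t(1)]) (use S_sub in auto)
  moreover have "set p \<inter> set t = {}" using p(4) t(1) unfolding pth_def by blast
  ultimately have "pth V (p @ t)" using p t by (intro pth_append) auto
  moreover have "E (last (p @ t)) (hd (p @ t))" using p t by (auto simp: pth_def)
  moreover have "length (p @ t) = length p + 2 * h - 1" using t h by auto
  ultimately show ?thesis unfolding has_cycle_def by blast
qed

text \<open>The height depends on \<open>z\<close> and \<open>w\<close> alone, so the path between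
  them may be chosen, with the right length, once \<open>h\<close> is known.\<close>

lemma close_cycle_ex:
  assumes z: "z \<in> S J" and w: "w \<in> S J" and zw: "z \<noteq> w"
  obtains h where "1 \<le> h" "h \<le> J"
    "\<And>p. pth V p \<Longrightarrow> hd p = z \<Longrightarrow> last p = w \<Longrightarrow> (\<And>i. i < J \<Longrightarrow> set p \<inter> S i = {}) \<Longrightarrow> has_cycle V (length p + 2 * h - 1)"
proof -
  define h where "h = (LEAST h. (par ^^ h) z = (par ^^ h) w)"
  have top: "(par ^^ J) z = (par ^^ J) w" using par_pow_top z w by auto
  have eq: "(par ^^ h) z = (par ^^ h) w" unfolding h_def using top by (rule LeastI)
  have hJ: "h \<le> J" unfolding h_def using top by (rule Least_le)
  have h1: "1 \<le> h" using eq zw by (cases h) auto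
  have "(par ^^ (h - 1)) z \<noteq> (par ^^ (h - 1)) w"
    using not_less_Least[of "h - 1" "\<lambda>h. (par ^^ h) z = (par ^^ h) w"] h1 unfolding h_def[symmetric] by auto
  then show ?thesis using that[OF h1 hJ] close_cycle[OF z w h1 hJ eq] by metis
qed

text \<open>
  Splitting \<open>H\<close> at the deepest common ancestor into two parts avoids all parity problems: a path
  that starts with an edge between the parts and then stays in one of them closes up to a cycle
  whose length is determined by the length of the path alone.
\<close>

lemma layer_half:
  assumes noC: "\<not> has_cycle V l" and H: "H \<subseteq> S J" "finite H" "conn H" "2 \<le> card H" and l: "2 * J + 2 \<le> l"
  obtains A where "A \<subseteq> H" "card H \<le> 2 * card A" "\<And>p. pth A p \<Longrightarrow> length p < 2 * l"
proof -
  note result = that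
  define const where "const k \<longleftrightarrow> (\<forall>z\<in>H. \<forall>w\<in>H. (par ^^ k) z = (par ^^ k) w)" for k
  \<comment> \<open>The least number of steps after which the ancestors of all vertices of
    \<open>H\<close> agree; one step earlier they form at least two classes, of which
    \<open>A0\<close> is one.\<close>
  define h where "h = (LEAST h. const h)"
  have "(par ^^ J) z = y" if "z \<in> H" for z using par_pow_top that H(1) by auto
  then have top: "const J" unfolding const_def by simp
  have ch: "const h" unfolding h_def using top by (rule LeastI)
  have hJ: "h \<le> J" unfolding h_def using top by (rule Least_le)
  have "\<not> const 0"
  proof
    assume "const 0"
    then have "\<forall>z\<in>H. \<forall>w\<in>H. z = w" unfolding const_def by simp
    then have "card H \<le> 1" using H(2) by (simp add: card_le_Suc0_iff_eq)
    then show False using H(4) by auto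
  qed
  then have h1: "1 \<le> h" using ch by (cases h) auto
  have "\<not> const (h - 1)" using not_less_Least[of "h - 1" const] h1 unfolding h_def[symmetric] by auto
  then obtain u0 v0 where uv: "u0 \<in> H" "v0 \<in> H" "(par ^^ (h - 1)) u0 \<noteq> (par ^^ (h - 1)) v0"
    unfolding const_def by auto
  define A0 where "A0 = {z \<in> H. (par ^^ (h - 1)) z = (par ^^ (h - 1)) u0}"
  define B0 where "B0 = H - A0"
  have main: "length p < 2 * l"
    if AB: "A \<union> B = H" "B \<noteq> {}" and diff: "\<And>z w. z \<in> A \<Longrightarrow> w \<in> B \<Longrightarrow> (par ^^ (h - 1)) z \<noteq> (par ^^ (h - 1)) w"
      and p: "pth A p" for A B p
  proof (rule ccontr)
    assume "\<not> ?thesis"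
    then have lp: "2 * l \<le> length p" by simp
    have pne: "p \<noteq> []" and pA: "set p \<subseteq> A" using p by (auto simp: pth_def)
    have disj: "A \<inter> B = {}" using diff by auto
    have hp: "hd p \<in> A" using pne pA by auto
    define K where "K = component A (hd p)"
    have KA: "K \<subseteq> A" and Kc: "conn K" and Kn: "nadj K (A - K)" and hK: "hd p \<in> K"
      unfolding K_def using component_subset[OF hp] component_conn[OF hp] component_nadj[OF hp] component_refl by auto
    have "\<exists>x\<in>K. \<exists>v\<in>B. E x v"
    proof (rule ccontr)
      assume a: "\<not> ?thesis"
      have "nadj K (H - K)" unfolding nadj_def
      proof (intro ballI)
        fix u v assume "u \<in> K" "v \<in> H - K"
        then show "\<not> E u v" using a Kn AB(1) unfolding nadj_def by (cases "v \<in> B") auto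
      qed
      moreover obtain b where b: "b \<in> B" using AB by auto
      moreover have "(hd p, b) \<in> (edge_rel H)\<^sup>*" using H(3) hp b AB(1) unfolding conn_def by auto
      ultimately have "b \<in> K" using reach_closed[OF _ hK] by blast
      then show False using KA b disj by auto
    qed
    then obtain x v where xv: "x \<in> K" "v \<in> B" "E x v" by auto
    obtain q where q: "pth K q" "hd q = x" "last q = hd p" using conn_pth[OF Kc xv(1) hK] .
    have "q \<noteq> []" using q(1) by (simp add: pth_def)
    then have "\<exists>u\<in>set q. u \<in> set p" using last_in_set[of q] hd_in_set[OF pne] q(3) by auto
    then obtain ys u zs where ys: "q = ys @ u # zs" "u \<in> set p" "\<forall>a\<in>set ys. a \<notin> set p"
      using split_list_first_prop[of q "\<lambda>u. u \<in> set p"] by auto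
    obtain p1 p2 where p12: "p = p1 @ u # p2" using ys(2) by (meson split_list)
    \<comment> \<open>The vertex \<open>u\<close> where \<open>q\<close> first meets
      \<open>p\<close> divides \<open>p\<close> into two arms. As \<open>p\<close> has at least
      \<open>2 * l\<close> vertices, one arm, counted with \<open>u\<close>, has at least
      \<open>l\<close>.\<close>
    have "\<exists>r. pth A r \<and> hd r = u \<and> set r \<subseteq> set p \<and> l \<le> length r"
    proof (cases "l \<le> length (u # p2)")
      case True
      then show ?thesis using pth_appendD2[of A p1 "u # p2"] p p12 by (intro exI[of _ "u # p2"]) auto
    next
      case False
      have "pth A (p1 @ [u])" using pth_appendD1[of A "p1 @ [u]" p2] p p12 by auto
      then have "pth A (rev (p1 @ [u]))" by (rule pth_rev)
      moreover have "l \<le> length (rev (p1 @ [u]))" using False lp p12 by auto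
      ultimately show ?thesis using p12 by (intro exI[of _ "rev (p1 @ [u])"]) auto
    qed
    then obtain r where r: "pth A r" "hd r = u" "set r \<subseteq> set p" "l \<le> length r" by auto
    have rr: "pth A (ys @ r) \<and> hd (ys @ r) = x"
    proof (cases "ys = []")
      case True
      then show ?thesis using r q(2) ys(1) by auto
    next
      case False
      have "pth A ys" using pth_mono[OF pth_appendD1[of K ys "u # zs"] KA] q(1) ys(1) False by auto
      moreover have "E (last ys) u" using pth_append_edge[of K ys "u # zs"] q(1) ys(1) False by auto
      moreover have "set ys \<inter> set r = {}" using ys(3) r(3) by auto
      ultimately have "pth A (ys @ r)" using r by (intro pth_append) auto
      then show ?thesis using False q(2) ys(1) by auto
    qed
    \<comment> \<open>\<open>v\<close>, the \<open>m\<close> vertices of \<open>r'\<close> and the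
      \<open>2 * h - 1\<close> vertices of the tree path add up to \<open>l\<close>. The ends
      \<open>v\<close> and \<open>w\<close> lie in different parts, so their common ancestor has
      height exactly \<open>h\<close>.\<close>
    define m where "m = l - 2 * h"
    have m: "1 \<le> m" "m \<le> length (ys @ r)" "m + 1 + 2 * h - 1 = l" unfolding m_def using l hJ r(4) by auto
    define r' where "r' = take m (ys @ r)"
    have r'ne: "r' \<noteq> []" and lr': "length r' = m" unfolding r'_def using m by auto
    have pr': "pth A r'" unfolding r'_def by (rule pth_take) (use rr m in auto)
    have hr': "hd r' = x" using rr m hd_take[of m "ys @ r"] unfolding r'_def by (simp del: take_append)
    define w where "w = last r'"
    have wA: "w \<in> A" unfolding w_def using pr' r'ne by (auto simp: pth_def)
    have vA: "v \<notin> A" using xv disj by auto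
    have inS: "z \<in> S J" if "z \<in> A \<union> B" for z using that AB H(1) by auto
    have P: "pth H (v # r')" using pth_mono[OF pr', of H] AB xv vA hr' pr' E_sym by (intro pth_Cons) (auto simp: pth_def)
    have "has_cycle V (length (v # r') + 2 * h - 1)"
    proof (rule close_cycle[OF _ _ h1 hJ])
      show "v \<in> S J" "w \<in> S J" using inS xv wA by auto
      show "(par ^^ h) v = (par ^^ h) w" using ch xv wA AB unfolding const_def by auto
      show "(par ^^ (h - 1)) v \<noteq> (par ^^ (h - 1)) w" using diff[OF wA xv(2)] by auto
      show "pth V (v # r')" using P by (rule pth_mono) (use H(1) S_sub in auto)
      show "hd (v # r') = v" "last (v # r') = w" unfolding w_def using r'ne by auto
      show "set (v # r') \<inter> S i = {}" if "i < J" for i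
      proof -
        have "set (v # r') \<subseteq> S J" using P H(1) unfolding pth_def by auto
        then show ?thesis using S_disj[of i J] that by auto
      qed
    qed
    then show False using noC m lr' by simp
  qed
  have AB0: "A0 \<union> B0 = H" "A0 \<noteq> {}" "B0 \<noteq> {}" "A0 \<inter> B0 = {}" unfolding A0_def B0_def using uv by auto
  have diff: "(par ^^ (h - 1)) z \<noteq> (par ^^ (h - 1)) w" if "z \<in> A0" "w \<in> B0" for z w
    using that unfolding A0_def B0_def by auto
  have "card A0 + card B0 = card H" using AB0 H(2) by (metis card_Un_disjoint finite_Un)
  then consider "card H \<le> 2 * card A0" | "card H \<le> 2 * card B0" by linarith
  then show ?thesis
  proof cases
    case 1
    then show ?thesis using result[of A0] main[OF AB0(1,3)] diff AB0 by blast
  next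
    case 2
    have "B0 \<union> A0 = H" using AB0 by auto
    then show ?thesis using result[of B0] main[of B0 A0] diff AB0 2 by (metis Un_upper2)
  qed
qed

text \<open>The factor 8 pays for the losses: passing to a component is free, taking a part without
  long paths halves the size, and passing to fewer than \<open>4 * l\<close> vertices costs another
  factor 2, since paths have fewer than \<open>2 * l\<close> vertices. What remains suffices for
  extracting a \<open>k\<close>-connected set.\<close>

lemma layer_cluster:
  assumes noC: "\<not> has_cycle V l" and Y: "Y \<subseteq> S J" "finite Y" and l: "2 * J + 2 \<le> l" and s: "1 \<le> s"
    and big: "8 * (s + k) * alpha Y < card Y"
  obtains X where "X \<subseteq> Y" "X \<noteq> {}" "kconn k X" "s * alpha X \<le> card X" "card X < 4 * l"
proof -
  have "\<exists>x\<in>Y. 8 * (s + k) * alpha (component Y x) < card (component Y x)"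
  proof (rule ccontr)
    assume "\<not> ?thesis"
    then have "card Y * 1 \<le> 8 * (s + k) * alpha Y"
      by (intro component_bound[OF Y(2)]) (auto simp: not_less)
    then show False using big by auto
  qed
  then obtain x where x: "x \<in> Y" and bigx: "8 * (s + k) * alpha (component Y x) < card (component Y x)" by auto
  define H where "H = component Y x"
  have HY: "H \<subseteq> Y" and Hc: "conn H" and xH: "x \<in> H"
    unfolding H_def using component_subset[OF x] component_conn[OF x] component_refl by auto
  have finH: "finite H" using HY Y(2) finite_subset by auto
  have "1 \<le> alpha H" using alpha_pos[OF finH] xH by auto
  then have "8 * 1 \<le> 8 * (s + k) * alpha H" using s by (intro mult_le_mono) auto
  then have "2 \<le> card H" using bigx unfolding H_def[symmetric] by linarith
  then obtain A where A: "A \<subseteq> H" "card H \<le> 2 * card A" and path: "\<And>p. pth A p \<Longrightarrow> length p < 2 * l"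
    using layer_half[OF noC _ finH Hc _ l] HY Y(1) by (metis subset_trans)
  have finA: "finite A" using A finH finite_subset by auto
  have "8 * (s + k) * alpha A \<le> 8 * (s + k) * alpha H" using alpha_mono[OF finH A(1)] by (rule mult_le_mono2)
  then have cA: "4 * (s + k) * alpha A < card A" using bigx A(2) unfolding H_def[symmetric] by linarith
  have "\<exists>W\<subseteq>A. card W < 4 * l \<and> 2 * (s + k) * alpha W < card W"
  proof (rule ccontr)
    assume "\<not> ?thesis"
    then have "card A * (4 * l - 2 * l) \<le> 2 * (s + k) * (4 * l) * alpha A"
      using path by (intro no_long_path_bound[OF finA]) (auto simp: not_less less_imp_le_nat)
    then have "(2 * l) * card A \<le> (2 * l) * (4 * (s + k) * alpha A)" by (simp add: algebra_simps)
    then show False using cA l by simp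
  qed
  then obtain W where W: "W \<subseteq> A" "card W < 4 * l" "2 * (s + k) * alpha W < card W" by auto
  have finW: "finite W" using W finA finite_subset by auto
  have "W \<noteq> {}" using W(3) by auto
  moreover have "alpha W * (s + k) \<le> 2 * (s + k) * alpha W" by simp
  then have "alpha W * (s + k) \<le> card W + k" using W(3) by linarith
  ultimately obtain X where X: "X \<subseteq> W" "X \<noteq> {}" "kconn k X" "alpha X * (s + k) \<le> card X + k"
    using extract_kconn[OF finW] by blast
  have finX: "finite X" using X finW finite_subset by auto
  have "k * 1 \<le> k * alpha X" using alpha_pos[OF finX X(2)] by (rule mult_le_mono2)
  moreover have "alpha X * (s + k) = s * alpha X + k * alpha X" by (simp add: algebra_simps)
  ultimately have "s * alpha X \<le> card X" using X(4) by linarith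
  moreover have "card X < 4 * l" using card_mono[OF finW X(1)] W(2) by linarith
  moreover have "X \<subseteq> Y" using X W A HY by auto
  ultimately show ?thesis using that X by auto
qed

end

section \<open>Pruning, alternating paths and exact totals\<close>

text \<open>Deleting a node of degree at most \<open>d\<close> costs at most \<open>d\<close> edges,
  so the surplus of edges persists and something nonempty remains. The two sides may overlap: later
  one cluster can be a node of both.\<close>

lemma bip_prune:
  assumes "finite L" "finite R" "F \<subseteq> L \<times> R" "d * (card L + card R) < card F"
  shows "\<exists>G\<subseteq>F. G \<noteq> {} \<and> (\<forall>(x, r)\<in>G. d < card {r'. (x, r') \<in> G} \<and> d < card {x'. (x', r) \<in> G})"
  using assms
proof (induction "card L + card R" arbitrary: L R F rule: less_induct)
  case less
  have finF: "finite F" using less.prems by (meson finite_SigmaI finite_subset)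
  show ?case
  proof (cases "(\<forall>x\<in>L. d < card {r'. (x, r') \<in> F}) \<and> (\<forall>r\<in>R. d < card {x'. (x', r) \<in> F})")
    case True
    moreover have "F \<noteq> {}" using less.prems(4) by auto
    ultimately show ?thesis using less.prems(3) by (intro exI[of _ F]) auto
  next
    case False
    then consider (x) x where "x \<in> L" "card {r'. (x, r') \<in> F} \<le> d" | (r) r where "r \<in> R" "card {x'. (x', r) \<in> F} \<le> d"
      by (meson not_le)
    then have "\<exists>L' R' D. L' \<subseteq> L \<and> R' \<subseteq> R \<and> Suc (card L' + card R') = card L + card R \<and>
      D \<subseteq> F \<and> card D \<le> d \<and> F - D \<subseteq> L' \<times> R'"
    proof cases
      case x
      then show ?thesis using less.prems(1-3) card_Suc_Diff1[OF less.prems(1) x(1)]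
        by (intro exI[of _ "L - {x}"] exI[of _ R] exI[of _ "{x} \<times> {r'. (x, r') \<in> F}"])
          (auto simp: card_cartesian_product)
    next
      case r
      then show ?thesis using less.prems(1-3) card_Suc_Diff1[OF less.prems(2) r(1)]
        by (intro exI[of _ L] exI[of _ "R - {r}"] exI[of _ "{x'. (x', r) \<in> F} \<times> {r}"])
          (auto simp: card_cartesian_product)
    qed
    then obtain L' R' D where sub: "L' \<subseteq> L" "R' \<subseteq> R" "Suc (card L' + card R') = card L + card R"
      and D: "D \<subseteq> F" "card D \<le> d" "F - D \<subseteq> L' \<times> R'" by blast
    have "card (F - D) = card F - card D" using D(1) finF by (meson card_Diff_subset finite_subset)
    moreover have "d + d * (card L' + card R') = d * (card L + card R)" unfolding sub(3)[symmetric] by simp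
    ultimately have big: "d * (card L' + card R') < card (F - D)" using less.prems(4) D(2) by linarith
    have "card L' + card R' < card L + card R" using sub(3) by simp
    from less.hyps[OF this _ _ D(3) big] sub less.prems show ?thesis
      by (meson Diff_subset finite_subset subset_trans)
  qed
qed

text \<open>Greedy choice of fresh nodes on alternating sides. As the sides may share nodes,
  freshness is demanded against the whole list, whence a degree above its full length.\<close>

lemma alternating_path:
  assumes ne: "F \<noteq> {}"
    and deg: "\<And>x r. (x, r) \<in> F \<Longrightarrow> d < card {r'. (x, r') \<in> F} \<and> d < card {x'. (x', r) \<in> F}"
    and "2 * p + 2 \<le> d"
  shows "\<exists>ns. distinct ns \<and> length ns = 2 * p + 1 \<and> last ns \<in> fst ` F \<and>
    (\<forall>i<p. (ns ! (2 * i), ns ! (2 * i + 1)) \<in> F \<and> (ns ! (2 * i + 2), ns ! (2 * i + 1)) \<in> F)"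
  using assms(3)
proof (induction p)
  case 0
  obtain x r where "(x, r) \<in> F" using ne by auto
  then show ?case by (intro exI[of _ "[x]"]) force
next
  case (Suc p)
  then obtain ns where ns: "distinct ns" "length ns = 2 * p + 1" "last ns \<in> fst ` F"
    and F: "\<forall>i<p. (ns ! (2 * i), ns ! (2 * i + 1)) \<in> F \<and> (ns ! (2 * i + 2), ns ! (2 * i + 1)) \<in> F" by auto
  define x where "x = last ns"
  have xe: "x = ns ! (2 * p)" unfolding x_def using ns(2) by (metis add_diff_cancel_right' last_conv_nth length_0_conv add_is_0 one_neq_zero)
  obtain r0 where "(x, r0) \<in> F" using ns(3) unfolding x_def by auto
  then have "card (set ns) < card {r'. (x, r') \<in> F}" using deg Suc.prems ns distinct_card[OF ns(1)] by fastforce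
  then have "\<not> {r'. (x, r') \<in> F} \<subseteq> set ns" by (metis List.finite_set card_mono not_le)
  then obtain r where r: "(x, r) \<in> F" "r \<notin> set ns" by auto
  have "card (set (r # ns)) < card {x'. (x', r) \<in> F}" using deg[OF r(1)] Suc.prems ns r distinct_card[OF ns(1)] by simp
  then have "\<not> {x'. (x', r) \<in> F} \<subseteq> set (r # ns)" by (metis List.finite_set card_mono not_le)
  then obtain x' where x': "(x', r) \<in> F" "x' \<notin> set (r # ns)" by auto
  define ms where "ms = ns @ [r, x']"
  have "(ms ! (2 * i), ms ! (2 * i + 1)) \<in> F \<and> (ms ! (2 * i + 2), ms ! (2 * i + 1)) \<in> F" if "i < Suc p" for i
  proof (cases "i = p")
    case True
    then show ?thesis using r x' xe ns(2) unfolding ms_def by (auto simp: nth_append)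
  next
    case False
    then have "i < p" using that by auto
    then show ?thesis using F ns(2) unfolding ms_def by (auto simp: nth_append)
  qed
  moreover have "distinct ms" "length ms = 2 * Suc p + 1" "last ms \<in> fst ` F"
    unfolding ms_def using ns r x' by force+
  ultimately show ?case by blast
qed

text \<open>Turns the freedom within single clusters into an exact total length.\<close>

lemma sum_between:
  fixes lo hi :: "nat \<Rightarrow> nat"
  assumes "\<And>i. i < n \<Longrightarrow> lo i \<le> hi i" "(\<Sum>i<n. lo i) \<le> t" "t \<le> (\<Sum>i<n. hi i)"
  shows "\<exists>c. (\<forall>i<n. lo i \<le> c i \<and> c i \<le> hi i) \<and> (\<Sum>i<n. c i) = t"
  using assms
proof (induction n arbitrary: t)
  case (Suc n)
  define u where "u = max (lo n) (t - (\<Sum>i<n. hi i))"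
  have "(\<Sum>i<n. lo i) \<le> (\<Sum>i<n. hi i)" using Suc.prems by (intro sum_mono) auto
  then have "(\<Sum>i<n. lo i) \<le> t - u" "t - u \<le> (\<Sum>i<n. hi i)" "u \<le> t" "lo n \<le> u" "u \<le> hi n"
    using Suc.prems(2,3) Suc.prems(1)[of n] unfolding u_def by auto
  then obtain c where c: "\<forall>i<n. lo i \<le> c i \<and> c i \<le> hi i" "(\<Sum>i<n. c i) = t - u"
    using Suc.IH[of "t - u"] Suc.prems(1) by auto
  then show ?case using \<open>u \<le> t\<close> \<open>lo n \<le> u\<close> \<open>u \<le> hi n\<close>
    by (intro exI[of _ "c(n := u)"]) (auto simp: less_Suc_eq)
qed auto

context ugraph
begin

lemma pth_concat:
  assumes "ps \<noteq> []" "\<And>p. p \<in> set ps \<Longrightarrow> pth A p"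
    and "\<And>i j. i < j \<Longrightarrow> j < length ps \<Longrightarrow> set (ps ! i) \<inter> set (ps ! j) = {}"
    and "\<And>i. Suc i < length ps \<Longrightarrow> E (last (ps ! i)) (hd (ps ! Suc i))"
  shows "pth A (concat ps) \<and> hd (concat ps) = hd (hd ps) \<and> last (concat ps) = last (last ps)"
  using assms
proof (induction ps)
  case (Cons p ps)
  show ?case
  proof (cases "ps = []")
    case True
    then show ?thesis using Cons.prems by auto
  next
    case False
    have "pth A (concat ps) \<and> hd (concat ps) = hd (hd ps) \<and> last (concat ps) = last (last ps)"
    proof (rule Cons.IH[OF False])
      show "pth A q" if "q \<in> set ps" for q using Cons.prems(2) that by auto
      show "set (ps ! i) \<inter> set (ps ! j) = {}" if "i < j" "j < length ps" for i j
        using Cons.prems(3)[of "Suc i" "Suc j"] that by auto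
      show "E (last (ps ! i)) (hd (ps ! Suc i))" if "Suc i < length ps" for i
        using Cons.prems(4)[of "Suc i"] that by auto
    qed
    then have IH: "pth A (concat ps)" "hd (concat ps) = hd (hd ps)" "last (concat ps) = last (last ps)" by auto
    have p: "pth A p" using Cons.prems(2) by auto
    have "set p \<inter> set (concat ps) = {}"
    proof -
      have "set p \<inter> set q = {}" if "q \<in> set ps" for q
      proof -
        obtain j where "j < length ps" "q = ps ! j" using \<open>q \<in> set ps\<close> by (metis in_set_conv_nth)
        then show ?thesis using Cons.prems(3)[of 0 "Suc j"] by auto
      qed
      then show ?thesis by auto
    qed
    moreover have "E (last p) (hd (concat ps))"
      using Cons.prems(4)[of 0] False IH(2) by (auto simp: hd_conv_nth)
    ultimately have "pth A (p @ concat ps)" using p IH(1) by (intro pth_append)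
    then show ?thesis using IH p False by (auto simp: pth_def)
  qed
qed auto

section \<open>Balls and spheres of the breadth-first search\<close>

fun ball :: "'a set \<Rightarrow> 'a \<Rightarrow> nat \<Rightarrow> 'a set" where
  "ball V y 0 = {y}"
| "ball V y (Suc n) = ball V y n \<union> {v \<in> V. \<exists>u\<in>ball V y n. E u v}"

fun sphere :: "'a set \<Rightarrow> 'a \<Rightarrow> nat \<Rightarrow> 'a set" where
  "sphere V y 0 = {y}"
| "sphere V y (Suc n) = ball V y (Suc n) - ball V y n"

lemma ball_subset: "y \<in> V \<Longrightarrow> ball V y n \<subseteq> V"
  by (induction n) auto

lemma ball_mono: "m \<le> n \<Longrightarrow> ball V y m \<subseteq> ball V y n"
  by (induction n rule: dec_induct) auto

lemma ball_center: "y \<in> ball V y n"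
  using ball_mono[of 0 n V y] by auto

lemma sphere_sub_ball: "sphere V y n \<subseteq> ball V y n"
  by (cases n) auto

lemma sphere_subset: "y \<in> V \<Longrightarrow> sphere V y n \<subseteq> V"
  using sphere_sub_ball ball_subset by blast

lemma ball_eq_spheres: "ball V y n = (\<Union>j\<le>n. sphere V y j)"
  by (induction n) (auto simp: atMost_Suc)

lemma sphere_not_ball: "m < n \<Longrightarrow> sphere V y n \<inter> ball V y m = {}"
  using ball_mono[of m "n - 1" V y] by (cases n) auto

lemma sphere_disjoint: "i \<noteq> j \<Longrightarrow> sphere V y i \<inter> sphere V y j = {}"
proof (induction i j rule: linorder_wlog)
  case (le a b)
  then show ?case using sphere_not_ball[of a b V y] sphere_sub_ball[of V y a] by auto
next
  case (sym a b)
  then show ?case by auto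
qed

lemma ball_step: "u \<in> ball V y n \<Longrightarrow> v \<in> V \<Longrightarrow> E u v \<Longrightarrow> v \<in> ball V y (Suc n)"
  by auto

lemma sphere_edge: "u \<in> sphere V y i \<Longrightarrow> v \<in> sphere V y j \<Longrightarrow> y \<in> V \<Longrightarrow> E u v \<Longrightarrow> j \<le> Suc i"
  using ball_step[of u V y i v] sphere_not_ball[of "Suc i" j V y] sphere_sub_ball[of V y i] sphere_subset[of y V j]
  by (meson disjoint_iff not_le subsetD)

lemma sphere_parent:
  assumes "v \<in> sphere V y (Suc n)"
  obtains u where "u \<in> sphere V y n" "E v u"
proof -
  have v: "v \<in> V" "v \<notin> ball V y n" using assms by auto
  obtain u where u: "u \<in> ball V y n" "E u v" using assms by auto
  have "u \<in> sphere V y n"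
  proof (cases n)
    case (Suc m)
    then have "u \<notin> ball V y m" using v u(2) by auto
    then show ?thesis using u Suc by auto
  qed (use u in auto)
  then show ?thesis using that u E_sym by auto
qed

text \<open>If every two steps multiplied the size by more than \<open>K\<close>, the ball of radius
  \<open>2 * M + 2\<close> would outgrow \<open>V\<close>. Two steps are needed because neighbours
  of the ball lie within radius \<open>i + 1\<close>, where the independence number is bounded by
  means of the ball of radius \<open>i + 2\<close>.\<close>

lemma ball_growth:
  assumes "finite V" "y \<in> V" "card V \<le> K ^ (M + 1)"
  obtains i where "i \<le> 2 * M" "card (ball V y (i + 2)) \<le> K * card (ball V y i)"
proof -
  have "\<exists>i\<le>2 * M. card (ball V y (i + 2)) \<le> K * card (ball V y i)"
  proof (rule ccontr)
    assume "\<not> ?thesis"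
    then have g: "K * card (ball V y i) < card (ball V y (i + 2))" if "i \<le> 2 * M" for i using that by (meson not_le)
    have *: "K ^ m \<le> card (ball V y (2 * m))" if "m \<le> M" for m
      using that
    proof (induction m)
      case (Suc m)
      then have "K ^ m \<le> card (ball V y (2 * m))" by auto
      then have "K * K ^ m \<le> K * card (ball V y (2 * m))" by (rule mult_le_mono2)
      moreover have "2 * Suc m = 2 * m + 2" by simp
      ultimately show ?case using g[of "2 * m"] Suc.prems unfolding power_Suc by (metis (no_types, lifting) Suc_leD le_trans less_imp_le_nat mult_le_mono2)
    qed simp
    have "K * K ^ M \<le> K * card (ball V y (2 * M))" using *[of M] by (intro mult_le_mono2) blast
    moreover have "K ^ (M + 1) = K * K ^ M" by simp
    ultimately have "K ^ (M + 1) < card (ball V y (2 * M + 2))" using g[of "2 * M"] by linarith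
    moreover have "card (ball V y (2 * M + 2)) \<le> card V" using ball_subset[OF assms(2)] by (intro card_mono assms(1))
    ultimately show False using assms(3) by linarith
  qed
  then show ?thesis using that by auto
qed

lemma alpha_sum_nadj:
  assumes "finite I" "\<And>i. i \<in> I \<Longrightarrow> finite (T i)"
    and "\<And>i j. i \<in> I \<Longrightarrow> j \<in> I \<Longrightarrow> i \<noteq> j \<Longrightarrow> T i \<inter> T j = {} \<and> nadj (T i) (T j)"
  shows "(\<Sum>i\<in>I. alpha (T i)) \<le> alpha (\<Union>i\<in>I. T i)"
  using assms
proof (induction I rule: finite_induct)
  case (insert i I)
  have "(\<Sum>i\<in>insert i I. alpha (T i)) \<le> alpha (T i) + alpha (\<Union>j\<in>I. T j)" using insert by simp
  also have "\<dots> \<le> alpha (T i \<union> (\<Union>j\<in>I. T j))"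
  proof (rule alpha_nadj)
    show "T i \<inter> (\<Union>j\<in>I. T j) = {}" using insert.prems(2)[of i] insert.hyps(2) by blast
    show "nadj (T i) (\<Union>j\<in>I. T j)"
      using insert.prems(2)[of i] insert.hyps(2) unfolding nadj_def by (metis UN_E insertCI)
  qed (use insert in auto)
  finally show ?case by simp
qed auto

text \<open>Spheres whose indices differ by at least two are not adjacent, so within one parity
  class the independence numbers add up to at most that of the ball. The two classes give the factor
  2.\<close>

lemma layered_card_bound:
  assumes fin: "finite V" and y: "y \<in> V" and T: "\<And>j. j \<le> n \<Longrightarrow> T j \<subseteq> sphere V y j"
    and c: "\<And>j. j \<le> n \<Longrightarrow> card (T j) \<le> c * alpha (T j)"
  shows "card (\<Union>j\<le>n. T j) \<le> 2 * c * alpha (ball V y n)"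
proof -
  have finT: "finite (T j)" if "j \<le> n" for j using T[OF that] sphere_subset[OF y] fin by (meson finite_subset)
  have finB: "finite (ball V y n)" using ball_subset[OF y] fin by (rule finite_subset)
  have part: "(\<Sum>j\<in>{j. j \<le> n \<and> P j}. alpha (T j)) \<le> alpha (ball V y n)"
    if P: "\<And>i j. P i \<Longrightarrow> P j \<Longrightarrow> i < j \<Longrightarrow> Suc i < j" for P
  proof -
    have sep: "T i \<inter> T j = {} \<and> nadj (T i) (T j)" if ij: "i \<le> n" "j \<le> n" "P i" "P j" "i < j" for i j
    proof
      show "T i \<inter> T j = {}" using T ij sphere_disjoint[of i j V y] by fastforce
      show "nadj (T i) (T j)" unfolding nadj_def
      proof (intro ballI notI)
        fix u v assume "u \<in> T i" "v \<in> T j" "E u v"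
        then have "j \<le> Suc i" using T ij sphere_edge[OF _ _ y] by blast
        then show False using P[of i j] ij by auto
      qed
    qed
    have "(\<Sum>j\<in>{j. j \<le> n \<and> P j}. alpha (T j)) \<le> alpha (\<Union>j\<in>{j. j \<le> n \<and> P j}. T j)"
    proof (rule alpha_sum_nadj)
      fix i j assume "i \<in> {j. j \<le> n \<and> P j}" "j \<in> {j. j \<le> n \<and> P j}" "i \<noteq> j"
      then show "T i \<inter> T j = {} \<and> nadj (T i) (T j)"
        using sep[of i j] sep[of j i] nadj_sym[of "T j" "T i"] by (cases "i < j") auto
    qed (use finT in auto)
    also have "\<dots> \<le> alpha (ball V y n)"
      using T ball_eq_spheres[of V y n] by (intro alpha_mono[OF finB]) fastforce
    finally show ?thesis .
  qed
  have "card (\<Union>j\<le>n. T j) \<le> (\<Sum>j\<le>n. card (T j))" by (rule card_UN_le) auto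
  also have "\<dots> \<le> (\<Sum>j\<le>n. c * alpha (T j))" using c by (intro sum_mono) auto
  also have "\<dots> = c * (\<Sum>j\<le>n. alpha (T j))" by (simp add: sum_distrib_left)
  also have "(\<Sum>j\<le>n. alpha (T j)) = (\<Sum>j\<in>{j. j \<le> n \<and> even j}. alpha (T j)) + (\<Sum>j\<in>{j. j \<le> n \<and> odd j}. alpha (T j))"
    by (subst sum.union_disjoint[symmetric]) (auto intro!: sum.cong)
  also have "\<dots> \<le> alpha (ball V y n) + alpha (ball V y n)"
  proof (intro add_mono part)
    fix i j :: nat
    show "even i \<Longrightarrow> even j \<Longrightarrow> i < j \<Longrightarrow> Suc i < j" by presburger
    show "odd i \<Longrightarrow> odd j \<Longrightarrow> i < j \<Longrightarrow> Suc i < j" by presburger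
  qed
  finally show ?thesis by (simp add: algebra_simps mult_2)
qed

end

section \<open>Cycles through highly connected clusters\<close>

context layering
begin

text \<open>
  A path through pairwise disjoint vertex sets is closed up by tree paths.  Its length is tuned
  inside the sets with index in \<open>I\<close>, which can be traversed in any number of steps between \<open>m0\<close>
  and \<open>M0\<close>.
\<close>

lemma node_cycle:
  fixes N :: "nat \<Rightarrow> 'a set" and a b :: "nat \<Rightarrow> 'a"
  assumes disj: "\<And>i j. i < j \<Longrightarrow> j \<le> Suc k \<Longrightarrow> N i \<inter> N j = {}"
    and NV: "\<And>i. i \<le> Suc k \<Longrightarrow> N i \<subseteq> V"
    and NS: "\<And>i t. i \<le> Suc k \<Longrightarrow> t < J \<Longrightarrow> N i \<inter> S t = {}"
    and aN: "\<And>i. 1 \<le> i \<Longrightarrow> i \<le> Suc k \<Longrightarrow> a i \<in> N i" and bN: "\<And>i. i \<le> k \<Longrightarrow> b i \<in> N i"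
    and e: "\<And>i. i \<le> k \<Longrightarrow> E (b i) (a (Suc i))"
    and ends: "b 0 \<in> S J" "a (Suc k) \<in> S J"
    and trav: "\<And>i. 1 \<le> i \<Longrightarrow> i \<le> k \<Longrightarrow> \<exists>p. pth (N i) p \<and> hd p = a i \<and> last p = b i \<and> length p \<le> m0"
    and flex: "\<And>i s. i \<in> I \<Longrightarrow> m0 \<le> s \<Longrightarrow> s \<le> M0 \<Longrightarrow> \<exists>p. pth (N i) p \<and> hd p = a i \<and> last p = b i \<and> length p = s"
    and I: "I \<subseteq> {1..k}" and m0: "m0 \<le> M0" and big: "l \<le> card I * M0" and small: "k * m0 + 2 * J + 1 \<le> l"
  shows "has_cycle V l"
proof -
  have "b 0 \<noteq> a (Suc k)" using disj[of 0 "Suc k"] bN[of 0] aN[of "Suc k"] by auto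
  then obtain h where h: "1 \<le> h" "h \<le> J"
    and close: "\<And>p. pth V p \<Longrightarrow> hd p = b 0 \<Longrightarrow> last p = a (Suc k) \<Longrightarrow> (\<And>i. i < J \<Longrightarrow> set p \<inter> S i = {}) \<Longrightarrow> has_cycle V (length p + 2 * h - 1)"
    using close_cycle_ex[OF ends] by metis
  have "\<forall>i\<in>{1..k}. \<exists>p. pth (N i) p \<and> hd p = a i \<and> last p = b i \<and> length p \<le> m0" using trav by auto
  then obtain q where q: "\<And>i. i \<in> {1..k} \<Longrightarrow> pth (N i) (q i) \<and> hd (q i) = a i \<and> last (q i) = b i \<and> length (q i) \<le> m0"
    using bchoice[of "{1..k}"] by metis
  \<comment> \<open>Index \<open>i\<close> stands for the node \<open>Suc i\<close>. The two end
    nodes contribute one vertex each and the tree path \<open>2 * h - 1\<close>, which leaves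
    \<open>l - 1 - 2 * h\<close> for the inner nodes.\<close>
  define lo where "lo i = (if Suc i \<in> I then m0 else length (q (Suc i)))" for i
  define hi where "hi i = (if Suc i \<in> I then M0 else length (q (Suc i)))" for i
  have "(\<Sum>i<k. lo i) \<le> (\<Sum>i<k. m0)" using q unfolding lo_def by (intro sum_mono) auto
  then have l1: "(\<Sum>i<k. lo i) \<le> l - 1 - 2 * h" using small h by auto
  have "card I * M0 = (\<Sum>i\<in>I. M0)" by simp
  also have "\<dots> = (\<Sum>i\<in>I. hi (i - 1))" using I by (intro sum.cong) (auto simp: hi_def)
  also have "\<dots> \<le> (\<Sum>i\<in>{1..k}. hi (i - 1))" using I by (intro sum_mono2) auto
  also have "\<dots> = (\<Sum>i<k. hi i)"
    by (rule sum.reindex_bij_witness[of _ Suc "\<lambda>i. i - 1"]) auto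
  finally have l2: "l - 1 - 2 * h \<le> (\<Sum>i<k. hi i)" using big by linarith
  have "lo i \<le> hi i" for i using m0 unfolding lo_def hi_def by auto
  then obtain c where c: "\<forall>i<k. lo i \<le> c i \<and> c i \<le> hi i" "(\<Sum>i<k. c i) = l - 1 - 2 * h"
    using sum_between[of k lo hi] l1 l2 by blast
  have "\<exists>p. pth (N (Suc i)) p \<and> hd p = a (Suc i) \<and> last p = b (Suc i) \<and> length p = c i" if "i < k" for i
  proof (cases "Suc i \<in> I")
    case True
    then show ?thesis using flex[OF True, of "c i"] c(1) that unfolding lo_def hi_def by auto
  next
    case False
    then have "c i = length (q (Suc i))" using c(1) that unfolding lo_def hi_def by fastforce
    then show ?thesis using q[of "Suc i"] that by (intro exI[of _ "q (Suc i)"]) auto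
  qed
  then obtain r where r: "\<And>i. i < k \<Longrightarrow> pth (N (Suc i)) (r i) \<and> hd (r i) = a (Suc i) \<and> last (r i) = b (Suc i) \<and> length (r i) = c i"
    by metis
  define f where "f i = (if i = 0 then [b 0] else if i = Suc k then [a (Suc k)] else r (i - 1))" for i
  have f: "pth (N i) (f i) \<and> (1 \<le> i \<longrightarrow> hd (f i) = a i) \<and> (i \<le> k \<longrightarrow> last (f i) = b i)" if i: "i \<le> Suc k" for i
  proof -
    consider "i = 0" | "i = Suc k" "i \<noteq> 0" | j where "i = Suc j" "j < k"
      using i by (metis Suc_le_mono le_eq_less_or_eq not0_implies_Suc)
    then show ?thesis using aN[of i] bN[of i] i r by cases (auto simp: f_def pth_single)
  qed
  define ps where "ps = map f [0..<Suc (Suc k)]"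
  have psn: "ps ! i = f i" if "i \<le> Suc k" for i unfolding ps_def using that by (simp del: upt_Suc)
  have psl: "length ps = Suc (Suc k)" unfolding ps_def by simp
  have P: "pth V (concat ps) \<and> hd (concat ps) = hd (hd ps) \<and> last (concat ps) = last (last ps)"
  proof (rule pth_concat)
    show "ps \<noteq> []" using psl by auto
    show "pth V p" if pp: "p \<in> set ps" for p
    proof -
      obtain i where "i \<le> Suc k" "p = f i" using pp unfolding ps_def by (auto simp: less_Suc_eq_le simp del: upt_Suc)
      then show ?thesis using f[of i] NV[of i] pth_mono[of "N i" "f i" V] by auto
    qed
    show "set (ps ! i) \<inter> set (ps ! j) = {}" if "i < j" "j < length ps" for i j
    proof -
      have "set (f i) \<subseteq> N i" "set (f j) \<subseteq> N j" using f[of i] f[of j] that psl by (auto simp: pth_def)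
      then show ?thesis using disj[of i j] that psl psn[of i] psn[of j] by auto
    qed
    show "E (last (ps ! i)) (hd (ps ! Suc i))" if "Suc i < length ps" for i
      using f[of i] f[of "Suc i"] e[of i] that psl psn[of i] psn[of "Suc i"] by auto
  qed
  have "hd ps = f 0" "last ps = f (Suc k)" unfolding ps_def by (auto simp: hd_map last_map simp del: upt_Suc)
  then have hl: "hd (concat ps) = b 0" "last (concat ps) = a (Suc k)" using P unfolding f_def by auto
  have "length (concat ps) = (\<Sum>i<Suc (Suc k). length (f i))"
    unfolding ps_def by (simp add: length_concat comp_def interv_sum_list_conv_sum_set_nat lessThan_atLeast0 del: upt_Suc)
  also have "\<dots> = length (f 0) + (\<Sum>i<Suc k. length (f (Suc i)))" by (rule sum.lessThan_Suc_shift)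
  also have "(\<Sum>i<Suc k. length (f (Suc i))) = (\<Sum>i<k. length (f (Suc i))) + length (f (Suc k))" by (rule sum.lessThan_Suc)
  also have "(\<Sum>i<k. length (f (Suc i))) = (\<Sum>i<k. c i)" using r by (intro sum.cong) (auto simp: f_def)
  finally have len: "length (concat ps) = l - 1 - 2 * h + 2" using c(2) by (simp add: f_def)
  have "has_cycle V (length (concat ps) + 2 * h - 1)"
  proof (rule close[OF _ hl])
    show "pth V (concat ps)" using P by auto
    show "set (concat ps) \<inter> S i = {}" if "i < J" for i
    proof -
      have "set p \<inter> S i = {}" if pp: "p \<in> set ps" for p
      proof -
        obtain j where j: "j \<le> Suc k" "p = f j" using pp unfolding ps_def by (auto simp: less_Suc_eq_le simp del: upt_Suc)
        then have "set p \<subseteq> N j" using f[of j] by (auto simp: pth_def)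
        then show ?thesis using NS[OF j(1) \<open>i < J\<close>] by auto
      qed
      then show ?thesis by auto
    qed
  qed
  moreover have "length (concat ps) + 2 * h - 1 = l" using len small h by linarith
  ultimately show ?thesis by simp
qed

text \<open>\<open>ns\<close> is a path in the contracted graph and \<open>q\<close> the parity of
  the positions of its tunable nodes. An inner tunable node is entered and left along different
  matching edges, hence at different vertices, as a path of prescribed length requires.\<close>

lemma alternating_cycle:
  assumes len: "length ns = 2 * p + 1" "1 \<le> p" and dist: "distinct ns"
    and disj: "\<And>P Q. P \<in> set ns \<Longrightarrow> Q \<in> set ns \<Longrightarrow> P \<noteq> Q \<Longrightarrow> P \<inter> Q = {}"
    and NV: "\<And>P. P \<in> set ns \<Longrightarrow> P \<subseteq> V" and NS: "\<And>P t. P \<in> set ns \<Longrightarrow> t < J \<Longrightarrow> P \<inter> S t = {}"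
    and ends: "ns ! 0 \<subseteq> S J" "ns ! (2 * p) \<subseteq> S J"
    and F: "\<And>X Z. (X, Z) \<in> F \<Longrightarrow> x X Z \<in> X \<and> w X Z \<in> Z \<and> E (x X Z) (w X Z)"
    and inj: "\<And>X Z Z'. (X, Z) \<in> F \<Longrightarrow> (X, Z') \<in> F \<Longrightarrow> Z \<noteq> Z' \<Longrightarrow> x X Z \<noteq> x X Z'"
    and pos: "\<And>i. i < 2 * p \<Longrightarrow> if i mod 2 = q then (ns ! i, ns ! Suc i) \<in> F else (ns ! Suc i, ns ! i) \<in> F"
    and q: "q < 2"
    and trav: "\<And>P a b. P \<in> set ns \<Longrightarrow> a \<in> P \<Longrightarrow> b \<in> P \<Longrightarrow> \<exists>p. pth P p \<and> hd p = a \<and> last p = b \<and> length p \<le> m0"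
    and flex: "\<And>X Z a b s. (X, Z) \<in> F \<Longrightarrow> a \<in> X \<Longrightarrow> b \<in> X \<Longrightarrow> a \<noteq> b \<Longrightarrow> m0 \<le> s \<Longrightarrow> s \<le> M0 \<Longrightarrow>
      \<exists>p. pth X p \<and> hd p = a \<and> last p = b \<and> length p = s"
    and m0: "m0 \<le> M0" and big: "l \<le> (p - 1) * M0" and small: "2 * p * m0 + 2 * J + 1 \<le> l"
  shows "has_cycle V l"
proof -
  define k where "k = 2 * p - 1"
  have k: "Suc k = 2 * p" unfolding k_def using len by auto
  define N where "N i = ns ! i" for i
  have mem: "N i \<in> set ns" if "i \<le> Suc k" for i unfolding N_def using that len k by (intro nth_mem) auto
  have neq: "N i \<noteq> N j" if "i < j" "j \<le> Suc k" for i j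
    using that dist len k unfolding N_def by (simp add: nth_eq_iff_index_eq)
  define a where "a i = (if i mod 2 = q then x (N i) (N (i - 1)) else w (N (i - 1)) (N i))" for i
  define b where "b i = (if i mod 2 = q then x (N i) (N (Suc i)) else w (N (Suc i)) (N i))" for i
  have par: "Suc i mod 2 = q \<longleftrightarrow> i mod 2 \<noteq> q" for i
  proof -
    have "q = 0 \<or> q = 1" using q by auto
    then show ?thesis by (elim disjE) (simp_all, presburger+)
  qed
  have pos1: "(N i, N (Suc i)) \<in> F" if "i \<le> k" "i mod 2 = q" for i using pos[of i] that k unfolding N_def by auto
  have pos2: "(N (Suc i), N i) \<in> F" if "i \<le> k" "i mod 2 \<noteq> q" for i using pos[of i] that k unfolding N_def by auto
  have ab: "a (Suc i) \<in> N (Suc i) \<and> b i \<in> N i \<and> E (b i) (a (Suc i))" if "i \<le> k" for i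
  proof (cases "i mod 2 = q")
    case True
    then show ?thesis using F[OF pos1[OF that True]] par[of i] unfolding a_def b_def by auto
  next
    case False
    then show ?thesis using F[OF pos2[OF that False]] par[of i] E_sym unfolding a_def b_def by auto
  qed
  \<comment> \<open>The inner tunable positions are 2, 4, ..., 2p - 2 for \<open>q = 0\<close> and
    1, 3, ..., 2p - 1 for \<open>q = 1\<close>; \<open>p - 1\<close> is a lower bound for
    both.\<close>
  define I where "I = {i \<in> {1..k}. i mod 2 = q}"
  have "p - 1 \<le> card I"
  proof -
    have "(\<lambda>i. 2 * i + 2 - q) ` {..<p - 1} \<subseteq> I"
    proof
      fix j assume "j \<in> (\<lambda>i. 2 * i + 2 - q) ` {..<p - 1}"
      then obtain i where i: "i < p - 1" "j = 2 * i + 2 - q" by auto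
      have "q = 0 \<or> q = 1" using q by auto
      then have "j mod 2 = q" using i(2) by auto
      then show "j \<in> I" using i q k unfolding I_def by auto
    qed
    moreover have "card ((\<lambda>i. 2 * i + 2 - q) ` {..<p - 1}) = card {..<p - 1}"
      using q by (intro card_image) (auto simp: inj_on_def)
    moreover have "finite I" unfolding I_def by auto
    ultimately show ?thesis using card_mono[of I "(\<lambda>i. 2 * i + 2 - q) ` {..<p - 1}"] by simp
  qed
  then have bigI: "l \<le> card I * M0" using big by (meson le_trans mult_le_mono1)
  show ?thesis
  proof (rule node_cycle[where N = N and a = a and b = b and k = k and J = J and I = I and ?m0.0 = m0 and ?M0.0 = M0])
    show "N i \<inter> N j = {}" if "i < j" "j \<le> Suc k" for i j using disj mem neq that by auto
    show "N i \<subseteq> V" if "i \<le> Suc k" for i using NV mem that by auto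
    show "N i \<inter> S t = {}" if "i \<le> Suc k" "t < J" for i t using NS mem that by auto
    show "a i \<in> N i" if "1 \<le> i" "i \<le> Suc k" for i using ab[of "i - 1"] that by auto
    show "b i \<in> N i" "E (b i) (a (Suc i))" if "i \<le> k" for i using ab[OF that] by auto
    show "b 0 \<in> S J" using ab[of 0] ends unfolding N_def by auto
    show "a (Suc k) \<in> S J" using ab[of k] ends k unfolding N_def by auto
    show "\<exists>p. pth (N i) p \<and> hd p = a i \<and> last p = b i \<and> length p \<le> m0" if "1 \<le> i" "i \<le> k" for i
      using trav[OF mem, of i] ab[of i] ab[of "i - 1"] that by auto
    show "\<exists>p. pth (N i) p \<and> hd p = a i \<and> last p = b i \<and> length p = s" if "i \<in> I" "m0 \<le> s" "s \<le> M0" for i s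
    proof -
      have i: "1 \<le> i" "i \<le> k" "i mod 2 = q" using that unfolding I_def by auto
      have "(i - 1) mod 2 \<noteq> q" using par[of "i - 1"] i by auto
      then have f1: "(N i, N (i - 1)) \<in> F" using pos2[of "i - 1"] i by auto
      have f2: "(N i, N (Suc i)) \<in> F" using pos1 i by auto
      have "N (i - 1) \<noteq> N (Suc i)" using neq[of "i - 1" "Suc i"] i by auto
      then have "a i \<noteq> b i" using inj[OF f1 f2] i unfolding a_def b_def by auto
      then show ?thesis using flex[OF f2 _ _ _ that(2,3), of "a i" "b i"] ab[of i] ab[of "i - 1"] i by auto
    qed
    show "I \<subseteq> {1..k}" unfolding I_def by auto
    show "m0 \<le> M0" "l \<le> card I * M0" by (rule m0, rule bigI)
    show "k * m0 + 2 * J + 1 \<le> l"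
    proof -
      have "k * m0 \<le> 2 * p * m0" using k by (intro mult_le_mono1) auto
      then show ?thesis using small by linarith
    qed
  qed
qed

end

section \<open>Cluster families, pairs of layers and merging\<close>

text \<open>Applied twice in each layer: for big clusters, and in what they leave for smaller
  ones.\<close>

lemma max_disjoint_family:
  assumes "finite A"
  shows "\<exists>F. (\<forall>X\<in>F. X \<subseteq> A \<and> X \<noteq> {} \<and> P X) \<and> (\<forall>X\<in>F. \<forall>Y\<in>F. X \<noteq> Y \<longrightarrow> X \<inter> Y = {}) \<and>
    (\<forall>X\<subseteq>A - \<Union>F. X \<noteq> {} \<longrightarrow> \<not> P X)"
  using assms
proof (induction A rule: finite_psubset_induct)
  case (psubset A)
  show ?case
  proof (cases "\<exists>X\<subseteq>A. X \<noteq> {} \<and> P X")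
    case False
    then show ?thesis by (intro exI[of _ "{}"]) auto
  next
    case True
    then obtain X where X: "X \<subseteq> A" "X \<noteq> {}" "P X" by auto
    then have "A - X \<subset> A" by auto
    then obtain F where F: "\<forall>Y\<in>F. Y \<subseteq> A - X \<and> Y \<noteq> {} \<and> P Y" "\<forall>Y\<in>F. \<forall>Z\<in>F. Y \<noteq> Z \<longrightarrow> Y \<inter> Z = {}"
      "\<forall>Y\<subseteq>A - X - \<Union>F. Y \<noteq> {} \<longrightarrow> \<not> P Y"
      using psubset.IH by meson
    have "A - \<Union>(insert X F) = A - X - \<Union>F" by auto
    have "\<forall>Y\<in>insert X F. Y \<subseteq> A \<and> Y \<noteq> {} \<and> P Y" using X F(1) by auto
    moreover have "\<forall>Y\<in>insert X F. \<forall>Z\<in>insert X F. Y \<noteq> Z \<longrightarrow> Y \<inter> Z = {}"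
    proof -
      have "X \<inter> Y = {}" if "Y \<in> F" for Y using F(1) that by auto
      then show ?thesis using F(2) by (auto simp: Int_commute)
    qed
    moreover have "\<forall>Y\<subseteq>A - \<Union>(insert X F). Y \<noteq> {} \<longrightarrow> \<not> P Y"
      unfolding \<open>A - \<Union>(insert X F) = A - X - \<Union>F\<close> by (rule F(3))
    ultimately show ?thesis by (intro exI[of _ "insert X F"] conjI)
  qed
qed

text \<open>A node belongs to at most three pairs of levels that differ by at most one. If each pair
  were sparse, summing over the pairs would contradict the density of \<open>F\<close>.\<close>

lemma level_pigeonhole:
  fixes f :: "'b \<Rightarrow> nat" and g :: "'c \<Rightarrow> nat"
  assumes fin: "finite L" "finite R" and FLR: "F \<subseteq> L \<times> R"
    and lev: "\<And>x r. (x, r) \<in> F \<Longrightarrow> f x \<le> g r + 1 \<and> g r \<le> f x + 1"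
    and big: "3 * d * (card L + card R) < card F"
  obtains j j' where
    "d * (card {x \<in> L. f x = j} + card {r \<in> R. g r = j'}) < card {e \<in> F. f (fst e) = j \<and> g (snd e) = j'}"
proof -
  define T where "T = {t \<in> f ` L \<times> g ` R. fst t \<le> snd t + 1 \<and> snd t \<le> fst t + 1}"
  have finT: "finite T" unfolding T_def using fin by auto
  have "\<exists>t\<in>T. d * (card {x \<in> L. f x = fst t} + card {r \<in> R. g r = snd t}) < card {e \<in> F. f (fst e) = fst t \<and> g (snd e) = snd t}"
  proof (rule ccontr)
    assume "\<not> ?thesis"
    then have le: "card {e \<in> F. f (fst e) = fst t \<and> g (snd e) = snd t} \<le> d * (card {x \<in> L. f x = fst t} + card {r \<in> R. g r = snd t})"
      if "t \<in> T" for t using that by (meson not_le)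
    have "F \<subseteq> (\<Union>t\<in>T. {e \<in> F. f (fst e) = fst t \<and> g (snd e) = snd t})"
    proof
      fix e assume e: "e \<in> F"
      obtain x r where xr: "e = (x, r)" by (cases e)
      have "(f x, g r) \<in> T" using lev[of x r] e FLR xr unfolding T_def by auto
      then show "e \<in> (\<Union>t\<in>T. {e \<in> F. f (fst e) = fst t \<and> g (snd e) = snd t})" using e xr by force
    qed
    moreover have "finite F" using FLR fin by (meson finite_SigmaI finite_subset)
    ultimately have "card F \<le> card (\<Union>t\<in>T. {e \<in> F. f (fst e) = fst t \<and> g (snd e) = snd t})"
      using finT by (intro card_mono) auto
    also have "\<dots> \<le> (\<Sum>t\<in>T. card {e \<in> F. f (fst e) = fst t \<and> g (snd e) = snd t})" using finT by (rule card_UN_le)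
    also have "\<dots> \<le> (\<Sum>t\<in>T. d * (card {x \<in> L. f x = fst t} + card {r \<in> R. g r = snd t}))" using le by (intro sum_mono) auto
    also have "\<dots> = d * ((\<Sum>t\<in>T. card {x \<in> L. f x = fst t}) + (\<Sum>t\<in>T. card {r \<in> R. g r = snd t}))"
      by (simp add: sum.distrib flip: sum_distrib_left)
    also have "(\<Sum>t\<in>T. card {x \<in> L. f x = fst t}) = (\<Sum>x\<in>L. card {t \<in> T. f x = fst t})"
      by (rule double_count[OF finT fin(1)])
    also have "\<dots> \<le> (\<Sum>x\<in>L. 3)"
    proof (rule sum_mono)
      fix x
      have "{t \<in> T. f x = fst t} \<subseteq> {(f x, f x - 1), (f x, f x), (f x, f x + 1)}" unfolding T_def by auto
      then have "card {t \<in> T. f x = fst t} \<le> card {(f x, f x - 1), (f x, f x), (f x, f x + 1)}" by (intro card_mono) auto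
      also have "\<dots> \<le> 3" by (simp add: card_insert_if)
      finally show "card {t \<in> T. f x = fst t} \<le> 3" .
    qed
    also have "(\<Sum>t\<in>T. card {r \<in> R. g r = snd t}) = (\<Sum>r\<in>R. card {t \<in> T. g r = snd t})"
      by (rule double_count[OF finT fin(2)])
    also have "\<dots> \<le> (\<Sum>r\<in>R. 3)"
    proof (rule sum_mono)
      fix r
      have "{t \<in> T. g r = snd t} \<subseteq> {(g r - 1, g r), (g r, g r), (g r + 1, g r)}" unfolding T_def by auto
      then have "card {t \<in> T. g r = snd t} \<le> card {(g r - 1, g r), (g r, g r), (g r + 1, g r)}" by (intro card_mono) auto
      also have "\<dots> \<le> 3" by (simp add: card_insert_if)
      finally show "card {t \<in> T. g r = snd t} \<le> 3" .
    qed
    finally have "card F \<le> d * ((\<Sum>x\<in>L. 3) + (\<Sum>r\<in>R. 3))" by simp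
    also have "\<dots> = 3 * d * (card L + card R)" by (simp add: algebra_simps)
    finally show False using big by simp
  qed
  then obtain t where "t \<in> T" "d * (card {x \<in> L. f x = fst t} + card {r \<in> R. g r = snd t}) < card {e \<in> F. f (fst e) = fst t \<and> g (snd e) = snd t}"
    by blast
  then show ?thesis using that[of "fst t" "snd t"] by auto
qed

context ugraph
begin

text \<open>Fewer than \<open>k\<close> deleted vertices cannot meet all of at least
  \<open>k\<close> disjoint edges between \<open>A\<close> and \<open>B\<close>, and a surviving
  edge joins the two connected remainders.\<close>

lemma kconn_merge:
  assumes fin: "finite A" "finite B" and kA: "kconn k A" and kB: "kconn k B" and AB: "A \<inter> B = {}"
    and S: "S \<subseteq> A" "inj_on w S" "k \<le> card S" and w: "\<And>x. x \<in> S \<Longrightarrow> w x \<in> B \<and> E x (w x)"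
  shows "kconn k (A \<union> B)"
  unfolding kconn_def
proof (intro allI impI)
  fix C assume C: "C \<subseteq> A \<union> B" "card C < k"
  have finC: "finite C" using C(1) fin finite_subset by blast
  have cC: "card (C \<inter> A) + card (C \<inter> B) = card C"
  proof -
    have "card (C \<inter> A \<union> C \<inter> B) = card (C \<inter> A) + card (C \<inter> B)" using finC AB by (intro card_Un_disjoint) auto
    moreover have "C \<inter> A \<union> C \<inter> B = C" using C(1) by auto
    ultimately show ?thesis by simp
  qed
  have finS: "finite S" using S(1) fin(1) by (rule finite_subset)
  have "\<exists>x\<in>S. x \<notin> C \<and> w x \<notin> C"
  proof (rule ccontr)
    assume "\<not> ?thesis"
    then have "S \<subseteq> (C \<inter> A) \<union> {x \<in> S. w x \<in> C \<inter> B}" using S(1) w by auto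
    then have "card S \<le> card ((C \<inter> A) \<union> {x \<in> S. w x \<in> C \<inter> B})" using finC finS by (intro card_mono) auto
    also have "\<dots> \<le> card (C \<inter> A) + card {x \<in> S. w x \<in> C \<inter> B}" by (rule card_Un_le)
    also have "card {x \<in> S. w x \<in> C \<inter> B} \<le> card (C \<inter> B)"
      using S(2) finC by (intro card_inj_on_le[of w]) (auto simp: inj_on_def)
    finally show False using cC C(2) S(3) by linarith
  qed
  then obtain x where x: "x \<in> A - C" "w x \<in> B - C" "E x (w x)" using S(1) w by blast
  have sub: "A - C \<subseteq> A \<union> B - C" "B - C \<subseteq> A \<union> B - C" by auto
  have "card (C \<inter> A) < k" "card (C \<inter> B) < k" using cC C(2) by auto
  then have "conn (A - C \<inter> A)" "conn (B - C \<inter> B)" using kA kB unfolding kconn_def by auto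
  then have cA: "conn (A - C)" and cB: "conn (B - C)" by (simp_all add: Diff_Int)
  have e: "(x, w x) \<in> (edge_rel (A \<union> B - C))\<^sup>*" using x unfolding edge_rel_def by auto
  have toX: "(z, x) \<in> (edge_rel (A \<union> B - C))\<^sup>*" if "z \<in> A \<union> B - C" for z
  proof (cases "z \<in> A")
    case True
    then have "(z, x) \<in> (edge_rel (A - C))\<^sup>*" using cA that x unfolding conn_def by auto
    then show ?thesis using edge_rel_mono[OF sub(1)] by auto
  next
    case False
    then have "(z, w x) \<in> (edge_rel (B - C))\<^sup>*" using cB that x unfolding conn_def by auto
    then have "(z, w x) \<in> (edge_rel (A \<union> B - C))\<^sup>*" using edge_rel_mono[OF sub(2)] by auto
    then show ?thesis using edge_rel_rtrancl_sym[OF e] by (rule rtrancl_trans)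
  qed
  show "conn (A \<union> B - C)" unfolding conn_def
    using toX edge_rel_rtrancl_sym rtrancl_trans by metis
qed

text \<open>A path on \<open>l\<close> vertices between the ends of an edge closes up. The bound
  \<open>4 * l\<close> on the size enters through \<open>alpha X \<le> m\<close>.\<close>

lemma large_cluster_cycle:
  assumes "finite X" "X \<subseteq> V" "kconn k X" "s * alpha X \<le> card X" "l \<le> card X" "card X < 4 * l"
    and "4 * l \<le> s * m" "10 * m * m \<le> k" "1 \<le> k" "k < s" "2 * m + 2 \<le> l"
  shows "has_cycle V l"
proof -
  have "s * alpha X < s * m" using assms by linarith
  then have al: "alpha X \<le> m" by simp
  have "X \<noteq> {}" using assms by auto
  then obtain a where a: "a \<in> X" by auto
  have "s * 1 \<le> s * alpha X" using alpha_pos[OF assms(1) \<open>X \<noteq> {}\<close>] by (rule mult_le_mono2)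
  then have kX: "k < card X" using assms by linarith
  have "k \<le> card {y \<in> X. E a y}" using kconn_degree[OF assms(1,3) kX a] .
  then have "card {y \<in> X. E a y} \<noteq> 0" using assms(9) by linarith
  then have "{y \<in> X. E a y} \<noteq> {}" by (intro notI) simp
  then obtain b where b: "b \<in> X" "E a b" by auto
  then have "a \<noteq> b" using E_irrefl by auto
  obtain p where p: "pth X p" "hd p = a" "last p = b" "length p = l"
    using panconnected[OF assms(1,3) al assms(8) kX a b(1) \<open>a \<noteq> b\<close> assms(11,5)] .
  have "pth V p" using pth_mono[OF p(1) assms(2)] .
  moreover have "E (last p) (hd p)" using p b E_sym by auto
  ultimately show ?thesis unfolding has_cycle_def using p(4) by blast
qed

end

text \<open>\<open>q\<close> decides which side holds the even positions and thus both ends of the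
  path; for \<open>q = 1\<close> the relation is reversed.\<close>

lemma alternating_path_mod:
  assumes ne: "F \<noteq> {}"
    and deg: "\<And>x r. (x, r) \<in> F \<Longrightarrow> d < card {r'. (x, r') \<in> F} \<and> d < card {x'. (x', r) \<in> F}"
    and d: "2 * p + 2 \<le> d" and q: "q < 2"
  obtains ns where "distinct ns" "length ns = 2 * p + 1"
    "\<forall>i<2 * p. if i mod 2 = q then (ns ! i, ns ! Suc i) \<in> F else (ns ! Suc i, ns ! i) \<in> F"
proof -
  have split: "\<exists>t. (i = 2 * t \<or> i = 2 * t + 1) \<and> t < p" if "i < 2 * p" for i :: nat
    using that by (intro exI[of _ "i div 2"]) auto
  consider "q = 0" | "q = 1" using q by linarith
  then show ?thesis
  proof cases
    case 1
    obtain ns where ns: "distinct ns" "length ns = 2 * p + 1"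
      and e: "\<And>i. i < p \<Longrightarrow> (ns ! (2 * i), ns ! (2 * i + 1)) \<in> F \<and> (ns ! (2 * i + 2), ns ! (2 * i + 1)) \<in> F"
      using alternating_path[OF ne deg d] by blast
    have "if i mod 2 = q then (ns ! i, ns ! Suc i) \<in> F else (ns ! Suc i, ns ! i) \<in> F" if i: "i < 2 * p" for i
    proof -
      obtain t where "i = 2 * t \<or> i = 2 * t + 1" "t < p" using split[OF i] by blast
      then show ?thesis using e[of t] 1 by auto
    qed
    then show ?thesis using that ns by blast
  next
    case 2
    define G where "G = F\<inverse>"
    have degG: "d < card {r'. (x, r') \<in> G} \<and> d < card {x'. (x', r) \<in> G}" if "(x, r) \<in> G" for x r
      using deg[of r x] that unfolding G_def by simp
    have "G \<noteq> {}" unfolding G_def using ne by auto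
    then obtain ns where ns: "distinct ns" "length ns = 2 * p + 1"
      and e: "\<And>i. i < p \<Longrightarrow> (ns ! (2 * i), ns ! (2 * i + 1)) \<in> G \<and> (ns ! (2 * i + 2), ns ! (2 * i + 1)) \<in> G"
      using alternating_path[OF _ degG d] by blast
    have "if i mod 2 = q then (ns ! i, ns ! Suc i) \<in> F else (ns ! Suc i, ns ! i) \<in> F" if i: "i < 2 * p" for i
    proof -
      obtain t where "i = 2 * t \<or> i = 2 * t + 1" "t < p" using split[OF i] by blast
      then show ?thesis using e[of t] 2 unfolding G_def by auto
    qed
    then show ?thesis using that ns by blast
  qed
qed

context layering
begin

text \<open>After a pair of levels is fixed and the graph pruned, the path of nodes is made to start
  and end on the level \<open>J\<close> of smaller index. All nodes then lie in layers from
  \<open>J\<close> on, away from the tree path, which runs strictly below index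
  \<open>J\<close>.\<close>

lemma dense_nodes_cycle:
  fixes f :: "'a set \<Rightarrow> nat"
  assumes fin: "finite LL" "finite RR" and FLR: "F \<subseteq> LL \<times> RR"
    and lev: "\<And>P. P \<in> LL \<union> RR \<Longrightarrow> P \<subseteq> S (f P) \<and> f P \<le> Jm"
    and disj: "\<And>P Q. P \<in> LL \<union> RR \<Longrightarrow> Q \<in> LL \<union> RR \<Longrightarrow> P \<noteq> Q \<Longrightarrow> P \<inter> Q = {}"
    and F: "\<And>X Z. (X, Z) \<in> F \<Longrightarrow> x X Z \<in> X \<and> w X Z \<in> Z \<and> E (x X Z) (w X Z)"
    and inj: "\<And>X Z Z'. (X, Z) \<in> F \<Longrightarrow> (X, Z') \<in> F \<Longrightarrow> Z \<noteq> Z' \<Longrightarrow> x X Z \<noteq> x X Z'"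
    and levF: "\<And>X Z. (X, Z) \<in> F \<Longrightarrow> f X \<le> f Z + 1 \<and> f Z \<le> f X + 1"
    and trav: "\<And>P a b. P \<in> LL \<union> RR \<Longrightarrow> a \<in> P \<Longrightarrow> b \<in> P \<Longrightarrow> \<exists>p. pth P p \<and> hd p = a \<and> last p = b \<and> length p \<le> m0"
    and flex: "\<And>X a b s. X \<in> LL \<Longrightarrow> a \<in> X \<Longrightarrow> b \<in> X \<Longrightarrow> a \<noteq> b \<Longrightarrow> m0 \<le> s \<Longrightarrow> s \<le> M0 \<Longrightarrow>
      \<exists>p. pth X p \<and> hd p = a \<and> last p = b \<and> length p = s"
    and p: "1 \<le> p" and m0: "m0 \<le> M0" and big: "l \<le> (p - 1) * M0" and small: "2 * p * m0 + 2 * Jm + 1 \<le> l"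
    and dense: "3 * (2 * p + 2) * (card LL + card RR) < card F"
  shows "has_cycle V l"
proof -
  obtain j j' where big': "(2 * p + 2) * (card {X \<in> LL. f X = j} + card {Z \<in> RR. f Z = j'}) < card {e \<in> F. f (fst e) = j \<and> f (snd e) = j'}"
    using level_pigeonhole[OF fin FLR levF dense] .
  define G0 where "G0 = {e \<in> F. f (fst e) = j \<and> f (snd e) = j'}"
  have G0sub: "G0 \<subseteq> {X \<in> LL. f X = j} \<times> {Z \<in> RR. f Z = j'}" unfolding G0_def using FLR by auto
  have finj: "finite {X \<in> LL. f X = j}" "finite {Z \<in> RR. f Z = j'}" using fin by auto
  from bip_prune[OF finj G0sub big'[folded G0_def]]
  obtain G where G: "G \<subseteq> G0" "G \<noteq> {}"
    and degG: "\<forall>(x, r)\<in>G. 2 * p + 2 < card {r'. (x, r') \<in> G} \<and> 2 * p + 2 < card {x'. (x', r) \<in> G}"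
    by auto
  have GF: "(X, Z) \<in> F \<and> X \<in> LL \<and> Z \<in> RR \<and> f X = j \<and> f Z = j'" if "(X, Z) \<in> G" for X Z
    using that G(1) FLR unfolding G0_def by auto
  define q :: nat where "q = (if j \<le> j' then 0 else 1)"
  have q2: "q < 2" unfolding q_def by simp
  define J where "J = min j j'"
  have dG: "2 * p + 2 < card {r'. (x, r') \<in> G} \<and> 2 * p + 2 < card {x'. (x', r) \<in> G}" if "(x, r) \<in> G" for x r
    using degG that by auto
  obtain ns where ns: "distinct ns" "length ns = 2 * p + 1"
    and pos0: "\<forall>i<2 * p. if i mod 2 = q then (ns ! i, ns ! Suc i) \<in> G else (ns ! Suc i, ns ! i) \<in> G"
    using alternating_path_mod[OF G(2) dG le_refl q2] .
  have pos: "if i mod 2 = q then (ns ! i, ns ! Suc i) \<in> G else (ns ! Suc i, ns ! i) \<in> G" if "i < 2 * p" for i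
    using pos0 that by blast
  have node: "P \<in> LL \<union> RR \<and> J \<le> f P" if Pns: "P \<in> set ns" for P
  proof -
    obtain i where i: "i < 2 * p + 1" "P = ns ! i" using Pns ns(2) by (metis in_set_conv_nth)
    have "\<exists>Q. (P, Q) \<in> G \<or> (Q, P) \<in> G"
    proof (cases "i < 2 * p")
      case True
      then show ?thesis using pos[OF True] i(2) by (cases "i mod 2 = q") auto
    next
      case False
      then have "i - 1 < 2 * p" "Suc (i - 1) = i" using i(1) p by auto
      then show ?thesis using pos[of "i - 1"] i(2) by (cases "(i - 1) mod 2 = q") auto
    qed
    then show ?thesis using GF unfolding J_def by auto
  qed
  have J1: "j \<le> j' \<Longrightarrow> J = j" and J2: "\<not> j \<le> j' \<Longrightarrow> J = j'" unfolding J_def by auto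
  have e0: "ns ! 0 \<in> LL \<union> RR \<and> f (ns ! 0) = J"
    using pos[of 0] p GF J1 J2 unfolding q_def by (cases "j \<le> j'") auto
  obtain u where "p = Suc u" using p by (cases p) auto
  then have "2 * p - 1 < 2 * p" "Suc (2 * p - 1) = 2 * p" "(2 * p - 1) mod 2 = 1" by auto
  then have e1: "ns ! (2 * p) \<in> LL \<union> RR \<and> f (ns ! (2 * p)) = J"
    using pos[of "2 * p - 1"] GF J1 J2 unfolding q_def by (cases "j \<le> j'") auto
  obtain X Z where XZ: "(X, Z) \<in> G" using G(2) by auto
  then have "j \<le> Jm" "j' \<le> Jm" using GF lev by blast+
  then have JJm: "J \<le> Jm" unfolding J_def by auto
  show ?thesis
  proof (rule alternating_cycle[OF ns(2) p ns(1), where F = G and J = J and q = q and ?m0.0 = m0 and ?M0.0 = M0])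
    show "P \<inter> Q = {}" if "P \<in> set ns" "Q \<in> set ns" "P \<noteq> Q" for P Q using disj node that by blast
    show "P \<subseteq> V" if "P \<in> set ns" for P using node[OF that] lev S_sub by blast
    show "P \<inter> S t = {}" if "P \<in> set ns" "t < J" for P t
    proof -
      have "P \<subseteq> S (f P)" "f P \<noteq> t" using node[OF that(1)] lev that(2) by auto
      then show ?thesis using S_disj[of "f P" t] by blast
    qed
    show "ns ! 0 \<subseteq> S J" "ns ! (2 * p) \<subseteq> S J" using lev e0 e1 by metis+
    show "x X Z \<in> X \<and> w X Z \<in> Z \<and> E (x X Z) (w X Z)" if "(X, Z) \<in> G" for X Z using F GF[OF that] by blast
    show "x X Z \<noteq> x X Z'" if "(X, Z) \<in> G" "(X, Z') \<in> G" "Z \<noteq> Z'" for X Z Z'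
      using inj[OF _ _ that(3)] GF that by blast
    show "if i mod 2 = q then (ns ! i, ns ! Suc i) \<in> G else (ns ! Suc i, ns ! i) \<in> G" if "i < 2 * p" for i by (rule pos[OF that])
    show "q < 2" by (rule q2)
    show "\<exists>p. pth P p \<and> hd p = a \<and> last p = b \<and> length p \<le> m0" if "P \<in> set ns" "a \<in> P" "b \<in> P" for P a b
      using trav[of P a b] node[OF that(1)] that by blast
    show "\<exists>p. pth X p \<and> hd p = a \<and> last p = b \<and> length p = s"
      if "(X, Z) \<in> G" "a \<in> X" "b \<in> X" "a \<noteq> b" "m0 \<le> s" "s \<le> M0" for X Z a b s
      using flex[of X a b s] GF[OF that(1)] that by blast
    show "m0 \<le> M0" "l \<le> (p - 1) * M0" by (rule m0, rule big)
    show "2 * p * m0 + 2 * J + 1 \<le> l" using small JJm by linarith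
  qed
qed

end

section \<open>Expanding graphs contain the cycle\<close>

lemma div_bounds:
  fixes k l :: nat
  assumes "0 < k" "k \<le> l"
  shows "(l div k) * k \<le> l" "l \<le> 2 * (l div k) * k"
proof -
  show "(l div k) * k \<le> l" by simp
  have "l < k + (l div k) * k" using assms(1) by (rule dividend_less_div_times)
  moreover have "1 \<le> l div k" using assms by (simp add: Suc_le_eq div_greater_zero_iff)
  then have "1 * k \<le> (l div k) * k" by (rule mult_le_mono1)
  ultimately show "l \<le> 2 * (l div k) * k" by linarith
qed

text \<open>This situation is to be refuted. \<open>alphaB\<close> is the expansion of a maximum
  independent set of a ball, and \<open>nl\<close> keeps the depth of the search below
  \<open>l / 8\<close>.\<close>

locale stalled_ball = ugraph E for E :: "'a \<Rightarrow> 'a \<Rightarrow> bool" +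
  fixes V :: "'a set" and y :: 'a and l K n :: nat
  assumes finV: "finite V" and yV: "y \<in> V" and noC: "\<not> has_cycle V l"
    and deg: "\<And>v. v \<in> V \<Longrightarrow> l \<le> Suc (card {u \<in> V. E v u})"
    and K: "1000 \<le> K" and Kl: "K ^ 50 \<le> l" and nl: "8 * n + 16 \<le> l"
    and alphaB: "\<And>j. (l - 1) * alpha (ball V y j) \<le> card (ball V y (Suc j))"
    and stall: "card (ball V y (n + 2)) \<le> K * card (ball V y n)"
begin

abbreviation B where "B \<equiv> ball V y"
abbreviation Sp where "Sp \<equiv> sphere V y"

text \<open>
  Clusters are \<open>kp\<close>-connected and have independence number at most \<open>m\<close>; big clusters and all clusters
  have at least \<open>s1\<close> and \<open>s2\<close> vertices, respectively.  The exponents are chosen with room to spare: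
  what matters is that the vertices in no cluster are fewer than those outside big clusters by a
  large power of \<open>K\<close>, and that \<open>10 * m * m \<le> kp\<close> while \<open>kp\<close> is small compared to \<open>s2\<close>.
\<close>

definition kp where "kp = K ^ 23"
definition m where "m = K ^ 11"
definition s1 where "s1 = l div K ^ 2"
definition s2 where "s2 = l div K ^ 10"
definition b0 where "b0 = card (B n)"

lemma pow_le: "i \<le> j \<Longrightarrow> K ^ i \<le> K ^ j"
  using K by (intro power_increasing) auto

lemma s1_bounds: "s1 * K ^ 2 \<le> l" "l \<le> 2 * s1 * K ^ 2" "K ^ 48 \<le> s1"
proof -
  have "K ^ 2 \<le> l" using pow_le[of 2 50] Kl by simp
  moreover have "0 < K ^ 2" using K by simp
  ultimately show "s1 * K ^ 2 \<le> l" "l \<le> 2 * s1 * K ^ 2" unfolding s1_def using div_bounds by blast+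
  have "K ^ 48 * K ^ 2 = K ^ 50" by (simp flip: power_add)
  then have "K ^ 48 = K ^ 50 div K ^ 2" using \<open>0 < K ^ 2\<close> by (metis div_mult_self_is_m)
  also have "\<dots> \<le> s1" unfolding s1_def using Kl by (rule div_le_mono)
  finally show "K ^ 48 \<le> s1" .
qed

lemma s2_bounds: "s2 * K ^ 10 \<le> l" "l \<le> 2 * s2 * K ^ 10" "K ^ 40 \<le> s2"
proof -
  have "K ^ 10 \<le> l" using pow_le[of 10 50] Kl by simp
  moreover have "0 < K ^ 10" using K by simp
  ultimately show "s2 * K ^ 10 \<le> l" "l \<le> 2 * s2 * K ^ 10" unfolding s2_def using div_bounds by blast+
  have "K ^ 40 * K ^ 10 = K ^ 50" by (simp flip: power_add)
  then have "K ^ 40 = K ^ 50 div K ^ 10" using \<open>0 < K ^ 10\<close> by (metis div_mult_self_is_m)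
  also have "\<dots> \<le> s2" unfolding s2_def using Kl by (rule div_le_mono)
  finally show "K ^ 40 \<le> s2" .
qed

lemma s2_le_s1: "s2 \<le> s1"
  unfolding s1_def s2_def using pow_le[of 2 10] K by (intro div_le_mono2) auto

lemma Kpow_mult: "c * K ^ i \<le> K ^ Suc i" if "c \<le> 1000"
  using K that by simp

text \<open>Numerical constants are absorbed by single factors \<open>K \<ge> 1000\<close>, so these
  inequalities come down mainly to comparing exponents.\<close>

lemma sizes: "4 * l \<le> s2 * m" "10 * m * m \<le> kp" "1 \<le> kp" "kp < s2" "2 * m + 2 \<le> s2" "s2 \<le> l"
  "l \<le> (K ^ 3 - 1) * s1" "2 * K ^ 3 * (2 * m + 2) + 2 * (n + 1) + 1 \<le> l" "kp < s1" "200 * K ^ 10 \<le> s1" "1 \<le> s2" "1 \<le> s1"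
proof -
  have "4 * l \<le> s2 * (8 * K ^ 10)" using s2_bounds(2) by simp
  also have "\<dots> \<le> s2 * m" unfolding m_def using Kpow_mult[of 8 10] by (intro mult_le_mono2) simp
  finally show "4 * l \<le> s2 * m" .
  have "10 * m * m = 10 * K ^ 22" unfolding m_def by (simp flip: power_add)
  also have "\<dots> \<le> kp" unfolding kp_def using Kpow_mult[of 10 22] by simp
  finally show "10 * m * m \<le> kp" .
  show "1 \<le> kp" unfolding kp_def using K by simp
  have "2 * K ^ 23 \<le> K ^ 24" using Kpow_mult[of 2 23] by simp
  moreover have "K ^ 24 \<le> K ^ 40" by (rule pow_le) simp
  moreover have "0 < K ^ 23" using K by simp
  ultimately show k2: "kp < s2" unfolding kp_def using s2_bounds(3) by linarith
  then show "kp < s1" "1 \<le> s2" "1 \<le> s1" using s2_le_s1 by auto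
  have "4 * K ^ 11 \<le> K ^ 12" using Kpow_mult[of 4 11] by simp
  moreover have "K ^ 12 \<le> K ^ 40" by (rule pow_le) simp
  moreover have "1 \<le> K ^ 11" using K by simp
  ultimately show "2 * m + 2 \<le> s2" unfolding m_def using s2_bounds(3) by linarith
  show "s2 \<le> l" unfolding s2_def by simp
  have "2 * K ^ 2 + 1 \<le> 3 * K ^ 2" using K by simp
  also have "\<dots> \<le> K ^ 3" using Kpow_mult[of 3 2] by (simp add: numeral_3_eq_3)
  finally have "2 * K ^ 2 \<le> K ^ 3 - 1" by simp
  then have "2 * K ^ 2 * s1 \<le> (K ^ 3 - 1) * s1" by (rule mult_le_mono1)
  moreover have "2 * s1 * K ^ 2 = 2 * K ^ 2 * s1" by simp
  ultimately show "l \<le> (K ^ 3 - 1) * s1" using s1_bounds(2) by linarith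
  have "2 * K ^ 3 * (2 * m + 2) \<le> 2 * K ^ 3 * (4 * m)" using \<open>1 \<le> K ^ 11\<close> unfolding m_def by (intro mult_le_mono2) simp
  also have "\<dots> = 8 * K ^ 14" unfolding m_def by (simp flip: power_add)
  finally have "2 * K ^ 3 * (2 * m + 2) \<le> 8 * K ^ 14" .
  moreover define X where "X = 2 * K ^ 3 * (2 * m + 2)"
  ultimately have "4 * X \<le> 32 * K ^ 14" by simp
  also have "\<dots> \<le> K ^ 15" using Kpow_mult[of 32 14] by simp
  also have "\<dots> \<le> l" using pow_le[of 15 50] Kl by simp
  finally have "4 * X \<le> l" .
  then have "X + 2 * (n + 1) + 1 \<le> l" using nl by presburger
  then show "2 * K ^ 3 * (2 * m + 2) + 2 * (n + 1) + 1 \<le> l" unfolding X_def .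
  have "200 * K ^ 10 \<le> K ^ 11" using Kpow_mult[of 200 10] by simp
  also have "\<dots> \<le> K ^ 48" by (rule pow_le) simp
  finally show "200 * K ^ 10 \<le> s1" using s1_bounds(3) by simp
qed

text \<open>\<open>s\<close> bounds the ratio of \<open>card\<close> to \<open>alpha\<close>, so a
  nonempty cluster has at least \<open>s\<close> vertices. The bound \<open>l\<close> reflects that
  larger sets of this kind contain the cycle.\<close>

definition cluster where "cluster s X \<longleftrightarrow> kconn kp X \<and> s * alpha X \<le> card X \<and> card X < l"

text \<open>The search in a layer yields a set with fewer than \<open>4 * l\<close> vertices. One
  with at least \<open>l\<close> vertices would itself contain the cycle, so what is found is a
  cluster.\<close>

lemma small_if_no_cluster:
  assumes s: "s2 \<le> s" and Y: "Y \<subseteq> Sp J" "J \<le> n + 1" and no: "\<forall>X\<subseteq>Y. X \<noteq> {} \<longrightarrow> \<not> cluster s X"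
    and lay: "layering E V Sp par y"
  shows "card Y \<le> 8 * (s + kp) * alpha Y"
proof (rule ccontr)
  assume "\<not> ?thesis"
  then have big: "8 * (s + kp) * alpha Y < card Y" by simp
  have YV: "Y \<subseteq> V" using Y sphere_subset[OF yV] by blast
  have finY: "finite Y" using YV finV finite_subset by blast
  have lJ: "2 * J + 2 \<le> l" using Y(2) nl by linarith
  have s1': "1 \<le> s" using s sizes(11) by linarith
  obtain X where X: "X \<subseteq> Y" "X \<noteq> {}" "kconn kp X" "s * alpha X \<le> card X" "card X < 4 * l"
    using layering.layer_cluster[OF lay noC Y(1) finY lJ s1' big] .
  show False
  proof (cases "card X < l")
    case True
    then show False using no X unfolding cluster_def by blast
  next
    case False
    have "finite X" "X \<subseteq> V" using X(1) finY YV finite_subset by blast+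
    moreover have "s2 * alpha X \<le> card X" using X(4) s by (meson le_trans mult_le_mono1)
    ultimately have "has_cycle V l"
      using large_cluster_cycle[of X V kp s2 l m] X sizes False by simp
    then show False using noC by simp
  qed
qed

lemma cluster_card: "cluster s X \<Longrightarrow> X \<noteq> {} \<Longrightarrow> finite X \<Longrightarrow> s \<le> card X"
  using alpha_pos[of X] unfolding cluster_def by (metis le_trans mult.right_neutral mult_le_mono2)

lemma cluster_flex:
  assumes "cluster s2 X" "X \<subseteq> V" "a \<in> X" "b \<in> X" "a \<noteq> b" "2 * m + 2 \<le> s" "s \<le> card X"
  shows "\<exists>p. pth X p \<and> hd p = a \<and> last p = b \<and> length p = s"
proof -
  have finX: "finite X" using assms(2) finV finite_subset by blast
  have X: "kconn kp X" "s2 * alpha X \<le> card X" "card X < l" using assms(1) unfolding cluster_def by auto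
  have "s2 * alpha X < s2 * m" using X sizes(1) by linarith
  then have al: "alpha X \<le> m" by simp
  have "s2 \<le> card X" using cluster_card[OF assms(1) _ finX] assms(3) by auto
  then have kX: "kp < card X" using sizes(4) by linarith
  obtain p where "pth X p" "hd p = a" "last p = b" "length p = s"
    using panconnected[OF finX X(1) al sizes(2) kX assms(3-7)] .
  then show ?thesis by blast
qed

text \<open>
  Absorbing into \<open>X\<close> all clusters joined to it by at least \<open>kp\<close> disjoint edges gives a highly
  connected set, which has fewer than \<open>l\<close> vertices; every other cluster receives fewer than \<open>kp\<close>
  edges of a matching that leaves it.
\<close>

lemma light_matching:
  assumes CC: "finite CC" "\<And>Z. Z \<in> CC \<Longrightarrow> cluster s2 Z \<and> Z \<subseteq> V"
    and disj: "\<And>Z Z'. Z \<in> CC \<Longrightarrow> Z' \<in> CC \<Longrightarrow> Z \<noteq> Z' \<Longrightarrow> Z \<inter> Z' = {}"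
    and X: "X \<in> CC" "s1 \<le> card X"
  shows "\<exists>S w. S \<subseteq> X \<and> inj_on w S \<and> card X \<le> 100 * card S \<and> (\<forall>x\<in>S. w x \<in> V \<and> E x (w x)) \<and>
    (\<forall>Z\<in>CC. card {x \<in> S. w x \<in> Z} < kp)"
proof -
  define heavy where "heavy Z \<longleftrightarrow> (\<exists>S w. S \<subseteq> X \<and> inj_on w S \<and> kp \<le> card S \<and> (\<forall>x\<in>S. w x \<in> Z \<and> E x (w x)))" for Z
  define HH where "HH = {Z \<in> CC. Z \<noteq> X \<and> heavy Z}"
  have finZ: "finite Z" if "Z \<in> CC" for Z using CC(2)[OF that] finV finite_subset by blast
  \<comment> \<open>One cluster is absorbed at a time: the old union and the new cluster have fewer
    than \<open>l\<close> vertices each, so together fewer than \<open>4 * l\<close>, and then fewer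
    than \<open>l\<close> again because the cycle is absent.\<close>
  have absorb: "cluster s2 (X \<union> \<Union>H)" if "finite H" "H \<subseteq> HH" for H
    using that
  proof (induction H rule: finite_induct)
    case empty
    then show ?case using CC X by simp
  next
    case (insert Z H)
    have Z: "Z \<in> CC" "Z \<noteq> X" "heavy Z" and HCC: "H \<subseteq> CC" using insert.prems unfolding HH_def by auto
    define A where "A = X \<union> \<Union>H"
    have A: "cluster s2 A" unfolding A_def using insert by auto
    have finA: "finite A" unfolding A_def using insert.hyps HCC finZ X by auto
    have "Z \<inter> Z' = {}" if "Z' \<in> insert X H" for Z'
      using disj[OF Z(1), of Z'] that Z(2) X(1) HCC insert.hyps(2) by blast
    then have AZ: "A \<inter> Z = {}" unfolding A_def by blast
    obtain S w where S: "S \<subseteq> X" "inj_on w S" "kp \<le> card S" "\<forall>x\<in>S. w x \<in> Z \<and> E x (w x)"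
      using Z(3) unfolding heavy_def by blast
    have ZV: "Z \<subseteq> V" "cluster s2 Z" using CC(2)[OF Z(1)] by auto
    have k: "kconn kp (A \<union> Z)"
    proof (rule kconn_merge[OF finA finZ[OF Z(1)] _ _ AZ _ S(2,3)])
      show "kconn kp A" "kconn kp Z" using A ZV(2) unfolding cluster_def by auto
      show "S \<subseteq> A" using S(1) unfolding A_def by auto
    qed (use S(4) in auto)
    have cAZ: "card (A \<union> Z) = card A + card Z" using finA finZ[OF Z(1)] AZ by (rule card_Un_disjoint)
    have "s2 * alpha (A \<union> Z) \<le> s2 * (alpha A + alpha Z)" using alpha_Un_le[OF finA finZ[OF Z(1)]] by (rule mult_le_mono2)
    also have "\<dots> \<le> card (A \<union> Z)" using A ZV(2) cAZ unfolding cluster_def by (simp add: add_mult_distrib2)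
    finally have al: "s2 * alpha (A \<union> Z) \<le> card (A \<union> Z)" .
    have "card (A \<union> Z) < l"
    proof (rule ccontr)
      assume "\<not> ?thesis"
      moreover have "card (A \<union> Z) < 4 * l" using A ZV(2) cAZ unfolding cluster_def by linarith
      moreover have "A \<subseteq> V" unfolding A_def using CC(2) X HCC by blast
      then have "A \<union> Z \<subseteq> V" using ZV by blast
      moreover have "finite (A \<union> Z)" using finA finZ Z by auto
      ultimately have "has_cycle V l"
        using large_cluster_cycle[of "A \<union> Z" V kp s2 l m] k al sizes by simp
      then show False using noC by simp
    qed
    then have "cluster s2 (A \<union> Z)" using k al unfolding cluster_def by blast
    moreover have "X \<union> \<Union>(insert Z H) = A \<union> Z" unfolding A_def by auto
    ultimately show ?case by simp
  qed
  define U where "U = X \<union> \<Union>HH"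
  have "finite HH" unfolding HH_def using CC(1) by auto
  then have U: "cluster s2 U" unfolding U_def by (intro absorb) auto
  have UV: "U \<subseteq> V" unfolding U_def HH_def using CC(2) X(1) by blast
  have XU: "X \<subseteq> U" unfolding U_def by auto
  have cU: "card U < l" "s2 * alpha U \<le> card U" using U unfolding cluster_def by auto
  \<comment> \<open>\<open>s2\<close> is of order \<open>l / K ^ 10\<close>, so
    \<open>alpha U\<close> stays below \<open>2 * K ^ 10\<close>, which is negligible against
    \<open>s1\<close>.\<close>
  have "2 * s2 * K ^ 10 = s2 * (2 * K ^ 10)" by simp
  then have "s2 * alpha U < s2 * (2 * K ^ 10)" using cU s2_bounds(2) by linarith
  then have "alpha U < 2 * K ^ 10" by simp
  then have aU: "100 * alpha U \<le> card X" using sizes(10) X(2) by linarith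
  have "\<exists>S w. S \<subseteq> X \<and> inj_on w S \<and> (\<forall>x\<in>S. w x \<in> V - U \<and> E x (w x)) \<and> card X \<le> 100 * card S"
    by (rule outward_matching[OF finV noC deg XU UV cU(1) aU]) blast+
  then obtain S w where S: "S \<subseteq> X" "inj_on w S" "\<forall>x\<in>S. w x \<in> V - U \<and> E x (w x)" "card X \<le> 100 * card S" by blast
  have "card {x \<in> S. w x \<in> Z} < kp" if Z: "Z \<in> CC" for Z
  proof (rule ccontr)
    assume big: "\<not> ?thesis"
    then have "{x \<in> S. w x \<in> Z} \<noteq> {}" using sizes(3) by (intro notI) simp
    then obtain x where "x \<in> S" "w x \<in> Z" by auto
    then have ZU: "\<not> Z \<subseteq> U" using S(3) by auto
    have "heavy Z" unfolding heavy_def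
      using S big by (intro exI[of _ "{x \<in> S. w x \<in> Z}"] exI[of _ w]) (auto simp: inj_on_def not_less)
    moreover have "Z \<noteq> X" using ZU XU by auto
    ultimately have "Z \<in> HH" using Z unfolding HH_def by auto
    then show False using ZU unfolding U_def by auto
  qed
  then show ?thesis using S by (intro exI[of _ S] exI[of _ w]) auto
qed

lemma ex_layering: "\<exists>par. layering E V Sp par y"
proof -
  have "\<exists>u. \<forall>j. v \<in> Sp (Suc j) \<longrightarrow> u \<in> Sp j \<and> E v u" for v
  proof (cases "\<exists>j. v \<in> Sp (Suc j)")
    case True
    then obtain j where j: "v \<in> Sp (Suc j)" by blast
    obtain u where u: "u \<in> Sp j" "E v u" using sphere_parent[OF j] .
    have "i = j" if "v \<in> Sp (Suc i)" for i
      using sphere_disjoint[of "Suc i" "Suc j" V y] j that by (cases "i = j") blast+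
    then show ?thesis using u by (intro exI[of _ u]) blast
  qed blast
  then obtain par where par: "\<forall>v j. v \<in> Sp (Suc j) \<longrightarrow> par v \<in> Sp j \<and> E v (par v)"
    using choice[of "\<lambda>v u. \<forall>j. v \<in> Sp (Suc j) \<longrightarrow> u \<in> Sp j \<and> E v u"] by blast
  have "layering E V Sp par y"
  proof unfold_locales
    show "Sp i \<subseteq> V" for i by (rule sphere_subset[OF yV])
    show "Sp i \<inter> Sp j = {}" if "i \<noteq> j" for i j by (rule sphere_disjoint[OF that])
    show "Sp 0 = {y}" by simp
    show "par v \<in> Sp j \<and> E v (par v)" if "v \<in> Sp (Suc j)" for v j using par that by blast
  qed
  then show ?thesis by blast
qed

text \<open>The matchings leaving the big clusters have a constant fraction of \<open>b0\<close>
  edges in total, whereas sparsity of the contracted graph leaves room for only a tiny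
  fraction.\<close>

lemma contradiction: False
proof -
  obtain par where lay: "layering E V Sp par y" using ex_layering by blast
  define fam where "fam A s C \<longleftrightarrow> (\<forall>X\<in>C. X \<subseteq> A \<and> X \<noteq> {} \<and> cluster s X) \<and> (\<forall>X\<in>C. \<forall>Y\<in>C. X \<noteq> Y \<longrightarrow> X \<inter> Y = {}) \<and>
    (\<forall>X\<subseteq>A - \<Union>C. X \<noteq> {} \<longrightarrow> \<not> cluster s X)" for A s C
  have finSp: "finite (Sp j)" for j using sphere_subset[OF yV] finV by (rule finite_subset)
  have ex_fam: "\<exists>C. fam A s C" if "finite A" for A s
    unfolding fam_def by (rule max_disjoint_family[OF that])
  have "\<forall>j. \<exists>C. fam (Sp j) s1 C" using ex_fam finSp by blast
  then obtain C1 where C1: "\<And>j. fam (Sp j) s1 (C1 j)" by metis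
  define T where "T j = Sp j - \<Union>(C1 j)" for j
  have "\<forall>j. \<exists>C. fam (T j) s2 C" unfolding T_def using ex_fam finSp by blast
  then obtain C2 where C2: "\<And>j. fam (T j) s2 (C2 j)" by metis
  define Q where "Q j = T j - \<Union>(C2 j)" for j
  \<comment> \<open>Matchings start in big clusters within radius \<open>n\<close>, but their other
    ends may have distance \<open>n + 1\<close> from \<open>y\<close>; the families of targets
    therefore extend one layer further.\<close>
  define LL where "LL = (\<Union>j\<le>n. C1 j)"
  define CC where "CC = (\<Union>j\<le>n + 1. C1 j \<union> C2 j)"
  define R where "R = (\<Union>j\<le>n + 1. Q j)"
  have C1D: "X \<subseteq> Sp j" "X \<noteq> {}" "cluster s1 X" if "X \<in> C1 j" for X j using C1 that unfolding fam_def by blast+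
  have C2D: "X \<subseteq> T j" "X \<noteq> {}" "cluster s2 X" if "X \<in> C2 j" for X j using C2 that unfolding fam_def by blast+
  have TSp: "T j \<subseteq> Sp j" and QT: "Q j \<subseteq> T j" for j unfolding T_def Q_def by auto
  have mono: "cluster s2 X" if "cluster s1 X" for X
    using that s2_le_s1 unfolding cluster_def by (meson le_trans mult_le_mono1)
  have CCD: "\<exists>j\<le>n + 1. Z \<subseteq> Sp j \<and> Z \<in> C1 j \<union> C2 j" "Z \<noteq> {}" "cluster s2 Z" "Z \<subseteq> V" "finite Z" if Z: "Z \<in> CC" for Z
  proof -
    obtain j where j: "j \<le> n + 1" "Z \<in> C1 j \<union> C2 j" using Z unfolding CC_def by blast
    have ZS: "Z \<subseteq> Sp j \<and> Z \<noteq> {} \<and> cluster s2 Z"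
    proof (cases "Z \<in> C1 j")
      case True
      then show ?thesis using C1D[OF True] mono by simp
    next
      case False
      then have "Z \<in> C2 j" using j(2) by simp
      from C2D[OF this] show ?thesis using TSp[of j] by auto
    qed
    then show "\<exists>j\<le>n + 1. Z \<subseteq> Sp j \<and> Z \<in> C1 j \<union> C2 j" using j by (intro exI[of _ j]) simp
    show "Z \<noteq> {}" "cluster s2 Z" using ZS by simp_all
    show "Z \<subseteq> V" using ZS sphere_subset[OF yV] by blast
    then show "finite Z" using finV finite_subset by blast
  qed
  have LLCC: "LL \<subseteq> CC" unfolding LL_def CC_def by fastforce
  have finCC: "finite CC" using CCD(4) finV by (intro finite_subset[of CC "Pow V"]) auto
  have finLL: "finite LL" using LLCC finCC finite_subset by blast
  have CCdisj: "Z \<inter> Z' = {}" if Z: "Z \<in> CC" "Z' \<in> CC" "Z \<noteq> Z'" for Z Z'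
  proof -
    obtain j where j: "Z \<subseteq> Sp j" "Z \<in> C1 j \<union> C2 j" using CCD(1)[OF Z(1)] by blast
    obtain j' where j': "Z' \<subseteq> Sp j'" "Z' \<in> C1 j' \<union> C2 j'" using CCD(1)[OF Z(2)] by blast
    show ?thesis
    proof (cases "j = j'")
      case False
      then show ?thesis using sphere_disjoint[OF False, of V y] j j' by blast
    next
      case True
      have d12: "X \<inter> X' = {}" if "X \<in> C1 j" "X' \<in> C2 j" for X X' using C2D(1)[OF that(2)] that(1) unfolding T_def by blast
      have d1: "X \<inter> X' = {}" if "X \<in> C1 j" "X' \<in> C1 j" "X \<noteq> X'" for X X' using C1[of j] that unfolding fam_def by simp
      have d2: "X \<inter> X' = {}" if "X \<in> C2 j" "X' \<in> C2 j" "X \<noteq> X'" for X X' using C2[of j] that unfolding fam_def by simp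
      consider "Z \<in> C1 j" "Z' \<in> C1 j" | "Z \<in> C1 j" "Z' \<in> C2 j" | "Z \<in> C2 j" "Z' \<in> C1 j" | "Z \<in> C2 j" "Z' \<in> C2 j"
        using j(2) j'(2) True by auto
      then show ?thesis using d1[of Z Z'] d2[of Z Z'] d12[of Z Z'] d12[of Z' Z] Z(3) by cases auto
    qed
  qed
  have RC: "v \<notin> Z" if v: "v \<in> R" and Z: "Z \<in> CC" for v Z
  proof
    assume vZ: "v \<in> Z"
    obtain i where i: "v \<in> Q i" using v unfolding R_def by blast
    obtain j where j: "Z \<subseteq> Sp j" "Z \<in> C1 j \<union> C2 j" using CCD(1)[OF Z] by blast
    have "v \<in> Sp i \<inter> Sp j" using i QT TSp j(1) vZ by blast
    then have "i = j" using sphere_disjoint[of i j V y] by blast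
    then show False using i j(2) vZ unfolding Q_def T_def by blast
  qed
  have cover: "v \<in> R \<or> (\<exists>Z\<in>CC. v \<in> Z)" if v: "v \<in> B (n + 1)" for v
  proof -
    obtain j where "j \<le> n + 1" "v \<in> Sp j" using v unfolding ball_eq_spheres by blast
    then show ?thesis unfolding R_def CC_def Q_def T_def by blast
  qed
  have cT: "card (T j) \<le> 8 * (s1 + kp) * alpha (T j)" if "j \<le> n" for j
  proof (rule small_if_no_cluster[OF s2_le_s1 TSp _ _ lay])
    show "j \<le> n + 1" using that by simp
    show "\<forall>X\<subseteq>T j. X \<noteq> {} \<longrightarrow> \<not> cluster s1 X" using C1[of j] unfolding fam_def T_def by blast
  qed
  have cQ: "card (Q j) \<le> 8 * (s2 + kp) * alpha (Q j)" if "j \<le> n + 1" for j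
  proof (rule small_if_no_cluster[OF le_refl _ that _ lay])
    show "Q j \<subseteq> Sp j" using QT TSp by blast
    show "\<forall>X\<subseteq>Q j. X \<noteq> {} \<longrightarrow> \<not> cluster s2 X" using C2[of j] unfolding fam_def Q_def by blast
  qed
  have ball1: "card (B (n + 1)) \<le> K * b0"
  proof -
    have "card (B (n + 1)) \<le> card (B (n + 2))"
      by (intro card_mono ball_mono finite_subset[OF ball_subset[OF yV] finV]) simp
    then show ?thesis using stall unfolding b0_def by linarith
  qed
  have b0pos: "0 < b0" unfolding b0_def using ball_center[of y V n] finite_subset[OF ball_subset[OF yV, of n] finV] card_gt_0_iff by blast
  have finR: "finite R" unfolding R_def using finSp QT TSp by (meson finite_UN_I finite_atMost finite_subset)
  have K1: "K ^ 2 = K * K" by (simp add: power2_eq_square)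
  \<comment> \<open>The sets \<open>T j\<close> have about \<open>s1 * alpha (B n)\<close> vertices
    at most, and \<open>alpha (B n) \<le> K * b0 / (l - 1)\<close>. With \<open>s1\<close> about
    \<open>l / K ^ 2\<close> a factor \<open>K\<close> is left to beat the constant.\<close>
  have Tsmall: "2 * card (\<Union>j\<le>n. T j) \<le> b0"
  proof -
    define c where "c = card (\<Union>j\<le>n. T j)"
    have "c \<le> 2 * (8 * (s1 + kp)) * alpha (B n)" unfolding c_def by (rule layered_card_bound[OF finV yV TSp cT])
    then have "(l - 1) * c \<le> (l - 1) * (2 * (8 * (s1 + kp)) * alpha (B n))" by (rule mult_le_mono2)
    also have "\<dots> = 16 * (s1 + kp) * ((l - 1) * alpha (B n))" by simp
    also have "\<dots> \<le> 16 * (s1 + kp) * (K * b0)" using alphaB[of n] ball1 by (intro mult_le_mono2) simp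
    also have "\<dots> \<le> 32 * s1 * (K * b0)" using sizes(9) by (intro mult_le_mono1) simp
    finally have "K * ((l - 1) * c) \<le> K * (32 * s1 * (K * b0))" by (rule mult_le_mono2)
    also have "\<dots> = 32 * (s1 * K ^ 2) * b0" unfolding K1 by simp
    also have "\<dots> \<le> 32 * (2 * (l - 1)) * b0" using s1_bounds(1) nl by (intro mult_le_mono1 mult_le_mono2) linarith
    finally have "(l - 1) * (K * c) \<le> (l - 1) * (64 * b0)" by (simp add: ac_simps)
    then have "K * c \<le> 64 * b0" using nl by simp
    moreover have "1000 * c \<le> K * c" using K by (rule mult_le_mono1)
    ultimately show ?thesis unfolding c_def[symmetric] by linarith
  qed
  \<comment> \<open>The same estimate one layer further out, with \<open>s2\<close> in place of
    \<open>s1\<close>, saves \<open>K ^ 9\<close>.\<close>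
  have Rsmall: "K ^ 9 * card R \<le> 64 * b0"
  proof -
    have "Q j \<subseteq> Sp j" for j using QT TSp by blast
    then have "card R \<le> 2 * (8 * (s2 + kp)) * alpha (B (n + 1))" unfolding R_def by (intro layered_card_bound[OF finV yV _ cQ])
    then have "(l - 1) * card R \<le> (l - 1) * (2 * (8 * (s2 + kp)) * alpha (B (n + 1)))" by (rule mult_le_mono2)
    also have "\<dots> = 16 * (s2 + kp) * ((l - 1) * alpha (B (n + 1)))" by simp
    also have "\<dots> \<le> 16 * (s2 + kp) * (K * b0)" using alphaB[of "n + 1"] stall unfolding b0_def by (intro mult_le_mono2) simp
    also have "\<dots> \<le> 32 * s2 * (K * b0)" using sizes(4) by (intro mult_le_mono1) simp
    finally have "K ^ 9 * ((l - 1) * card R) \<le> K ^ 9 * (32 * s2 * (K * b0))" by (rule mult_le_mono2)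
    also have "\<dots> = 32 * (s2 * (K ^ 9 * K)) * b0" by simp
    also have "K ^ 9 * K = K ^ 10" by (simp flip: power_Suc2)
    also have "32 * (s2 * K ^ 10) * b0 \<le> 32 * (2 * (l - 1)) * b0" using s2_bounds(1) nl by (intro mult_le_mono1 mult_le_mono2) linarith
    finally have "(l - 1) * (K ^ 9 * card R) \<le> (l - 1) * (64 * b0)" by (simp add: ac_simps)
    then show ?thesis using nl by simp
  qed
  have pdisj: "pairwise disjnt D" if "D \<subseteq> CC" for D
    using CCdisj that unfolding pairwise_def disjnt_def by blast
  have LLcard: "s1 \<le> card X" if X: "X \<in> LL" for X
  proof -
    have "cluster s1 X" using X C1D unfolding LL_def by blast
    then show ?thesis using cluster_card CCD(2,5) LLCC X by blast
  qed
  have finB: "finite (B j)" for j using ball_subset[OF yV] finV by (rule finite_subset)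
  have LLball: "\<Union>LL \<subseteq> B n"
    using C1D(1) unfolding LL_def ball_eq_spheres by blast
  have "finite X" if "X \<in> LL" for X using CCD(5) LLCC that by blast
  then have sumLL: "(\<Sum>X\<in>LL. card X) = card (\<Union>LL)"
    using card_Union_disjoint[OF pdisj[OF LLCC]] by simp
  have vol: "b0 \<le> 2 * (\<Sum>X\<in>LL. card X)"
  proof -
    have "B n \<subseteq> \<Union>LL \<union> (\<Union>j\<le>n. T j)" unfolding ball_eq_spheres LL_def T_def by blast
    moreover have "\<Union>LL \<union> (\<Union>j\<le>n. T j) \<subseteq> B n" using LLball TSp unfolding ball_eq_spheres by fast
    then have "finite (\<Union>LL \<union> (\<Union>j\<le>n. T j))" using finB by (rule finite_subset)
    ultimately have "b0 \<le> card (\<Union>LL \<union> (\<Union>j\<le>n. T j))" unfolding b0_def by (intro card_mono)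
    also have "\<dots> \<le> card (\<Union>LL) + card (\<Union>j\<le>n. T j)" by (rule card_Un_le)
    finally show ?thesis using Tsmall sumLL by linarith
  qed
  have cLL: "s1 * card LL \<le> b0"
  proof -
    have "s1 * card LL = (\<Sum>X\<in>LL. s1)" by simp
    also have "\<dots> \<le> (\<Sum>X\<in>LL. card X)" using LLcard by (rule sum_mono)
    also have "\<dots> \<le> b0" unfolding sumLL b0_def by (intro card_mono finB LLball)
    finally show ?thesis .
  qed
  have cCC: "s2 * card CC \<le> K * b0"
  proof -
    have "s2 * card CC = (\<Sum>X\<in>CC. s2)" by simp
    also have "\<dots> \<le> (\<Sum>X\<in>CC. card X)" using cluster_card CCD by (intro sum_mono) blast
    also have "\<dots> = card (\<Union>CC)" using card_Union_disjoint[OF pdisj[OF subset_refl]] CCD(5) by auto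
    also have "\<dots> \<le> card (B (n + 1))"
    proof (intro card_mono finB)
      show "\<Union>CC \<subseteq> B (n + 1)" using CCD(1) unfolding ball_eq_spheres by fast
    qed
    finally show ?thesis using ball1 by linarith
  qed
  define PP where "PP X S w \<longleftrightarrow> S \<subseteq> X \<and> inj_on w S \<and> card X \<le> 100 * card S \<and> (\<forall>x\<in>S. w x \<in> V \<and> E x (w x)) \<and>
    (\<forall>Z\<in>CC. card {x \<in> S. w x \<in> Z} < kp)" for X S and w :: "'a \<Rightarrow> 'a"
  have "\<exists>S w. PP X S w" if X: "X \<in> LL" for X
  proof -
    have c: "cluster s2 Z \<and> Z \<subseteq> V" if "Z \<in> CC" for Z using CCD(3,4)[OF that] by simp
    have "X \<in> CC" using LLCC X by blast
    from light_matching[OF finCC c CCdisj this LLcard[OF X]] show ?thesis unfolding PP_def by simp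
  qed
  then have "\<forall>X\<in>LL. \<exists>S w. PP X S w" by simp
  then obtain SS WW where PP: "\<forall>X\<in>LL. PP X (SS X) (WW X)" by metis
  have SW: "SS X \<subseteq> X" "inj_on (WW X) (SS X)" "card X \<le> 100 * card (SS X)"
    "\<And>x. x \<in> SS X \<Longrightarrow> WW X x \<in> V \<and> E x (WW X x)" "\<And>Z. Z \<in> CC \<Longrightarrow> card {x \<in> SS X. WW X x \<in> Z} < kp" if "X \<in> LL" for X
    using PP that unfolding PP_def by auto
  \<comment> \<open>Uncovered vertices become one-element nodes, so that all nodes of the contracted
    graph are sets of vertices.\<close>
  define RS where "RS = (\<lambda>v. {v}) ` R"
  have finRS: "finite RS" and cRS: "card RS = card R" unfolding RS_def using finR by (auto intro!: card_image)
  define f where "f P = (SOME j. P \<subseteq> Sp j)" for P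
  have fI: "f P = j" if P: "P \<noteq> {}" "P \<subseteq> Sp j" for P j
    unfolding f_def
  proof (rule some_equality)
    fix i assume "P \<subseteq> Sp i"
    then show "i = j" using P sphere_disjoint[of i j V y] by blast
  qed (rule P(2))
  have lev: "P \<subseteq> Sp (f P) \<and> f P \<le> n + 1" if P: "P \<in> CC \<union> RS" for P
  proof -
    have "\<exists>j\<le>n + 1. P \<noteq> {} \<and> P \<subseteq> Sp j"
    proof (cases "P \<in> CC")
      case True
      then show ?thesis using CCD(1,2) by blast
    next
      case False
      then obtain v where v: "v \<in> R" "P = {v}" using P unfolding RS_def by blast
      then obtain j where "j \<le> n + 1" "v \<in> Q j" unfolding R_def by blast
      then show ?thesis using v QT TSp by blast
    qed
    then show ?thesis using fI by blast
  qed
  have ndisj: "P \<inter> P' = {}" if P: "P \<in> CC \<union> RS" "P' \<in> CC \<union> RS" "P \<noteq> P'" for P P'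
  proof -
    have RR: "P \<inter> P' = {}" if "P \<in> RS" "P' \<in> CC" for P P' using that RC unfolding RS_def by blast
    consider "P \<in> CC" "P' \<in> CC" | "P \<in> RS" "P' \<in> CC" | "P \<in> CC" "P' \<in> RS" | "P \<in> RS" "P' \<in> RS" using P by blast
    then show ?thesis
    proof cases
      case 1 then show ?thesis using CCdisj P(3) by blast
    next
      case 2 then show ?thesis using RR by blast
    next
      case 3 then show ?thesis using RR[of P' P] by blast
    next
      case 4 then show ?thesis using P(3) unfolding RS_def by blast
    qed
  qed
  \<comment> \<open>With more edges there would be a path of \<open>2 * K ^ 3 + 1\<close> nodes. Its
    \<open>K ^ 3 - 1\<close> inner tunable nodes, each offering up to \<open>s1\<close> vertices,
    suffice for length \<open>l\<close>, while crossing all inner nodes with few vertices stays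
    below it.\<close>
  have sparse: "card (SIGMA X:LL. {Z \<in> RR. \<exists>x\<in>SS X. WW X x \<in> Z}) \<le> 8 * K ^ 3 * (card LL + card RR)"
    if RR: "RR \<subseteq> CC \<union> RS" for RR
  proof (rule ccontr)
    define F where "F = (SIGMA X:LL. {Z \<in> RR. \<exists>x\<in>SS X. WW X x \<in> Z})"
    assume "\<not> ?thesis"
    then have big: "8 * K ^ 3 * (card LL + card RR) < card F" unfolding F_def by simp
    have "1 \<le> K ^ 3" using K by simp
    then have "3 * (2 * K ^ 3 + 2) * (card LL + card RR) \<le> 8 * K ^ 3 * (card LL + card RR)"
      using pow_le[of 1 3] K by (intro mult_le_mono1) simp
    then have dense: "3 * (2 * K ^ 3 + 2) * (card LL + card RR) < card F" using big by linarith
    define xx where "xx X Z = (SOME x. x \<in> SS X \<and> WW X x \<in> Z)" for X Z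
    have xx: "xx X Z \<in> SS X" "WW X (xx X Z) \<in> Z" "X \<in> LL" "Z \<in> RR" if XZ: "(X, Z) \<in> F" for X Z
    proof -
      have "\<exists>x. x \<in> SS X \<and> WW X x \<in> Z" using XZ unfolding F_def by blast
      then have "xx X Z \<in> SS X \<and> WW X (xx X Z) \<in> Z" unfolding xx_def by (rule someI_ex)
      then show "xx X Z \<in> SS X" "WW X (xx X Z) \<in> Z" by auto
      show "X \<in> LL" "Z \<in> RR" using XZ unfolding F_def by auto
    qed
    have Fp: "xx X Z \<in> X \<and> WW X (xx X Z) \<in> Z \<and> E (xx X Z) (WW X (xx X Z))" if "(X, Z) \<in> F" for X Z
      using xx[OF that] SW(1,4)[OF xx(3)[OF that]] by blast
    have LR: "LL \<union> RR \<subseteq> CC \<union> RS" using RR LLCC by blast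
    have finRR: "finite RR" using RR finCC finRS finite_subset by blast
    have "has_cycle V l"
    proof (rule layering.dense_nodes_cycle[OF lay finLL finRR, where F = F and f = f and Jm = "n + 1" and x = xx
          and w = "\<lambda>X Z. WW X (xx X Z)" and ?m0.0 = "2 * m + 2" and ?M0.0 = s1 and p = "K ^ 3"])
      show "F \<subseteq> LL \<times> RR" unfolding F_def by auto
      show "P \<subseteq> Sp (f P) \<and> f P \<le> n + 1" if "P \<in> LL \<union> RR" for P using lev LR that by blast
      show "P \<inter> P' = {}" if "P \<in> LL \<union> RR" "P' \<in> LL \<union> RR" "P \<noteq> P'" for P P' using ndisj LR that by blast
      show "xx X Z \<in> X \<and> WW X (xx X Z) \<in> Z \<and> E (xx X Z) (WW X (xx X Z))" if "(X, Z) \<in> F" for X Z by (rule Fp[OF that])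
      show "xx X Z \<noteq> xx X Z'" if XZ: "(X, Z) \<in> F" "(X, Z') \<in> F" "Z \<noteq> Z'" for X Z Z'
      proof
        assume "xx X Z = xx X Z'"
        then have "WW X (xx X Z) \<in> Z \<inter> Z'" using xx(2)[OF XZ(1)] xx(2)[OF XZ(2)] by simp
        moreover have "Z \<inter> Z' = {}" using ndisj[OF _ _ XZ(3)] xx(4)[OF XZ(1)] xx(4)[OF XZ(2)] RR by blast
        ultimately show False by blast
      qed
      show "f X \<le> f Z + 1 \<and> f Z \<le> f X + 1" if XZ: "(X, Z) \<in> F" for X Z
      proof -
        have "X \<subseteq> Sp (f X)" "Z \<subseteq> Sp (f Z)" using lev xx(3,4)[OF XZ] LLCC RR by blast+
        then have "xx X Z \<in> Sp (f X)" "WW X (xx X Z) \<in> Sp (f Z)" "E (xx X Z) (WW X (xx X Z))" using Fp[OF XZ] by blast+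
        then show ?thesis using sphere_edge[OF _ _ yV] E_sym by (metis Suc_eq_plus1)
      qed
      show "\<exists>p. pth P p \<and> hd p = a \<and> last p = b \<and> length p \<le> 2 * m + 2"
        if P: "P \<in> LL \<union> RR" "a \<in> P" "b \<in> P" for P a b
      proof (cases "a = b")
        case True
        then show ?thesis using P pth_single[of a P] by (intro exI[of _ "[a]"]) auto
      next
        case False
        then have PC: "P \<in> CC" using P LR unfolding RS_def by auto
        have "s2 \<le> card P" using cluster_card CCD PC by blast
        then have "2 * m + 2 \<le> card P" using sizes(5) by linarith
        from cluster_flex[OF CCD(3,4)[OF PC] P(2,3) False le_refl this] show ?thesis by (metis le_refl)
      qed
      show "\<exists>p. pth X p \<and> hd p = a \<and> last p = b \<and> length p = s"
        if X: "X \<in> LL" "a \<in> X" "b \<in> X" "a \<noteq> b" "2 * m + 2 \<le> s" "s \<le> s1" for X a b s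
        using cluster_flex[of X a b s] CCD(3,4) LLCC X LLcard[OF X(1)] by (meson le_trans subsetD)
      show "1 \<le> K ^ 3" by fact
      show "2 * m + 2 \<le> s1" using sizes(5) s2_le_s1 by linarith
      show "l \<le> (K ^ 3 - 1) * s1" by (rule sizes(7))
      show "2 * K ^ 3 * (2 * m + 2) + 2 * (n + 1) + 1 \<le> l" by (rule sizes(8))
      show "3 * (2 * K ^ 3 + 2) * (card LL + card RR) < card F" by (rule dense)
    qed
    then show False using noC by simp
  qed
  \<comment> \<open>The two kinds of targets are counted apart: matching edges into uncovered
    vertices give distinct nodes, while those into clusters lose a factor \<open>kp\<close>, made up
    for by the much smaller number of clusters.\<close>
  define Na where "Na X = {Z \<in> RS. \<exists>x\<in>SS X. WW X x \<in> Z}" for X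
  define Nb where "Nb X = {Z \<in> CC. \<exists>x\<in>SS X. WW X x \<in> Z}" for X
  have finNa: "finite (Na X)" and finNb: "finite (Nb X)" for X unfolding Na_def Nb_def using finRS finCC by auto
  have split: "card (SS X) \<le> card (Na X) + kp * card (Nb X)" if X: "X \<in> LL" for X
  proof -
    note X' = SW(1,2,4,5)[OF X]
    have finS: "finite (SS X)" using X'(1) CCD(5) LLCC X finite_subset by blast
    have "SS X \<subseteq> {x \<in> SS X. WW X x \<in> R} \<union> (\<Union>Z\<in>Nb X. {x \<in> SS X. WW X x \<in> Z})"
    proof
      fix x assume x: "x \<in> SS X"
      then have "x \<in> B n" using X'(1) LLball X by blast
      then have "WW X x \<in> B (n + 1)" using ball_step[of x V y n "WW X x"] X'(3)[OF x] by simp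
      then show "x \<in> {x \<in> SS X. WW X x \<in> R} \<union> (\<Union>Z\<in>Nb X. {x \<in> SS X. WW X x \<in> Z})"
        using cover x unfolding Nb_def by blast
    qed
    then have "card (SS X) \<le> card ({x \<in> SS X. WW X x \<in> R} \<union> (\<Union>Z\<in>Nb X. {x \<in> SS X. WW X x \<in> Z}))"
      using finS finNb by (intro card_mono) auto
    also have "\<dots> \<le> card {x \<in> SS X. WW X x \<in> R} + card (\<Union>Z\<in>Nb X. {x \<in> SS X. WW X x \<in> Z})" by (rule card_Un_le)
    also have "card {x \<in> SS X. WW X x \<in> R} \<le> card (Na X)"
      using X'(2) finNa by (intro card_inj_on_le[of "\<lambda>x. {WW X x}"]) (auto simp: inj_on_def Na_def RS_def)
    also have "card (\<Union>Z\<in>Nb X. {x \<in> SS X. WW X x \<in> Z}) \<le> (\<Sum>Z\<in>Nb X. card {x \<in> SS X. WW X x \<in> Z})"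
      using finNb by (rule card_UN_le)
    also have "\<dots> \<le> (\<Sum>Z\<in>Nb X. kp)" using X'(4) unfolding Nb_def by (intro sum_mono) (simp add: less_imp_le_nat)
    finally show ?thesis by (simp add: mult.commute)
  qed
  define ca where "ca = card (SIGMA X:LL. Na X)"
  define cb where "cb = card (SIGMA X:LL. Nb X)"
  have "b0 \<le> 2 * (\<Sum>X\<in>LL. 100 * card (SS X))" 
  proof -
    have "(\<Sum>X\<in>LL. card X) \<le> (\<Sum>X\<in>LL. 100 * card (SS X))" using SW(3) by (rule sum_mono)
    then show ?thesis using vol by linarith
  qed
  also have "\<dots> \<le> 2 * (\<Sum>X\<in>LL. 100 * (card (Na X) + kp * card (Nb X)))" using split by (intro mult_le_mono2 sum_mono) simp
  also have "\<dots> = 200 * (ca + kp * cb)"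
    unfolding ca_def cb_def using finLL finNa finNb by (simp add: sum_distrib_left[symmetric] sum.distrib)
  finally have b0le: "b0 \<le> 200 * ca + 200 * (kp * cb)" by simp
  have ca: "ca \<le> 8 * K ^ 3 * (card LL + card R)" unfolding ca_def Na_def cRS[symmetric] by (rule sparse) blast
  have cb: "cb \<le> 8 * K ^ 3 * (card LL + card CC)" unfolding cb_def Nb_def by (rule sparse) blast
  have pK: "K ^ 48 * card LL \<le> b0" "K ^ 40 * card CC \<le> K * b0"
    using cLL cCC mult_le_mono1[OF s1_bounds(3), of "card LL"] mult_le_mono1[OF s2_bounds(3), of "card CC"] by linarith+
  \<comment> \<open>104000 is \<open>1600 * (1 + 64)\<close>: the 200 combines the factor 100 of the
    matchings with the half of the ball outside the big clusters, 8 comes from \<open>sparse\<close>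
    and 64 from \<open>Rsmall\<close>.\<close>
  have a: "K ^ 6 * (200 * ca) \<le> 104000 * b0"
  proof -
    have "K ^ 6 * (200 * ca) \<le> K ^ 6 * (200 * (8 * K ^ 3 * (card LL + card R)))" using ca by (intro mult_le_mono2) simp
    also have "\<dots> = 1600 * (K ^ 6 * K ^ 3) * (card LL + card R)" by (simp add: ac_simps)
    also have "K ^ 6 * K ^ 3 = K ^ 9" by (simp flip: power_add)
    also have "1600 * K ^ 9 * (card LL + card R) = 1600 * (K ^ 9 * card LL) + 1600 * (K ^ 9 * card R)" by (simp add: algebra_simps)
    also have "\<dots> \<le> 1600 * b0 + 1600 * (64 * b0)"
      using mult_le_mono1[OF pow_le[of 9 48], of "card LL"] pK(1) Rsmall by (intro add_mono mult_le_mono2) linarith+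
    finally show ?thesis by simp
  qed
  have b: "K ^ 13 * (200 * (kp * cb)) \<le> 3200 * b0"
  proof -
    have "K ^ 13 * (200 * (kp * cb)) \<le> K ^ 13 * (200 * (kp * (8 * K ^ 3 * (card LL + card CC))))"
      using cb by (intro mult_le_mono2)
    also have "\<dots> = 1600 * (K ^ 13 * K ^ 23 * K ^ 3) * (card LL + card CC)" unfolding kp_def by (simp only: ac_simps)
    also have "K ^ 13 * K ^ 23 * K ^ 3 = K ^ 39" by (simp flip: power_add)
    also have "1600 * K ^ 39 * (card LL + card CC) = 1600 * (K ^ 39 * card LL) + 1600 * (K ^ 39 * card CC)" by (simp add: algebra_simps)
    also have "\<dots> \<le> 1600 * b0 + 1600 * b0"
    proof (intro add_mono mult_le_mono2)
      show "K ^ 39 * card LL \<le> b0" using mult_le_mono1[OF pow_le[of 39 48], of "card LL"] pK(1) by linarith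
      have "K * (K ^ 39 * card CC) \<le> K * b0" using pK(2) by (simp flip: power_Suc add: mult.assoc[symmetric])
      then show "K ^ 39 * card CC \<le> b0" using K by simp
    qed
    finally show ?thesis by simp
  qed
  have "1000000 \<le> K ^ 2" using power_mono[OF K, of 2] by simp
  then have "1000000 \<le> K ^ 6" "1000000 \<le> K ^ 13" using pow_le[of 2 6] pow_le[of 2 13] by linarith+
  then have "1000000 * (200 * ca) \<le> 104000 * b0" "1000000 * (200 * (kp * cb)) \<le> 3200 * b0"
    using a b mult_le_mono1 le_trans by blast+
  then show False using b0le b0pos by linarith
qed

end

section \<open>The Ramsey number\<close>

context ugraph
begin

lemma has_cycle_mono: "has_cycle A l \<Longrightarrow> A \<subseteq> B \<Longrightarrow> has_cycle B l"
  unfolding has_cycle_def using pth_mono by blast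

text \<open>Expansion of single vertices gives the minimum degree, and expansion of a maximum
  independent set of a ball bounds its independence number by the size of the next ball. The stalled
  radius is at most \<open>2 * M\<close>, whence \<open>16 * M\<close>.\<close>

lemma cycle_of_expansion:
  assumes finV: "finite V" and yV: "y \<in> V" and K: "1000 \<le> K" "K ^ 50 \<le> l" and M: "16 * M + 16 \<le> l"
    and VM: "card V \<le> K ^ (M + 1)"
    and exp: "\<And>I. I \<subseteq> V \<Longrightarrow> I \<noteq> {} \<Longrightarrow> indep I \<Longrightarrow> (l - 1) * card I < card (I \<union> {v \<in> V. \<exists>u\<in>I. E u v})"
  shows "has_cycle V l"
proof (rule ccontr)
  assume noC: "\<not> has_cycle V l"
  obtain n where n: "n \<le> 2 * M" "card (ball V y (n + 2)) \<le> K * card (ball V y n)"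
    using ball_growth[OF finV yV VM] .
  have deg: "l \<le> Suc (card {u \<in> V. E v u})" if v: "v \<in> V" for v
  proof -
    have "indep {v}" using E_irrefl unfolding indep_def by simp
    then have "(l - 1) * card {v} < card ({v} \<union> {u \<in> V. \<exists>w\<in>{v}. E w u})" using v by (intro exp) auto
    moreover have "card ({v} \<union> {u \<in> V. \<exists>w\<in>{v}. E w u}) \<le> Suc (card {u \<in> V. E v u})"
      by (simp add: card_insert_le_m1)
    ultimately show ?thesis by simp
  qed
  have alphaB: "(l - 1) * alpha (ball V y j) \<le> card (ball V y (Suc j))" for j
  proof -
    have BV: "ball V y i \<subseteq> V" for i by (rule ball_subset[OF yV])
    have finB: "finite (ball V y i)" for i using BV finV by (rule finite_subset)
    obtain I where I: "I \<subseteq> ball V y j" "indep I" "card I = alpha (ball V y j)" using alpha_ex[OF finB] .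
    have "ball V y j \<noteq> {}" using ball_center by blast
    then have "card I \<noteq> 0" using alpha_pos[OF finB, of j] I(3) by simp
    then have "I \<noteq> {}" by (intro notI) simp
    then have "(l - 1) * card I < card (I \<union> {v \<in> V. \<exists>u\<in>I. E u v})" using I(1,2) BV by (intro exp) blast+
    also have "\<dots> \<le> card (ball V y (Suc j))" using I(1) by (intro card_mono finB) auto
    finally show ?thesis using I(3) by simp
  qed
  interpret stalled_ball E V y l K n
    using finV yV noC deg K n M alphaB by unfold_locales auto
  show False by (rule contradiction)
qed

text \<open>
  In a minimal counterexample every independent set \<open>I\<close> has a closed neighbourhood with more than
  \<open>(l - 1) * card I\<close> vertices, since removing it leaves a smaller counterexample.
\<close>

lemma cycle_of_small_alpha:
  assumes K: "1000 \<le> K" "K ^ 50 \<le> l" and M: "16 * M + 16 \<le> l"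
    and "finite V" "alpha V < n" "(l - 1) * (n - 1) + 1 \<le> card V" "(l - 1) * (n - 1) + 1 \<le> K ^ (M + 1)"
  shows "has_cycle V l"
  using assms(4-)
proof (induction n arbitrary: V rule: less_induct)
  case (less n)
  obtain U where U: "U \<subseteq> V" "card U = (l - 1) * (n - 1) + 1" "finite U"
    by (meson less.prems(3) obtain_subset_with_card_n)
  have aU: "alpha U < n" using alpha_mono[OF less.prems(1) U(1)] less.prems(2) by simp
  have "has_cycle U l"
  proof (rule ccontr)
    assume noC: "\<not> has_cycle U l"
    have "U \<noteq> {}" using U(2) by auto
    then obtain y where y: "y \<in> U" by blast
    have "has_cycle U l"
    proof (rule cycle_of_expansion[OF U(3) y K M])
      show "card U \<le> K ^ (M + 1)" using U(2) less.prems(4) by simp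
      fix I assume I: "I \<subseteq> U" "I \<noteq> {}" "indep I"
      define N where "N = I \<union> {v \<in> U. \<exists>u\<in>I. E u v}"
      show "(l - 1) * card I < card (I \<union> {v \<in> U. \<exists>u\<in>I. E u v})"
      proof (rule ccontr)
        assume "\<not> ?thesis"
        then have cN: "card N \<le> (l - 1) * card I" unfolding N_def by simp
        have finI: "finite I" using I(1) U(3) by (rule finite_subset)
        have NU: "N \<subseteq> U" unfolding N_def using I(1) by blast
        have cI: "1 \<le> card I" "card I < n" using I finI alpha_ge[OF U(3) I(1,3)] aU by (auto simp: Suc_le_eq card_gt_0_iff)
        define W where "W = U - N"
        have finW: "finite W" unfolding W_def using U(3) by simp
        have "alpha I + alpha W \<le> alpha (I \<union> W)"
          unfolding W_def N_def using finI U(3) by (intro alpha_nadj) (auto simp: nadj_def)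
        also have "\<dots> \<le> alpha U" unfolding W_def using I(1) U(3) by (intro alpha_mono) auto
        finally have aW: "alpha W < n - card I" using alpha_ge[OF finI subset_refl I(3)] aU by linarith
        have "card W = card U - card N" unfolding W_def using NU U(3) by (meson card_Diff_subset finite_subset)
        moreover obtain k where k: "n = card I + Suc k" using cI(2) by (metis less_iff_Suc_add add_Suc_right)
        then have "(l - 1) * (n - 1) = (l - 1) * card I + (l - 1) * (n - card I - 1)" by (simp add: add_mult_distrib2)
        ultimately have cW: "(l - 1) * (n - card I - 1) + 1 \<le> card W" using U(2) cN by linarith
        have "(l - 1) * (n - card I - 1) \<le> (l - 1) * (n - 1)" by (intro mult_le_mono2) simp
        then have "(l - 1) * (n - card I - 1) + 1 \<le> K ^ (M + 1)" using less.prems(4) by linarith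
        then have "has_cycle W l" using less.IH[of "n - card I" W] cI finW aW cW by simp
        then show False using noC has_cycle_mono unfolding W_def by blast
      qed
    qed
    then show False using noC by simp
  qed
  then show ?case using has_cycle_mono U(1) by blast
qed

end

text \<open>Red edges play the role of \<open>E\<close>, so \<open>n\<close> independent vertices
  form a blue clique.\<close>

lemma ramsey_property_upper:
  assumes "1000 \<le> K" "K ^ 50 \<le> l" "16 * M + 16 \<le> l" "(l - 1) * (n - 1) + 1 \<le> K ^ (M + 1)"
  shows "ramsey_property (cycle_graph l) (complete_graph n) ((l - 1) * (n - 1) + 1)"
  unfolding ramsey_property_def
proof (intro allI impI)
  define N where "N = (l - 1) * (n - 1) + 1"
  fix R :: "nat set set" assume R: "R \<subseteq> edges (complete_graph N)"
  define E where "E x y \<longleftrightarrow> {x, y} \<in> R" for x y :: nat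
  have inR: "card e = 2" if "e \<in> R" for e
    using that R unfolding edges_def complete_graph_def nsets_def by auto
  interpret ugraph E
  proof
    show "E y x" if "E x y" for x y using that unfolding E_def by (simp add: insert_commute)
    show "\<not> E x x" for x using inR[of "{x, x}"] unfolding E_def by auto
  qed
  have verts: "verts (complete_graph N) = {..<N}" unfolding verts_def complete_graph_def by simp
  show "contains_copy (verts (complete_graph N), R) (cycle_graph l) \<or>
    contains_copy (verts (complete_graph N), edges (complete_graph N) - R) (complete_graph n)"
  proof (cases "alpha {..<N} < n")
    case True
    have "has_cycle {..<N} l"
      by (rule cycle_of_small_alpha[OF assms(1-3) _ True]) (use assms(4) in \<open>simp_all add: N_def\<close>)
    then obtain xs where xs: "pth {..<N} xs" "length xs = l" "E (last xs) (hd xs)" unfolding has_cycle_def by blast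
    have d: "distinct xs" "set xs \<subseteq> {..<N}" "successively E xs" "xs \<noteq> []" using xs(1) unfolding pth_def by auto
    have e: "{xs ! i, xs ! ((i + 1) mod l)} \<in> R" if i: "i < l" for i
    proof (cases "Suc i < l")
      case True
      then have "E (xs ! i) (xs ! Suc i)" using d(3) xs(2) by (simp add: successively_conv_nth)
      then show ?thesis using True unfolding E_def by simp
    next
      case False
      then have "Suc i = l" using i by simp
      then have "last xs = xs ! i" "hd xs = xs ! 0" using xs(2) d(4) by (auto simp: last_conv_nth hd_conv_nth)
      then show ?thesis using xs(3) \<open>Suc i = l\<close> unfolding E_def by simp
    qed
    have "contains_copy (verts (complete_graph N), R) (cycle_graph l)"
      unfolding contains_copy_def verts
    proof (intro exI[of _ "\<lambda>i. xs ! i"] conjI)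
      show "inj_on ((!) xs) (verts (cycle_graph l))"
        using d(1) xs(2) unfolding verts_def cycle_graph_def by (auto simp: inj_on_def nth_eq_iff_index_eq)
      have "xs ! i < N" if "i < l" for i using subsetD[OF d(2) nth_mem[of i xs]] xs(2) that by simp
      then show "(!) xs ` verts (cycle_graph l) \<subseteq> verts ({..<N}, R)"
        unfolding verts_def cycle_graph_def by auto
      show "\<forall>e\<in>edges (cycle_graph l). (!) xs ` e \<in> edges ({..<N}, R)"
        using e unfolding edges_def cycle_graph_def by auto
    qed
    then show ?thesis by simp
  next
    case False
    obtain I where I: "I \<subseteq> {..<N}" "indep I" "card I = alpha {..<N}" using alpha_ex[of "{..<N}"] by auto
    have "n \<le> card I" using False I(3) by simp
    then obtain I' where I': "I' \<subseteq> I" "card I' = n" "finite I'" by (rule obtain_subset_with_card_n)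
    obtain h where h: "bij_betw h {..<n} I'"
      using ex_bij_betw_nat_finite[OF I'(3)] I'(2) by (auto simp: atLeast0LessThan)
    have hI: "h i \<in> I'" if "i < n" for i using h that unfolding bij_betw_def by auto
    have "contains_copy (verts (complete_graph N), edges (complete_graph N) - R) (complete_graph n)"
      unfolding contains_copy_def verts
    proof (intro exI[of _ h] conjI ballI)
      show inj: "inj_on h (verts (complete_graph n))" using h unfolding verts_def complete_graph_def bij_betw_def by simp
      show "h ` verts (complete_graph n) \<subseteq> verts ({..<N}, edges (complete_graph N) - R)"
        using hI I' I(1) unfolding verts_def complete_graph_def by auto
      fix e assume "e \<in> edges (complete_graph n)"
      then have e: "e \<subseteq> {..<n}" "card e = 2" unfolding edges_def complete_graph_def nsets_def by auto
      then obtain i j where ij: "e = {i, j}" "i \<noteq> j" by (meson card_2_iff)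
      have lt: "i < n" "j < n" using e ij by auto
      have "h i \<noteq> h j" using h lt ij(2) unfolding bij_betw_def inj_on_def by auto
      moreover have "h i \<in> I" "h j \<in> I" using hI lt I'(1) by auto
      moreover then have "{h i, h j} \<notin> R" using I(2) unfolding indep_def E_def by auto
      ultimately show "h ` e \<in> edges ({..<N}, edges (complete_graph N) - R)"
        using I(1) ij unfolding edges_def complete_graph_def nsets_def by auto
    qed
    then show ?thesis by simp
  qed
qed

text \<open>Disjoint red cliques with \<open>l - 1\<close> vertices.\<close>

lemma ramsey_property_lower:
  assumes l: "2 \<le> l" and n: "1 \<le> n" and r: "ramsey_property (cycle_graph l) (complete_graph n) N"
  shows "(l - 1) * (n - 1) + 1 \<le> N"
proof (rule ccontr)
  assume "\<not> ?thesis"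
  then have N: "N \<le> (l - 1) * (n - 1)" by simp
  define R where "R = {{x, y} | x y. x < N \<and> y < N \<and> x \<noteq> y \<and> x div (l - 1) = y div (l - 1)}"
  have "R \<subseteq> edges (complete_graph N)" unfolding R_def edges_def complete_graph_def nsets_def by auto
  then consider "contains_copy (verts (complete_graph N), R) (cycle_graph l)"
    | "contains_copy (verts (complete_graph N), edges (complete_graph N) - R) (complete_graph n)"
    using r unfolding ramsey_property_def by blast
  then show False
  proof cases
    case 1
    then obtain h where h: "inj_on h {..<l}" "\<forall>e\<in>{{i, (i + 1) mod l} | i. i < l}. h ` e \<in> R"
      unfolding contains_copy_def verts_def edges_def cycle_graph_def by auto
    define b where "b = h 0 div (l - 1)"
    have same: "h i div (l - 1) = b" if "i < l" for i
      using that
    proof (induction i)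
      case (Suc i)
      then have "{i, Suc i} \<in> {{i, (i + 1) mod l} | i. i < l}" by force
      then have "h ` {i, Suc i} \<in> R" using h(2) by blast
      then have "h i div (l - 1) = h (Suc i) div (l - 1)" unfolding R_def by (auto simp: doubleton_eq_iff)
      then show ?case using Suc by simp
    qed (simp add: b_def)
    have "h i \<in> {b * (l - 1)..<b * (l - 1) + (l - 1)}" if "i < l" for i
    proof -
      have "h i = b * (l - 1) + h i mod (l - 1)" using div_mult_mod_eq[of "h i" "l - 1"] same[OF that] by simp
      moreover have "h i mod (l - 1) < l - 1" using l by simp
      ultimately show ?thesis unfolding atLeastLessThan_iff by linarith
    qed
    then have "h ` {..<l} \<subseteq> {b * (l - 1)..<b * (l - 1) + (l - 1)}" by blast
    then have "card (h ` {..<l}) \<le> card {b * (l - 1)..<b * (l - 1) + (l - 1)}" by (intro card_mono) auto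
    then show False using card_image[OF h(1)] l by simp
  next
    case 2
    then obtain h where h: "inj_on h {..<n}" "h ` {..<n} \<subseteq> {..<N}" "\<forall>e\<in>[{..<n}]\<^bsup>2\<^esup>. h ` e \<notin> R"
      unfolding contains_copy_def verts_def edges_def complete_graph_def by auto
    have hN: "h i < N" if "i < n" for i using h(2) that by auto
    have "inj_on (\<lambda>i. h i div (l - 1)) {..<n}"
    proof (rule inj_onI, rule ccontr)
      fix i j assume ij: "i \<in> {..<n}" "j \<in> {..<n}" "h i div (l - 1) = h j div (l - 1)" "i \<noteq> j"
      then have "h i \<noteq> h j" using h(1) unfolding inj_on_def by auto
      then have "{h i, h j} \<in> R" unfolding R_def using ij hN by auto
      moreover have "{i, j} \<in> [{..<n}]\<^bsup>2\<^esup>" using ij unfolding nsets_def by auto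
      ultimately show False using h(3) by fastforce
    qed
    moreover have "(\<lambda>i. h i div (l - 1)) ` {..<n} \<subseteq> {..<n - 1}"
    proof (intro image_subsetI)
      fix i assume "i \<in> {..<n}"
      then have "h i < (n - 1) * (l - 1)" using hN[of i] N by (simp add: mult.commute)
      then show "h i div (l - 1) \<in> {..<n - 1}" by (simp add: less_mult_imp_div_less)
    qed
    ultimately have "card {..<n} \<le> card {..<n - 1}" by (rule card_inj_on_le) simp
    then show False using n by simp
  qed
qed

section \<open>Choice of the parameters\<close>

lemma ex_nat_root:
  fixes l :: nat
  obtains K where "K ^ 50 \<le> l" "l < (K + 1) ^ 50"
proof -
  define K where "K = (LEAST k. l < (k + 1) ^ 50)"
  have "(l + 1) ^ 1 \<le> (l + 1) ^ 50" by (rule power_increasing) auto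
  then have "l < (l + 1) ^ 50" by simp
  then have K: "l < (K + 1) ^ 50" unfolding K_def by (rule LeastI)
  have "K ^ 50 \<le> l"
  proof (cases K)
    case (Suc k)
    then have "\<not> l < (k + 1) ^ 50" using not_less_Least[of k "\<lambda>k. l < (k + 1) ^ 50"] unfolding K_def by simp
    then show ?thesis using Suc by simp
  qed simp
  then show ?thesis using that K by blast
qed

text \<open>The tangent of \<open>ln\<close> at 4 together with \<open>ln 2 \<ge> 1 / 2\<close>. It
  is applied to both iterated logarithms of \<open>n\<close>.\<close>

lemma log2_upper:
  fixes t :: real
  assumes "0 < t"
  shows "log 2 t \<le> t / 2 + 2"
proof -
  have "ln (1 / 2 :: real) \<le> 1 / 2 - 1" by (intro ln_le_minus_one) simp
  then have l2: "1 / 2 \<le> ln (2 :: real)" by (simp add: ln_div)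
  have "ln (t / 4) \<le> t / 4 - 1" using assms by (intro ln_le_minus_one) simp
  then have "ln t \<le> ln (2 ^ 2) + t / 4" using assms by (simp add: ln_div)
  also have "ln (2 ^ 2 :: real) = 2 * ln 2" by (subst ln_realpow) simp_all
  also have "t / 4 \<le> t / 2 * ln 2" using mult_left_mono[OF l2, of "t / 2"] assms by simp
  finally have "ln t \<le> (t / 2 + 2) * ln 2" by (simp add: algebra_simps)
  then show ?thesis using l2 by (simp add: log_def divide_le_eq)
qed

text \<open>With \<open>x = log n\<close> and \<open>L = log log n\<close>, the bound on
  \<open>l\<close> yields \<open>log l \<ge> L / 4\<close>, so \<open>l * log l\<close> is a large
  multiple of \<open>x\<close>. For \<open>K\<close> the 50th root of \<open>l\<close> rounded down
  and \<open>M + 1 = l div 16\<close>, this gives \<open>l * n \<le> K ^ (M + 1)\<close>.\<close>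

lemma parameters:
  fixes n l :: nat
  assumes n: "3 \<le> n" and l: "4 * 1001 ^ 50 * (log 2 (real n) / log 2 (log 2 (real n))) \<le> real l"
  obtains K M where "1000 \<le> K" "K ^ 50 \<le> l" "16 * M + 16 \<le> l" "(l - 1) * (n - 1) + 1 \<le> K ^ (M + 1)"
proof -
  define x where "x = log 2 (real n)"
  define L where "L = log 2 x"
  have x1: "1 < x" unfolding x_def using n by simp
  have L0: "0 < L" unfolding L_def using x1 by simp
  \<comment> \<open>\<open>1001 ^ 50\<close> secures \<open>K \<ge> 1000\<close>; the factor 4 makes
    up for \<open>x / L\<close>, which is bounded below by 1/3.\<close>
  define C :: real where "C = 4 * 1001 ^ 50"
  have C: "102400 \<le> C" unfolding C_def by simp
  have lC: "C * (x / L) \<le> real l" using l unfolding C_def x_def L_def by simp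
  have "L \<le> 3 * x" using log2_upper[of x] x1 unfolding L_def by linarith
  then have "1 / 3 \<le> x / L" using L0 by (simp add: field_simps)
  then have "C * (1 / 3) \<le> C * (x / L)" using C by (intro mult_left_mono) auto
  then have "real (1001 ^ 50) \<le> real l" using lC unfolding C_def by simp
  then have l1001: "1001 ^ 50 \<le> l" by (simp only: of_nat_le_iff)
  have "(6400 :: nat) \<le> 1001 ^ 50" by simp
  then have l6400: "6400 \<le> l" using l1001 by (rule le_trans)
  have "log 2 (C * (x / L)) \<le> log 2 (real l)" using lC C x1 L0 by (intro log_mono) auto
  moreover have "log 2 (C * (x / L)) = log 2 C + L - log 2 L" using C x1 L0
    by (simp add: log_mult_pos log_divide_pos flip: L_def)
  moreover have "log 2 8 \<le> log 2 C" using C by (intro log_mono) auto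
  moreover have "log 2 8 = (3 :: real)" using log_pow_cancel[of 2 3] by simp
  ultimately have lx: "L / 4 \<le> log 2 (real l)" using log2_upper[OF L0] L0 by linarith
  have "102400 * x / 4 \<le> C * (x / L) * (L / 4)" using C x1 L0 by simp
  also have "\<dots> \<le> real l * log 2 (real l)" using lC lx L0 C x1 by (intro mult_mono) auto
  finally have xl: "6400 * x \<le> real l * log 2 (real l)" using x1 by simp
  obtain K where K: "K ^ 50 \<le> l" "l < (K + 1) ^ 50" using ex_nat_root .
  have "1001 ^ 50 < (K + 1) ^ 50" using l1001 K(2) by (rule le_less_trans)
  then have "1001 < K + 1" by (rule power_less_imp_less_base) simp
  then have K1: "1000 \<le> K" by simp
  \<comment> \<open>Rounding is undone crudely by \<open>l < (K + 1) ^ 50 \<le> K ^ 100\<close>, so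
    \<open>log K\<close> is at least a hundredth of \<open>log l\<close>.\<close>
  have "K + 1 \<le> K * K" using K1 mult_le_mono1[of 2 K K] by linarith
  then have "(K + 1) ^ 50 \<le> (K * K) ^ 50" by (rule power_mono) simp
  also have "(K * K) ^ 50 = K ^ 100" by (simp flip: power2_eq_square power_mult)
  finally have "l \<le> K ^ 100" using K(2) by simp
  then have "real l \<le> real K ^ 100" by (metis of_nat_le_iff of_nat_power)
  then have "log 2 (real l) \<le> log 2 (real K ^ 100)" using l6400 by (intro log_mono) auto
  then have lK: "log 2 (real l) \<le> 100 * log 2 (real K)" using K1 by (simp add: log_nat_power)
  define d where "d = l div 16"
  have "l < 16 + d * 16" unfolding d_def by (rule dividend_less_div_times) simp
  then have "l \<le> 32 * d" using l6400 by linarith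
  then have ld: "real l / 32 \<le> real d" by linarith
  have logl: "0 \<le> log 2 (real l)" using l6400 by simp
  have "log 2 (real l) + x \<le> real l * log 2 (real l) / 3200"
  proof -
    have "6400 * log 2 (real l) \<le> real l * log 2 (real l)" using l6400 logl by (intro mult_right_mono) auto
    then show ?thesis using xl by linarith
  qed
  also have "\<dots> = real l / 32 * (log 2 (real l) / 100)" by simp
  also have "\<dots> \<le> real d * log 2 (real K)" using ld lK logl by (intro mult_mono) auto
  also have "\<dots> = log 2 (real K ^ d)" using K1 by (simp add: log_nat_power)
  finally have "log 2 (real l) + x \<le> log 2 (real K ^ d)" .
  moreover have "log 2 (real l * real n) = log 2 (real l) + x" unfolding x_def using l6400 n by (simp add: log_mult)
  ultimately have "log 2 (real l * real n) \<le> log 2 (real K ^ d)" by simp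
  then have "real l * real n \<le> real K ^ d" using l6400 n K1 by (subst (asm) log_le_cancel_iff) auto
  then have "real (l * n) \<le> real (K ^ d)" by simp
  then have lnK: "l * n \<le> K ^ d" by (simp only: of_nat_le_iff)
  have "(l - 1) * (n - 1) + 1 \<le> l * n"
  proof -
    obtain l' n' where "l = Suc l'" "n = Suc n'" using l6400 n by (metis Suc_le_D numeral_3_eq_3 numeral_eq_Suc)
    then show ?thesis by simp
  qed
  moreover have "d \<ge> 1" unfolding d_def using l6400 by (simp add: Suc_le_eq div_greater_zero_iff)
  then have d1: "d = (d - 1) + 1" by simp
  ultimately have "(l - 1) * (n - 1) + 1 \<le> K ^ ((d - 1) + 1)" using lnK by simp
  moreover have "d * 16 \<le> l" unfolding d_def by simp
  then have "16 * (d - 1) + 16 \<le> l" using d1 by linarith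
  ultimately show ?thesis using that[OF K1 K(1)] by blast
qed

theorem theorem1p1:
  shows "\<exists>C::real. C \<ge> 1 \<and>
    (\<forall>n l :: nat. n \<ge> 3 \<longrightarrow> l \<ge> 3 \<longrightarrow>
       real l \<ge> C * (log 2 (real n) / log 2 (log 2 (real n))) \<longrightarrow>
       ramsey_number (cycle_graph l) (complete_graph n) = (l - 1) * (n - 1) + 1)"
proof (intro exI[of _ "4 * 1001 ^ 50 :: real"] conjI allI impI)
  fix n l :: nat
  assume nl: "3 \<le> n" "3 \<le> l" and l: "4 * 1001 ^ 50 * (log 2 (real n) / log 2 (log 2 (real n))) \<le> real l"
  obtain K M where "1000 \<le> K" "K ^ 50 \<le> l" "16 * M + 16 \<le> l" "(l - 1) * (n - 1) + 1 \<le> K ^ (M + 1)"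
    using parameters[OF nl(1) l] .
  then have "ramsey_property (cycle_graph l) (complete_graph n) ((l - 1) * (n - 1) + 1)"
    by (rule ramsey_property_upper)
  then show "ramsey_number (cycle_graph l) (complete_graph n) = (l - 1) * (n - 1) + 1"
    unfolding ramsey_number_def using ramsey_property_lower nl by (intro Least_equality) auto
qed simp

end
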